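(* Fix $\rho>0$ and assume $(n-d)/d\to\rho$ as $n\to\infty$. Define $$ g_\rho(r):=(\rho+1)\ln(\rho+1)-\rho\ln\rho-\frac{r^2}{2}+\rho\ln\Phi(r),\qquad r\in\mathbb{R}, $$ where $\Phi$ is the cumulative distribution function of a standard normal random variable. Then there exist $r_\ell,r_u\in\mathbb{R}$, defined as $$ r_\ell:=\inf\{r\in\mathbb{R}:g_\rho(r)>0\}\qquad\text{and}\qquad r_u:=\sup\{r\in\mathbb{R}:g_\rho(r)>0\}, $$ such that, for fixed $r\in\mathbb{R}$, $$ \lim_{n\to\infty}F_{[-1,r/\sqrt d]}=\begin{cases}\infty,& r>r_\ell\\ 0,& r<r_\ell,\end{cases}\qquad\text{and}\qquad \lim_{n\to\infty}F_{[r/\sqrt d,1]}=\begin{cases}\infty,& r<r_u\\ 0,& r>r_u.\end{cases} $$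
   Context: Asymptotic setting: $\mathbb{N}\ni n\to\infty$ and $d=d(n)\in\{2,\ldots,n-1\}$ is a function of $n$ which is either constant or tends to infinity. Let $X_1,\ldots,X_n$ be i.i.d. random vectors uniformly distributed on the unit sphere $\mathbb{S}^{d-1}\subset\mathbb{R}^d$, and let $P_{n,d}=[X_1,\ldots,X_n]$ be their convex hull. A facet ($(d-1)$-dimensional face) of $P_{n,d}$ has height $h\in[-1,1]$ if its supporting hyperplane is $\{x\in\mathbb{R}^d:\langle x,u\rangle=h\}$ for some $u\in\mathbb{S}^{d-1}$ and $P_{n,d}\subset\{x:\langle x,u\rangle\le h\}$ (heights can be negative). For $-1\le h_1\le h_2\le1$, $F_{[h_1,h_2]}=\mathbb{E}\,\#\{\text{facets of }P_{n,d}\text{ with height in }[h_1,h_2]\}$. *)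

theory Defs
  imports "HOL-Probability.Probability" "HOL-Library.Function_Algebras"
begin

text \<open>
  The dimension \<open>d\<close> varies inside the limit, so \<open>\<real>\<^sup>d\<close> is the carrier of the library topology
  \<open>Euclidean_space d\<close> on \<open>nat \<Rightarrow> real\<close>, that is \<open>{x. \<forall>i\<ge>d. x i = 0}\<close>. Pointwise scalar
  multiplication completes the pointwise addition of \<open>Function_Algebras\<close> to a real vector space, so
  that convex hulls, affine hulls and faces are those of the library. The metric that the library
  puts on functions is not the Euclidean one and is not used.
\<close>

instantiation "fun" :: (type, real_vector) real_vector
begin

definition scaleR_fun :: "real \<Rightarrow> ('a \<Rightarrow> 'b) \<Rightarrow> 'a \<Rightarrow> 'b"
  where "scaleR_fun c f = (\<lambda>x. c *\<^sub>R f x)"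

instance
  by standard (auto simp: scaleR_fun_def plus_fun_def scaleR_add_right scaleR_add_left)

end

definition inner_dim :: "nat \<Rightarrow> (nat \<Rightarrow> real) \<Rightarrow> (nat \<Rightarrow> real) \<Rightarrow> real"
  where "inner_dim d x y = (\<Sum>i<d. x i * y i)"

definition norm_dim :: "nat \<Rightarrow> (nat \<Rightarrow> real) \<Rightarrow> real"
  where "norm_dim d x = sqrt (inner_dim d x x)"

definition unit_sphere :: "nat \<Rightarrow> (nat \<Rightarrow> real) set"
  where "unit_sphere d = {u \<in> topspace (Euclidean_space d). norm_dim d u = 1}"

text \<open>
  Normalized surface measure as the cone measure: the radial projection \<open>x \<mapsto> x / \<parallel>x\<parallel>\<close> of the
  normalized Lebesgue measure on the unit ball. The \<open>if\<close> passes from the extensional functions on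
  \<open>{..<d}\<close> that carry the product measure to functions that vanish outside \<open>{..<d}\<close>; the value at
  the origin is irrelevant.
\<close>

definition uniform_sphere :: "nat \<Rightarrow> (nat \<Rightarrow> real) measure"
  where "uniform_sphere d =
    distr
      (uniform_measure (\<Pi>\<^sub>M i\<in>{..<d}. lborel)
        {x \<in> space (\<Pi>\<^sub>M i\<in>{..<d}. lborel). norm_dim d x \<le> 1})
      borel
      (\<lambda>x i. if i < d then x i / norm_dim d x else 0)"

definition iid_uniform_sphere :: "'a measure \<Rightarrow> nat \<Rightarrow> nat \<Rightarrow> (nat \<Rightarrow> 'a \<Rightarrow> nat \<Rightarrow> real) \<Rightarrow> bool"
  where "iid_uniform_sphere M n d X \<longleftrightarrow>
    prob_space M \<and>
    prob_space.indep_vars M (\<lambda>_. borel) X {..<n} \<and>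
    (\<forall>i<n. distr M borel (X i) = uniform_sphere d)"

text \<open>
  The library's \<open>aff_dim\<close> is restricted to types of class \<open>euclidean_space\<close>; this is its defining
  condition.
\<close>

definition has_aff_dim :: "'a::real_vector set \<Rightarrow> nat \<Rightarrow> bool"
  where "has_aff_dim S k \<longleftrightarrow>
    (\<exists>B. affine hull B = affine hull S \<and> \<not> affine_dependent B \<and> card B = k + 1)"

definition facets :: "nat \<Rightarrow> (nat \<Rightarrow> real) set \<Rightarrow> (nat \<Rightarrow> real) set set"
  where "facets d P = {G. G face_of P \<and> has_aff_dim G (d - 1)}"

definition has_height :: "nat \<Rightarrow> (nat \<Rightarrow> real) set \<Rightarrow> (nat \<Rightarrow> real) set \<Rightarrow> real \<Rightarrow> bool"
  where "has_height d P G h \<longleftrightarrow>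
    (\<exists>u\<in>unit_sphere d.
      G = P \<inter> {x \<in> topspace (Euclidean_space d). inner_dim d x u = h} \<and>
      P \<subseteq> {x \<in> topspace (Euclidean_space d). inner_dim d x u \<le> h})"

definition random_polytope :: "nat \<Rightarrow> (nat \<Rightarrow> 'a \<Rightarrow> nat \<Rightarrow> real) \<Rightarrow> 'a \<Rightarrow> (nat \<Rightarrow> real) set"
  where "random_polytope n X \<omega> = convex hull ((\<lambda>i. X i \<omega>) ` {..<n})"

definition expected_facets ::
    "'a measure \<Rightarrow> nat \<Rightarrow> nat \<Rightarrow> (nat \<Rightarrow> 'a \<Rightarrow> nat \<Rightarrow> real) \<Rightarrow> real \<Rightarrow> real \<Rightarrow> ennreal"
  where "expected_facets M n d X h1 h2 =
    (\<integral>\<^sup>+\<omega>. of_nat (card {G \<in> facets d (random_polytope n X \<omega>).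
        \<exists>h\<in>{h1..h2}. has_height d (random_polytope n X \<omega>) G h}) \<partial>M)"

definition std_normal_cdf :: "real \<Rightarrow> real"
  where "std_normal_cdf = cdf std_normal_distribution"

definition g_rate :: "real \<Rightarrow> real \<Rightarrow> real"
  where "g_rate \<rho> r =
    (\<rho> + 1) * ln (\<rho> + 1) - \<rho> * ln \<rho> - r\<^sup>2 / 2 + \<rho> * ln (std_normal_cdf r)"

definition r_lower :: "real \<Rightarrow> real"
  where "r_lower \<rho> = Inf {r. g_rate \<rho> r > 0}"

definition r_upper :: "real \<Rightarrow> real"
  where "r_upper \<rho> = Sup {r. g_rate \<rho> r > 0}"

end

theory Submission
  imports Defs "HOL-Real_Asymp.Real_Asymp"
begin

text \<open>
  The hyperplane through \<open>d\<close> uniform points is studied by feeding the points one by one into the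
  Gram--Schmidt process. Let \<open>w\<^sub>k\<close> be the vector of least norm with \<open>\<langle>x\<^sub>j, w\<^sub>k\<rangle> = 1\<close> for \<open>j < k\<close>. By rotation
  invariance \<open>\<parallel>w\<^sub>k\<parallel>\<^sup>2\<close> is a Markov chain, and completing a square shows that the expectation of
  \<open>(1 - h\<^sup>2 \<parallel>w\<^sub>k\<parallel>\<^sup>2)\<^sub>+\<close> to the power \<open>(d - 1 - k) / 2\<close> gains a factor \<open>(1 - h\<^sup>2)\<close> to the power \<open>d / 2 - 1\<close>
  in every step. Hence the affine hull of \<open>d - 1\<close> points has distance more than \<open>h\<close> from the origin with
  probability \<open>(1 - h\<^sup>2)\<close> to the power \<open>(d - 1) (d / 2 - 1)\<close>, and for \<open>h = r / \<surd>d\<close> the last point changes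
  this by subexponential factors only. So the tail at \<open>r / \<surd>d\<close> decays like \<open>exp (- d r\<^sup>2 / 2)\<close>.

  Almost surely the facets correspond to the \<open>d\<close>-subsets whose hyperplane has all remaining points on
  one side; at signed height \<open>h\<close> this has conditional probability \<open>F\<^sub>d(h)\<close> to the power \<open>n - d\<close>, where \<open>F\<^sub>d\<close>
  is the distribution function of a coordinate on the sphere and \<open>F\<^sub>d(r / \<surd>d) \<longlonglongrightarrow> \<Phi>(r)\<close>. Together with the
  rate of the binomial coefficient the exponents add up to \<open>g\<^sub>\<rho>\<close>. Finitely many short windows of heights
  with \<open>g\<^sub>\<rho> < 0\<close> give the limit \<open>0\<close>, a single window with \<open>g\<^sub>\<rho> > 0\<close> gives \<open>\<infinity>\<close>, and \<open>g\<^sub>\<rho>\<close> is negative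
  outside \<open>[r\<^sub>\<ell>, r\<^sub>u]\<close> because it increases up to \<open>0\<close> and is concave from \<open>0\<close> on.
\<close>


subsection \<open>Lebesgue measure on finite powers of the real line\<close>

text \<open>No density of the height is ever computed. A closed formula exists because exponents
  agree: the density of the projection of a uniform point to \<open>k\<close> coordinates carries
  the power \<open>(d - k) / 2 - 1\<close>, and this is also the power of the quantity whose
  expectation is taken after the step. The two powers merge, and the integral over the resulting
  ellipsoid returns the power \<open>(d - k) / 2 - 1 / 2\<close>, which belongs to the state before
  the step. After \<open>d - 1\<close> points the power is 0, that is, an indicator. One point more
  would need the power -1/2, so the last point is treated by inequalities: it can only decrease the
  distance, and at heights of order \<open>1 / sqrt d\<close> it keeps the hyperplane far enough
  away with at least polynomially small probability. Upper bounds for a window of heights treat the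
  two factors separately, the distance at the end nearest to 0 and the cap probability at the right
  end; continuity makes this sharp as windows shrink. A facet may carry more than \<open>d\<close>
  of the points. The facet count is therefore enclosed between sums over open and over closed
  half-spaces, whose expectations agree since hyperplanes are null sets.\<close>

abbreviation (input) lebn :: "nat set \<Rightarrow> (nat \<Rightarrow> real) measure"
  where "lebn I \<equiv> PiM I (\<lambda>_. lborel)"

definition sqs :: "nat set \<Rightarrow> (nat \<Rightarrow> real) \<Rightarrow> real"
  where "sqs I x = (\<Sum>i\<in>I. (x i)\<^sup>2)"

interpretation lebn: product_sigma_finite "\<lambda>_::nat. lborel :: real measure"
  by (simp add: product_sigma_finite_def lborel.sigma_finite_measure_axioms)

lemma sqs_nonneg [simp]: "0 \<le> sqs I x"
  by (simp add: sqs_def sum_nonneg)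

lemma measurable_sqs [measurable]: "sqs I \<in> borel_measurable (lebn I)"
proof -
  have [measurable]: "(\<lambda>x. x i) \<in> borel_measurable (lebn I)" if "i \<in> I" for i
    using measurable_component_singleton[OF that, of "\<lambda>_. lborel :: real measure"] by simp
  show ?thesis
    unfolding sqs_def by measurable
qed

lemma measurable_update_lebn:
  assumes "i \<in> I" and "h \<in> borel_measurable (lebn I)"
  shows "(\<lambda>x. x(i := h x)) \<in> measurable (lebn I) (lebn I)"
  using assms by (intro measurable_fun_upd[where J=I]) (auto simp: measurable_lborel1)

text \<open>Fubini isolates coordinate \<open>i\<close>, where the one-dimensional affine
  substitution applies because \<open>t\<close> ignores that coordinate. Scalings, shears,
  reflections and the completion of the square below are all instances of this change of
  variables.\<close>

lemma nn_integral_lebn_affine_coordinate: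
  assumes I: "finite I" "i \<in> I" and c: "c \<noteq> 0"
    and [measurable]: "f \<in> borel_measurable (lebn I)" "t \<in> borel_measurable (lebn I)"
    and t: "\<And>x y. t (x(i := y)) = t x"
  shows "(\<integral>\<^sup>+x. f x \<partial>lebn I) = ennreal \<bar>c\<bar> * (\<integral>\<^sup>+x. f (x(i := t x + c * x i)) \<partial>lebn I)"
proof -
  define J where "J = I - {i}"
  have J: "finite J" "i \<notin> J" "I = insert i J"
    using I by (auto simp: J_def)
  have [measurable]: "(\<lambda>x. x i) \<in> borel_measurable (lebn I)"
    using measurable_component_singleton[OF I(2), of "\<lambda>_. lborel :: real measure"] by simp
  have [measurable]: "(\<lambda>x. x(i := t x + c * x i)) \<in> measurable (lebn I) (lebn I)"
    by (rule measurable_update_lebn) (use I in measurable)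
  have upd: "(\<lambda>y. x(i := y)) \<in> measurable lborel (lebn I)" if "x \<in> space (lebn J)" for x
    using measurable_component_update[OF that J(2)] unfolding J(3) .
  have "(\<integral>\<^sup>+x. f x \<partial>lebn I) = (\<integral>\<^sup>+x. (\<integral>\<^sup>+y. f (x(i := y)) \<partial>lborel) \<partial>lebn J)"
    unfolding J(3) by (rule lebn.product_nn_integral_insert[OF J(1,2)]) (simp flip: J(3))
  also have "\<dots> = (\<integral>\<^sup>+x. ennreal \<bar>c\<bar> * (\<integral>\<^sup>+y. f (x(i := t x + c * y)) \<partial>lborel) \<partial>lebn J)"
  proof (rule nn_integral_cong)
    fix x assume "x \<in> space (lebn J)"
    from upd[OF this] have [measurable]: "(\<lambda>y. f (x(i := y))) \<in> borel_measurable borel"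
      by (auto simp: measurable_lborel1)
    show "(\<integral>\<^sup>+y. f (x(i := y)) \<partial>lborel) = ennreal \<bar>c\<bar> * (\<integral>\<^sup>+y. f (x(i := t x + c * y)) \<partial>lborel)"
      by (subst nn_integral_real_affine[where c=c and t="t x"]) (use c in auto)
  qed
  \<comment> \<open>Since \<open>t\<close> does not see coordinate \<open>i\<close>, the integrand
    can be written in terms of the assembled point \<open>x(i := y)\<close>, which allows Fubini to
    be undone.\<close>
  also have "\<dots> = (\<integral>\<^sup>+x. ennreal \<bar>c\<bar> * (\<integral>\<^sup>+y. f ((x(i:=y))(i := t (x(i:=y)) + c * (x(i:=y)) i)) \<partial>lborel) \<partial>lebn J)"
    by (simp add: t)
  also have "\<dots> = ennreal \<bar>c\<bar> * (\<integral>\<^sup>+x. (\<integral>\<^sup>+y. f ((x(i:=y))(i := t (x(i:=y)) + c * (x(i:=y)) i)) \<partial>lborel) \<partial>lebn J)"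
  proof (rule nn_integral_cmult)
    interpret J: sigma_finite_measure "lebn J" by (rule lebn.sigma_finite) fact
    have [measurable]: "(\<lambda>(x, y). x(i := y)) \<in> measurable (lebn J \<Otimes>\<^sub>M lborel) (lebn I)"
      unfolding J(3) using measurable_add_dim[of i J "\<lambda>_. lborel :: real measure"] by (simp add: split_def)
    have "(\<lambda>z. (\<lambda>x. f (x(i := t x + c * x i))) (case z of (x, y) \<Rightarrow> x(i := y))) \<in> borel_measurable (lebn J \<Otimes>\<^sub>M lborel)"
      by measurable
    then show "(\<lambda>x. \<integral>\<^sup>+y. f ((x(i:=y))(i := t (x(i:=y)) + c * (x(i:=y)) i)) \<partial>lborel) \<in> borel_measurable (lebn J)"
      by (intro lborel.borel_measurable_nn_integral) (simp add: split_def)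
  qed
  also have "(\<integral>\<^sup>+x. (\<integral>\<^sup>+y. f ((x(i:=y))(i := t (x(i:=y)) + c * (x(i:=y)) i)) \<partial>lborel) \<partial>lebn J)
      = (\<integral>\<^sup>+x. f (x(i := t x + c * x i)) \<partial>lebn I)"
    unfolding J(3)
    by (rule lebn.product_nn_integral_insert[OF J(1,2), symmetric]) (simp flip: J(3))
  finally show ?thesis .
qed

lemma measurable_lebn_extend:
  assumes "\<And>i. i \<in> I \<Longrightarrow> (\<lambda>x. g x i) \<in> borel_measurable M" "\<And>x. x \<in> space M \<Longrightarrow> g x \<in> extensional I"
  shows "g \<in> measurable M (lebn I)"
  using assms by (intro measurable_PiM_single') (auto simp: PiE_def measurable_lborel1)

text \<open>One coordinate is scaled at a time; the induction runs over the set \<open>J\<close> of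
  coordinates already scaled inside the fixed index set \<open>I\<close>.\<close>

lemma nn_integral_lebn_scale:
  assumes I: "finite I" and c: "c > 0" and f[measurable]: "f \<in> borel_measurable (lebn I)"
  shows "(\<integral>\<^sup>+x. f x \<partial>lebn I)
    = ennreal (c ^ card I) * (\<integral>\<^sup>+x. f (\<lambda>i. if i \<in> I then c * x i else x i) \<partial>lebn I)"
proof -
  have coord[measurable]: "(\<lambda>x. x i) \<in> borel_measurable (lebn I)" if "i \<in> I" for i
    using measurable_component_singleton[OF that, of "\<lambda>_. lborel :: real measure"] by simp
  have meas: "(\<lambda>x i. if i \<in> J then c * x i else x i) \<in> measurable (lebn I) (lebn I)" if "J \<subseteq> I" for J
  proof (rule measurable_lebn_extend)
    fix i assume [simp]: "i \<in> I"
    show "(\<lambda>x. if i \<in> J then c * x i else x i) \<in> borel_measurable (lebn I)"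
      by (cases "i \<in> J") auto
  qed (use that in \<open>auto simp: space_PiM PiE_def extensional_def\<close>)
  have "(\<integral>\<^sup>+x. f x \<partial>lebn I)
    = ennreal (c ^ card J) * (\<integral>\<^sup>+x. f (\<lambda>i. if i \<in> J then c * x i else x i) \<partial>lebn I)" if "J \<subseteq> I" for J
    using finite_subset[OF that I] that
  proof (induction J rule: finite_induct)
    case empty
    then show ?case by simp
  next
    case (insert j J)
    let ?f = "\<lambda>x. f (\<lambda>i. if i \<in> J then c * x i else x i)"
    have [measurable]: "?f \<in> borel_measurable (lebn I)"
      using measurable_compose[OF meas f, of J] insert by auto
    have "(\<integral>\<^sup>+x. ?f x \<partial>lebn I) = ennreal \<bar>c\<bar> * (\<integral>\<^sup>+x. ?f (x(j := 0 + c * x j)) \<partial>lebn I)"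
      by (rule nn_integral_lebn_affine_coordinate) (use insert c I in auto)
    also have "(\<lambda>x. ?f (x(j := 0 + c * x j))) = (\<lambda>x. f (\<lambda>i. if i \<in> insert j J then c * x i else x i))"
      using insert by (intro ext arg_cong[of _ _ f]) auto
    finally show ?case
      using insert c by (simp add: ennreal_mult mult_ac)
  qed
  from this[of I] show ?thesis by simp
qed

text \<open>The cube with side \<open>1 / sqrt m\<close>, \<open>m = card J\<close>, lies in the
  ball and the ball lies in the cube \<open>[-1, 1]\<close>; the last claim is scaling by
  \<open>sqrt t\<close>. The volume itself is not evaluated: being positive, finite and homogeneous
  is enough.\<close>

lemma emeasure_lebn_ball:
  assumes J: "finite J" "J \<noteq> {}"
  shows "emeasure (lebn J) {x \<in> space (lebn J). sqs J x \<le> 1} \<noteq> 0"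
    and "emeasure (lebn J) {x \<in> space (lebn J). sqs J x \<le> 1} \<noteq> \<infinity>"
    and "t > 0 \<Longrightarrow> emeasure (lebn J) {x \<in> space (lebn J). sqs J x \<le> t}
      = ennreal (t powr (card J / 2)) * emeasure (lebn J) {x \<in> space (lebn J). sqs J x \<le> 1}"
proof -
  let ?m = "real (card J)"
  have m: "?m > 0" using J by (auto simp: card_gt_0_iff)
  let ?B = "{x \<in> space (lebn J). sqs J x \<le> 1}"
  have [measurable]: "{x \<in> space (lebn J). sqs J x \<le> t} \<in> sets (lebn J)" for t
    by measurable
  have "emeasure (lebn J) (PiE J (\<lambda>_. {0..1/sqrt ?m})) \<le> emeasure (lebn J) ?B"
  proof (rule emeasure_mono)
    show "PiE J (\<lambda>_. {0..1/sqrt ?m}) \<subseteq> ?B"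
    proof
      fix x assume x: "x \<in> PiE J (\<lambda>_. {0..1/sqrt ?m})"
      have "(x i)\<^sup>2 \<le> 1 / ?m" if "i \<in> J" for i
      proof -
        have "0 \<le> x i" "x i \<le> 1/sqrt ?m" using x that by (auto simp: PiE_def Pi_def)
        then have "(x i)\<^sup>2 \<le> (1/sqrt ?m)\<^sup>2" by (intro power_mono)
        then show ?thesis by (simp add: power_divide)
      qed
      then have "sqs J x \<le> (\<Sum>i\<in>J. 1 / ?m)" unfolding sqs_def by (rule sum_mono)
      also have "\<dots> = 1" using m by simp
      finally show "x \<in> ?B" using x by (auto simp: space_PiM PiE_def)
    qed
  qed simp
  moreover have "emeasure (lebn J) (PiE J (\<lambda>_. {0..1/sqrt ?m})) = ennreal ((1/sqrt ?m) ^ card J)"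
    using J by (subst lebn.emeasure_PiM) (auto simp: ennreal_power)
  moreover have "(1/sqrt ?m) ^ card J > 0" using m by simp
  ultimately show "emeasure (lebn J) ?B \<noteq> 0"
    by (metis ennreal_eq_0_iff le_zero_eq not_less)
  have "emeasure (lebn J) ?B \<le> emeasure (lebn J) (PiE J (\<lambda>_. {-1..1}))"
  proof (rule emeasure_mono)
    show "?B \<subseteq> PiE J (\<lambda>_. {-1..1})"
    proof
      fix x assume x: "x \<in> ?B"
      have "x i \<in> {-1..1}" if "i \<in> J" for i
      proof -
        have "(x i)\<^sup>2 \<le> sqs J x" unfolding sqs_def using J that by (intro member_le_sum) auto
        then have "(x i)\<^sup>2 \<le> 1" using x by auto
        then show ?thesis by (simp add: abs_square_le_1 abs_le_iff)
      qed
      then show "x \<in> PiE J (\<lambda>_. {-1..1})" using x by (auto simp: space_PiM PiE_def)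
    qed
    show "PiE J (\<lambda>_. {-1..1}) \<in> sets (lebn J)"
      using J by (intro sets_PiM_I_finite) auto
  qed
  also have "\<dots> = ennreal (2 ^ card J)"
    using J ennreal_power[of 2 "card J"] by (subst lebn.emeasure_PiM) (auto simp: ennreal_power)
  finally show "emeasure (lebn J) ?B \<noteq> \<infinity>"
    by (auto simp: top_unique)
  show "emeasure (lebn J) {x \<in> space (lebn J). sqs J x \<le> t}
      = ennreal (t powr (card J / 2)) * emeasure (lebn J) ?B" if t: "t > 0"
  proof -
    have "emeasure (lebn J) {x \<in> space (lebn J). sqs J x \<le> t}
        = (\<integral>\<^sup>+x. indicator {x \<in> space (lebn J). sqs J x \<le> t} x \<partial>lebn J)"
      by simp
    also have "\<dots> = ennreal (sqrt t ^ card J) *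
       (\<integral>\<^sup>+x. indicator {x \<in> space (lebn J). sqs J x \<le> t} (\<lambda>i. if i \<in> J then sqrt t * x i else x i) \<partial>lebn J)"
      by (rule nn_integral_lebn_scale) (use J t in auto)
    also have "(\<integral>\<^sup>+x. indicator {x \<in> space (lebn J). sqs J x \<le> t} (\<lambda>i. if i \<in> J then sqrt t * x i else x i) \<partial>lebn J)
       = (\<integral>\<^sup>+x. indicator ?B x \<partial>lebn J)"
    proof (rule nn_integral_cong)
      fix x assume x: "x \<in> space (lebn J)"
      have "sqs J (\<lambda>i. if i \<in> J then sqrt t * x i else x i) = t * sqs J x"
        using t by (simp add: sqs_def sum_distrib_left power_mult_distrib)
      moreover have "(\<lambda>i. if i \<in> J then sqrt t * x i else x i) \<in> space (lebn J)"
        using x by (auto simp: space_PiM PiE_def extensional_def)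
      ultimately show "(indicator {x \<in> space (lebn J). sqs J x \<le> t} (\<lambda>i. if i \<in> J then sqrt t * x i else x i) :: ennreal)
         = indicator ?B x"
        using x t by (auto simp: indicator_def)
    qed
    also have "sqrt t ^ card J = t powr (card J / 2)"
      using t by (simp add: powr_half_sqrt[symmetric] powr_powr powr_realpow[symmetric])
    finally show ?thesis by simp
  qed
qed

lemma nn_integral_powr_from_0:
  assumes p: "p > 0" and t: "0 \<le> t"
  shows "(\<integral>\<^sup>+v. ennreal (v powr (p - 1)) * indicator {0<..t} v \<partial>lborel) = ennreal (t powr p / p)"
proof -
  have "((\<lambda>v. v powr (p - 1)) has_integral (t powr (p - 1 + 1) / (p - 1 + 1))) {0..t}"
    using p t by (intro has_integral_powr_from_0) auto
  then have "((\<lambda>v. v powr (p - 1)) has_integral (t powr p / p)) {0<..t}"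
    by (subst has_integral_spike_set_eq[of _ "{0..t}"])
       (auto intro!: negligible_subset[OF negligible_sing[of 0]])
  then have "((\<lambda>v. v powr (p - 1) * indicator {0<..t} v) has_integral (t powr p / p)) UNIV"
    by (subst (asm) has_integral_restrict_UNIV[symmetric])
       (simp add: indicator_def of_bool_def if_distrib cong: if_cong)
  then have "(\<integral>\<^sup>+v. ennreal (v powr (p - 1) * indicator {0<..t} v) \<partial>lborel) = ennreal (t powr p / p)"
    by (rule nn_integral_has_integral_lborel[rotated 2]) auto
  then show ?thesis
    by (simp add: ennreal_mult' ennreal_indicator)
qed

text \<open>By homogeneity the squared norm has distribution function
  \<open>V * t powr (m / 2)\<close>, with \<open>m = card J\<close> and \<open>V\<close> the volume
  of the unit ball. A measure with density \<open>C * v powr (m / 2 - 1)\<close> has the same values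
  on half-lines, and these generate the Borel sets. The constant stays abstract because
  normalizations are always recovered from a total mass.\<close>

lemma nn_integral_lebn_polar:
  assumes J: "finite J" "J \<noteq> {}"
  obtains C where "C > 0"
    "\<And>\<Phi>. \<Phi> \<in> borel_measurable borel \<Longrightarrow> (\<integral>\<^sup>+x. \<Phi> (sqs J x) \<partial>lebn J)
       = ennreal C * (\<integral>\<^sup>+v. \<Phi> v * (ennreal (v powr (card J / 2 - 1)) * indicator {0<..} v) \<partial>lborel)"
proof -
  let ?p = "card J / 2"
  have p: "?p > 0" using J by (auto simp: card_gt_0_iff)
  define V where "V = measure (lebn J) {x \<in> space (lebn J). sqs J x \<le> 1}"
  have V: "emeasure (lebn J) {x \<in> space (lebn J). sqs J x \<le> 1} = ennreal V"
    unfolding V_def using emeasure_lebn_ball(2)[OF J] by (simp add: emeasure_eq_ennreal_measure)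
  have Vpos: "V > 0"
    using emeasure_lebn_ball(1)[OF J] unfolding V by (simp add: V_def zero_less_measure_iff)
  define C where "C = V * ?p"
  have C: "C > 0" using Vpos p by (simp add: C_def)
  let ?w = "\<lambda>v. ennreal C * (ennreal (v powr (?p - 1)) * indicator {0<..} v)"
  let ?A = "distr (lebn J) borel (sqs J)" and ?D = "density lborel ?w"
  have eqA: "emeasure ?A {..t} = emeasure (lebn J) {x \<in> space (lebn J). sqs J x \<le> t}" for t
    by (subst emeasure_distr) (auto intro!: arg_cong[where f="emeasure _"])
  have pos: "emeasure ?A {..t} = ennreal (t powr ?p * V)" if "t > 0" for t
    using emeasure_lebn_ball(3)[OF J that] Vpos by (simp add: eqA V ennreal_mult)
  have nonpos: "emeasure ?A {..t} = 0" if "t \<le> 0" for t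
  proof -
    have "emeasure ?A {..t} \<le> ennreal e" if e: "e > 0" for e
    proof -
      \<comment> \<open>The origin has no mass: \<open>s\<close> is chosen such that the ball
        \<open>sqs J x \<le> s\<close> has volume exactly \<open>e\<close>.\<close>
      define s where "s = (e / V) powr (1 / ?p)"
      have s: "s > 0" "s powr ?p = e / V"
        using e Vpos p by (auto simp: s_def powr_powr)
      have "emeasure ?A {..t} \<le> emeasure ?A {..s}"
        using s \<open>t \<le> 0\<close> by (intro emeasure_mono) auto
      then show ?thesis using pos[OF s(1)] s Vpos by simp
    qed
    then have "emeasure ?A {..t} \<le> 0"
      using ennreal_le_epsilon[of 0 "emeasure ?A {..t}"] by auto
    then show ?thesis by simp
  qed
  have D: "emeasure ?D {..t} = (if t > 0 then ennreal (t powr ?p * V) else 0)" for t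
  proof -
    have "emeasure ?D {..t} = (\<integral>\<^sup>+v. ?w v * indicator {..t} v \<partial>lborel)"
      by (subst emeasure_density) auto
    also have "\<dots> = ennreal C * (\<integral>\<^sup>+v. ennreal (v powr (?p - 1)) * indicator {0<..t} v \<partial>lborel)"
      by (subst nn_integral_cmult[symmetric]) (auto intro!: nn_integral_cong simp: indicator_def)
    also have "\<dots> = (if t > 0 then ennreal (t powr ?p * V) else 0)"
    proof (cases "t > 0")
      case True
      have "ennreal C * ennreal (t powr ?p / ?p) = ennreal (C * (t powr ?p / ?p))"
        using C p by (intro ennreal_mult[symmetric]) auto
      also have "C * (t powr ?p / ?p) = t powr ?p * V"
        unfolding C_def using p by simp
      finally show ?thesis
        using nn_integral_powr_from_0[OF p, of t] True by simp
    next
      case False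
      then show ?thesis by simp
    qed
    finally show ?thesis .
  qed
  have eq: "?A = ?D"
  proof (rule measure_eqI_generator_eq[where E="range (\<lambda>a. {..a::real})" and \<Omega>=UNIV and A="\<lambda>n::nat. {..real n}"])
    show "Int_stable (range (\<lambda>a. {..a::real}))"
      by (auto simp: Int_stable_def)
    show "sets ?A = sigma_sets UNIV (range (\<lambda>a. {..a::real}))"
      "sets ?D = sigma_sets UNIV (range (\<lambda>a. {..a::real}))"
      by (simp_all add: borel_eq_atMost[where 'a=real] sets_measure_of_conv)
    show "(\<Union>n. {..real n}) = UNIV"
      using real_arch_simple by auto
    fix X assume "X \<in> range (\<lambda>a. {..a::real})"
    then show "emeasure ?A X = emeasure ?D X"
      using pos nonpos D by (auto simp: not_less)
  next
    show "emeasure ?A {..real n} \<noteq> \<infinity>" for n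
      using pos[of "real n"] nonpos[of "real n"] by (cases "n = 0") auto
  qed auto
  show ?thesis
  proof (rule that[OF C])
    fix \<Phi> :: "real \<Rightarrow> ennreal" assume [measurable]: "\<Phi> \<in> borel_measurable borel"
    have "(\<integral>\<^sup>+x. \<Phi> (sqs J x) \<partial>lebn J) = (\<integral>\<^sup>+v. \<Phi> v \<partial>?A)"
      by (subst nn_integral_distr) auto
    also have "\<dots> = (\<integral>\<^sup>+v. ?w v * \<Phi> v \<partial>lborel)"
      unfolding eq by (subst nn_integral_density) auto
    also have "\<dots> = ennreal C * (\<integral>\<^sup>+v. \<Phi> v * (ennreal (v powr (?p - 1)) * indicator {0<..} v) \<partial>lborel)"
      by (subst nn_integral_cmult[symmetric]) (auto intro!: nn_integral_cong simp: mult_ac)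
    finally show "(\<integral>\<^sup>+x. \<Phi> (sqs J x) \<partial>lebn J)
       = ennreal C * (\<integral>\<^sup>+v. \<Phi> v * (ennreal (v powr (card J / 2 - 1)) * indicator {0<..} v) \<partial>lborel)" .
  qed
qed


subsection \<open>The uniform distribution on the sphere\<close>

definition sphere_proj :: "nat \<Rightarrow> (nat \<Rightarrow> real) \<Rightarrow> nat \<Rightarrow> real"
  where "sphere_proj d x = (\<lambda>i. if i < d then x i / norm_dim d x else 0)"

text \<open>Power of the positive part, with value 0 on \<open>t \<le> 0\<close> for every exponent.
  Exponent 0 therefore gives the indicator of the open half-line, and the singularity of a negative
  exponent at 0 is removed.\<close>

definition ppow :: "real \<Rightarrow> real \<Rightarrow> real"
  where "ppow t a = (if t > 0 then t powr a else 0)"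

lemma measurable_ppow [measurable]: "(\<lambda>t. ppow t a) \<in> borel_measurable borel"
  unfolding ppow_def by measurable

lemma ppow_nonneg [simp]: "0 \<le> ppow t a"
  by (simp add: ppow_def)

lemma ppow_mult: "0 < s \<Longrightarrow> ppow (s * t) a = s powr a * ppow t a"
  by (simp add: ppow_def powr_mult zero_less_mult_iff)

lemma measurable_lebn_coord: "i \<in> I \<Longrightarrow> (\<lambda>x. x i) \<in> borel_measurable (lebn I)"
  using measurable_component_singleton[of i I "\<lambda>_. lborel :: real measure"] by simp

lemma inner_dim_self: "inner_dim d x x = sqs {..<d} x"
  by (simp add: inner_dim_def sqs_def power2_eq_square)

lemma norm_dim_sqs: "norm_dim d x = sqrt (sqs {..<d} x)"
  by (simp add: norm_dim_def inner_dim_self)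

lemma measurable_sphere_proj [measurable]: "sphere_proj d \<in> measurable (lebn {..<d}) borel"
proof (rule measurable_coordinatewise_then_product)
  fix i
  have [measurable]: "(\<lambda>x. x i) \<in> borel_measurable (lebn {..<d})" if "i < d"
    using that by (intro measurable_lebn_coord) auto
  show "(\<lambda>x. sphere_proj d x i) \<in> borel_measurable (lebn {..<d})"
    unfolding sphere_proj_def norm_dim_sqs by (cases "i < d") auto
qed

lemma uniform_sphere_alt:
  "uniform_sphere d = distr (uniform_measure (lebn {..<d}) {x \<in> space (lebn {..<d}). sqs {..<d} x \<le> 1})
     borel (sphere_proj d)"
  by (simp add: uniform_sphere_def norm_dim_sqs sphere_proj_def[abs_def])

lemma sets_uniform_sphere [simp, measurable_cong]: "sets (uniform_sphere d) = sets borel"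
  by (simp add: uniform_sphere_def)

lemma space_uniform_sphere [simp]: "space (uniform_sphere d) = UNIV"
  by (simp add: uniform_sphere_def)

lemma nn_integral_uniform_sphere:
  assumes [measurable]: "f \<in> borel_measurable borel"
  shows "(\<integral>\<^sup>+x. f x \<partial>uniform_sphere d) =
    (\<integral>\<^sup>+x. f (sphere_proj d x) * indicator {x. sqs {..<d} x \<le> 1} x \<partial>lebn {..<d})
      / emeasure (lebn {..<d}) {x \<in> space (lebn {..<d}). sqs {..<d} x \<le> 1}"
proof -
  let ?B = "{x \<in> space (lebn {..<d}). sqs {..<d} x \<le> 1}"
  have [measurable]: "?B \<in> sets (lebn {..<d})" by measurable
  have "(\<integral>\<^sup>+x. f x \<partial>uniform_sphere d) = (\<integral>\<^sup>+x. f (sphere_proj d x) \<partial>uniform_measure (lebn {..<d}) ?B)"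
    unfolding uniform_sphere_alt by (subst nn_integral_distr) auto
  also have "\<dots> = (\<integral>\<^sup>+x. f (sphere_proj d x) * indicator ?B x \<partial>lebn {..<d}) / emeasure (lebn {..<d}) ?B"
    by (subst nn_integral_uniform_measure) auto
  also have "(\<integral>\<^sup>+x. f (sphere_proj d x) * indicator ?B x \<partial>lebn {..<d})
     = (\<integral>\<^sup>+x. f (sphere_proj d x) * indicator {x. sqs {..<d} x \<le> 1} x \<partial>lebn {..<d})"
    by (intro nn_integral_cong) (auto simp: indicator_def)
  finally show ?thesis .
qed

lemma prob_space_uniform_sphere: "0 < d \<Longrightarrow> prob_space (uniform_sphere d)"
  unfolding uniform_sphere_alt
proof (intro prob_space.prob_space_distr prob_space_uniform_measure)
  assume "0 < d"
  then have "{..<d} \<noteq> {}" by auto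
  then show "emeasure (lebn {..<d}) {x \<in> space (lebn {..<d}). sqs {..<d} x \<le> 1} \<noteq> 0"
     "emeasure (lebn {..<d}) {x \<in> space (lebn {..<d}). sqs {..<d} x \<le> 1} \<noteq> \<infinity>"
    by (intro emeasure_lebn_ball; simp)+
qed auto

text \<open>Unnormalized density of the first \<open>k\<close> coordinates of a uniform point of the
  sphere. At \<open>k = d - 1\<close> the exponent is -1/2 and the density is unbounded near the
  boundary of the ball.\<close>

abbreviation (input) marginal_weight :: "nat \<Rightarrow> nat \<Rightarrow> (nat \<Rightarrow> real) \<Rightarrow> ennreal"
  where "marginal_weight d k y \<equiv> ennreal (ppow (1 - sqs {..<k} y) (real (d - k) / 2 - 1))"

text \<open>
  The ball is split into the first \<open>k\<close> coordinates \<open>g\<close> and the remaining ones, which enter only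
  through the square \<open>v\<close> of their norm. In terms of \<open>u = \<parallel>g\<parallel>\<^sup>2 + v\<close> and \<open>y = g / \<surd>u\<close> the
  integral factorizes.
\<close>

lemma nn_integral_uniform_sphere_marginal:
  assumes k: "k < d"
  obtains c where "c > 0"
    "\<And>f. f \<in> borel_measurable (lebn {..<k}) \<Longrightarrow>
      (\<integral>\<^sup>+x. (f :: (nat \<Rightarrow> real) \<Rightarrow> ennreal) (restrict x {..<k}) \<partial>uniform_sphere d) =
      ennreal c * (\<integral>\<^sup>+y. f y * marginal_weight d k y \<partial>lebn {..<k})"
proof -
  let ?K = "{..<k}" and ?J = "{k..<d}" and ?D = "{..<d}"
  let ?p = "real (d - k) / 2"
  let ?sc = "\<lambda>c (g::nat \<Rightarrow> real) i. if i \<in> ?K then c * g i else g i"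
  have D: "?D = ?K \<union> ?J" and disj: "?K \<inter> ?J = {}" using k by auto
  have J: "finite ?J" "?J \<noteq> {}" using k by auto
  define V where "V = measure (lebn ?D) {x \<in> space (lebn ?D). sqs ?D x \<le> 1}"
  have Dne: "finite ?D" "?D \<noteq> {}" using k by auto
  have V: "emeasure (lebn ?D) {x \<in> space (lebn ?D). sqs ?D x \<le> 1} = ennreal V"
    unfolding V_def using emeasure_lebn_ball(2)[OF Dne] by (simp add: emeasure_eq_ennreal_measure)
  have Vpos: "V > 0"
    using emeasure_lebn_ball(1)[OF Dne] unfolding V by (simp add: V_def zero_less_measure_iff)
  obtain C where C: "C > 0" and polar: "\<And>\<Phi>. \<Phi> \<in> borel_measurable borel \<Longrightarrow> (\<integral>\<^sup>+x. \<Phi> (sqs ?J x) \<partial>lebn ?J)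
       = ennreal C * (\<integral>\<^sup>+v. \<Phi> v * (ennreal (v powr (card ?J / 2 - 1)) * indicator {0<..} v) \<partial>lborel)"
    by (rule nn_integral_lebn_polar[OF J]) (rule that)
  define c where "c = C * (2 / d) / V"
  have c: "c > 0" using C Vpos k by (simp add: c_def)
  interpret K: sigma_finite_measure "lebn ?K" by (rule lebn.sigma_finite) simp
  interpret P: pair_sigma_finite lborel "lebn ?K" by standard
  show ?thesis
  proof (rule that[OF c])
    fix f :: "(nat \<Rightarrow> real) \<Rightarrow> ennreal" assume f[measurable]: "f \<in> borel_measurable (lebn ?K)"
    let ?w = "\<lambda>y. ennreal (ppow (1 - sqs ?K y) (?p - 1))"
    define I where "I = (\<integral>\<^sup>+y. f y * ?w y \<partial>lebn ?K)"
    have restr: "(\<lambda>x. restrict x ?K) \<in> measurable borel (lebn ?K)"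
      by (rule measurable_lebn_extend) (simp_all add: extensional_def)
    have sc_space: "?sc a g \<in> space (lebn ?K)" if "g \<in> space (lebn ?K)" for a g
      using that by (auto simp: space_PiM PiE_def extensional_def)
    have sc_pair[measurable]: "(\<lambda>(a, g). ?sc a g) \<in> measurable (borel \<Otimes>\<^sub>M lebn ?K) (lebn ?K)"
    proof (rule measurable_lebn_extend)
      fix i assume i: "i \<in> ?K"
      have [measurable]: "(\<lambda>x. x i) \<in> borel_measurable (lebn ?K)"
        using i by (rule measurable_lebn_coord)
      show "(\<lambda>x. (case x of (a, g) \<Rightarrow> ?sc a g) i) \<in> borel_measurable (borel \<Otimes>\<^sub>M lebn ?K)"
        using i by (simp add: split_def)
    qed (auto simp: space_pair_measure space_PiM PiE_def extensional_def)
    have [measurable]: "(\<lambda>g. ?sc a g) \<in> measurable (lebn ?K) (lebn ?K)" for a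
    proof -
      have "(\<lambda>g. case (a, g) of (a, g) \<Rightarrow> ?sc a g) \<in> measurable (lebn ?K) (lebn ?K)"
        by (rule measurable_compose[OF _ sc_pair]) measurable
      then show ?thesis by (simp only: prod.case)
    qed
    have merge_sqs: "sqs ?D (merge ?K ?J (g, z)) = sqs ?K g + sqs ?J z" for g z
      unfolding sqs_def D using disj by (subst sum.union_disjoint) (auto simp: merge_def)
    have "(\<integral>\<^sup>+x. f (restrict (sphere_proj d x) ?K) * indicator {x. sqs ?D x \<le> 1} x \<partial>lebn ?D)
       = (\<integral>\<^sup>+g. (\<integral>\<^sup>+z. f (restrict (sphere_proj d (merge ?K ?J (g, z))) ?K)
            * indicator {x. sqs ?D x \<le> 1} (merge ?K ?J (g, z)) \<partial>lebn ?J) \<partial>lebn ?K)"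
      unfolding D
      by (rule lebn.product_nn_integral_fold[OF disj])
         (use measurable_compose[OF measurable_sphere_proj restr, of d] in \<open>auto simp flip: D\<close>)
    also have "\<dots> = (\<integral>\<^sup>+g. (\<integral>\<^sup>+z. (\<lambda>v. f (?sc (1 / sqrt (sqs ?K g + v)) g)
            * indicator {..1} (sqs ?K g + v)) (sqs ?J z) \<partial>lebn ?J) \<partial>lebn ?K)"
    proof (intro nn_integral_cong)
      fix g z assume g: "g \<in> space (lebn ?K)"
      have "restrict (sphere_proj d (merge ?K ?J (g, z))) ?K = ?sc (1 / sqrt (sqs ?K g + sqs ?J z)) g"
        unfolding sphere_proj_def norm_dim_sqs merge_sqs
        using g k by (auto simp: fun_eq_iff space_PiM PiE_def extensional_def restrict_def merge_def)
      then show "f (restrict (sphere_proj d (merge ?K ?J (g, z))) ?K)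
            * indicator {x. sqs ?D x \<le> 1} (merge ?K ?J (g, z))
          = f (?sc (1 / sqrt (sqs ?K g + sqs ?J z)) g) * indicator {..1} (sqs ?K g + sqs ?J z)"
        by (simp add: indicator_def merge_sqs)
    qed
    also have "\<dots> = (\<integral>\<^sup>+g. ennreal C * (\<integral>\<^sup>+u. f (?sc (1 / sqrt u) g) * indicator {..1} u
            * ennreal (ppow (u - sqs ?K g) (?p - 1)) \<partial>lborel) \<partial>lebn ?K)"
    proof (intro nn_integral_cong)
      fix g assume g: "g \<in> space (lebn ?K)"
      have scm[measurable]: "(\<lambda>a. f (?sc a g)) \<in> borel_measurable borel"
      proof -
        have "(\<lambda>a. f (case (a, g) of (a, g) \<Rightarrow> ?sc a g)) \<in> borel_measurable borel"
          by (rule measurable_compose[OF measurable_compose[OF _ sc_pair] f]) (use g in measurable)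
        then show ?thesis by (simp only: prod.case)
      qed
      let ?\<Phi> = "\<lambda>v. f (?sc (1 / sqrt (sqs ?K g + v)) g) * indicator {..1} (sqs ?K g + v)"
      let ?h = "\<lambda>u. f (?sc (1 / sqrt u) g) * indicator {..1} u * ennreal (ppow (u - sqs ?K g) (?p - 1))"
      have "(\<integral>\<^sup>+z. ?\<Phi> (sqs ?J z) \<partial>lebn ?J)
          = ennreal C * (\<integral>\<^sup>+v. ?\<Phi> v * (ennreal (v powr (card ?J / 2 - 1)) * indicator {0<..} v) \<partial>lborel)"
        by (rule polar) measurable
      also have "(\<integral>\<^sup>+v. ?\<Phi> v * (ennreal (v powr (card ?J / 2 - 1)) * indicator {0<..} v) \<partial>lborel)
          = (\<integral>\<^sup>+v. ?h (sqs ?K g + 1 * v) \<partial>lborel)"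
        unfolding mult_1 by (intro nn_integral_cong) (auto simp: ppow_def indicator_def)
      also have "\<dots> = (\<integral>\<^sup>+u. ?h u \<partial>lborel)"
      proof -
        have "?h \<in> borel_measurable borel"
        proof -
          have [measurable]: "(\<lambda>u. f (?sc (1 / sqrt u) g)) \<in> borel_measurable borel"
            by (rule measurable_compose[OF _ scm]) measurable
          show ?thesis by measurable
        qed
        from nn_integral_real_affine[OF this, of 1 "sqs ?K g"] show ?thesis by simp
      qed
      finally show "(\<integral>\<^sup>+z. ?\<Phi> (sqs ?J z) \<partial>lebn ?J) = ennreal C * (\<integral>\<^sup>+u. ?h u \<partial>lborel)" .
    qed
    also have "\<dots> = ennreal C * (\<integral>\<^sup>+g. (\<integral>\<^sup>+u. f (?sc (1 / sqrt u) g) * indicator {..1} u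
            * ennreal (ppow (u - sqs ?K g) (?p - 1)) \<partial>lborel) \<partial>lebn ?K)"
      by (intro nn_integral_cmult) measurable
    also have "(\<integral>\<^sup>+g. (\<integral>\<^sup>+u. f (?sc (1 / sqrt u) g) * indicator {..1} u
            * ennreal (ppow (u - sqs ?K g) (?p - 1)) \<partial>lborel) \<partial>lebn ?K)
       = (\<integral>\<^sup>+u. (\<integral>\<^sup>+g. f (?sc (1 / sqrt u) g) * indicator {..1} u
            * ennreal (ppow (u - sqs ?K g) (?p - 1)) \<partial>lebn ?K) \<partial>lborel)"
      by (rule P.Fubini') measurable
    also have "\<dots> = (\<integral>\<^sup>+u. ennreal (u powr (d / 2 - 1)) * indicator {0<..1} u * I \<partial>lborel)"
    proof (intro nn_integral_cong)
      fix u :: real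
      show "(\<integral>\<^sup>+g. f (?sc (1 / sqrt u) g) * indicator {..1} u
            * ennreal (ppow (u - sqs ?K g) (?p - 1)) \<partial>lebn ?K)
         = ennreal (u powr (d / 2 - 1)) * indicator {0<..1} u * I"
      proof (cases "0 < u")
        case False
        then have "ppow (u - sqs ?K g) (?p - 1) = 0" for g
          using sqs_nonneg[of ?K g] by (auto simp: ppow_def simp del: sqs_nonneg)
        then show ?thesis using False by simp
      next
        \<comment> \<open>Scaling \<open>g\<close> by \<open>sqrt u\<close> contributes
          \<open>u powr (k / 2)\<close> and the homogeneous weight contributes
          \<open>u powr (?p - 1)\<close>; what remains is \<open>I\<close>, free of
          \<open>u\<close>.\<close>
        case u: True
        have "(\<integral>\<^sup>+g. f (?sc (1 / sqrt u) g) * indicator {..1} u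
              * ennreal (ppow (u - sqs ?K g) (?p - 1)) \<partial>lebn ?K)
          = ennreal (sqrt u ^ card ?K) * (\<integral>\<^sup>+g. f (?sc (1 / sqrt u) (?sc (sqrt u) g)) * indicator {..1} u
              * ennreal (ppow (u - sqs ?K (?sc (sqrt u) g)) (?p - 1)) \<partial>lebn ?K)"
          by (rule nn_integral_lebn_scale[OF finite_lessThan real_sqrt_gt_zero[OF u]]) measurable
        also have "(\<integral>\<^sup>+g. f (?sc (1 / sqrt u) (?sc (sqrt u) g)) * indicator {..1} u
              * ennreal (ppow (u - sqs ?K (?sc (sqrt u) g)) (?p - 1)) \<partial>lebn ?K)
          = (\<integral>\<^sup>+g. (ennreal (u powr (?p - 1)) * indicator {..1} u) * (f g * ?w g) \<partial>lebn ?K)"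
        proof (intro nn_integral_cong)
          fix g
          have "?sc (1 / sqrt u) (?sc (sqrt u) g) = g" using u by (auto simp: fun_eq_iff)
          moreover have "sqs ?K (?sc (sqrt u) g) = u * sqs ?K g"
            using u by (simp add: sqs_def sum_distrib_left power_mult_distrib)
          then have "u - sqs ?K (?sc (sqrt u) g) = u * (1 - sqs ?K g)"
            by (simp add: algebra_simps)
          then have "ppow (u - sqs ?K (?sc (sqrt u) g)) (?p - 1) = u powr (?p - 1) * ppow (1 - sqs ?K g) (?p - 1)"
            using u by (simp add: ppow_mult)
          ultimately show "f (?sc (1 / sqrt u) (?sc (sqrt u) g)) * indicator {..1} u
              * ennreal (ppow (u - sqs ?K (?sc (sqrt u) g)) (?p - 1))
             = (ennreal (u powr (?p - 1)) * indicator {..1} u) * (f g * ?w g)"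
            by (simp add: ennreal_mult mult_ac)
        qed
        also have "\<dots> = (ennreal (u powr (?p - 1)) * indicator {..1} u) * I"
          unfolding I_def by (intro nn_integral_cmult) measurable
        also have "ennreal (sqrt u ^ card ?K) * ((ennreal (u powr (?p - 1)) * indicator {..1} u) * I)
           = ennreal (sqrt u ^ card ?K * u powr (?p - 1)) * indicator {0<..1} u * I"
          using u by (simp add: ennreal_mult indicator_def mult_ac)
        also have "sqrt u ^ card ?K = u powr (k / 2)"
          using u by (simp add: powr_half_sqrt[symmetric] powr_powr powr_realpow[symmetric])
        also have "u powr (k / 2) * u powr (?p - 1) = u powr (d / 2 - 1)"
          using k by (subst powr_add[symmetric]) (simp add: of_nat_diff field_simps)
        finally show ?thesis .
      qed
    qed
    also have "\<dots> = (\<integral>\<^sup>+u. ennreal (u powr (d / 2 - 1)) * indicator {0<..1} u \<partial>lborel) * I"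
      by (intro nn_integral_multc) measurable
    also have "(\<integral>\<^sup>+u. ennreal (u powr (d / 2 - 1)) * indicator {0<..1} u \<partial>lborel) = ennreal (2 / d)"
      by (subst nn_integral_powr_from_0) (use k in auto)
    finally have *: "(\<integral>\<^sup>+x. f (restrict (sphere_proj d x) ?K) * indicator {x. sqs ?D x \<le> 1} x \<partial>lebn ?D)
        = ennreal C * (ennreal (2 / d) * I)" .
    have "(\<integral>\<^sup>+x. f (restrict x ?K) \<partial>uniform_sphere d) = ennreal C * (ennreal (2 / d) * I) / ennreal V"
      using measurable_compose[OF restr f] by (subst nn_integral_uniform_sphere) (simp_all add: * V)
    also have "\<dots> = ennreal (C * (2 / d)) / ennreal V * I"
      using C by (subst ennreal_mult) (auto simp: divide_ennreal_def mult_ac)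
    also have "ennreal (C * (2 / d)) / ennreal V = ennreal c"
      unfolding c_def using C Vpos by (intro divide_ennreal) auto
    finally show "(\<integral>\<^sup>+x. f (restrict x ?K) \<partial>uniform_sphere d) = ennreal c * (\<integral>\<^sup>+y. f y * ?w y \<partial>lebn ?K)"
      unfolding I_def .
  qed
qed

text \<open>Choosing the normalizing constant once makes it the same for all test functions
  \<open>f\<close>.\<close>

definition marginal_const :: "nat \<Rightarrow> nat \<Rightarrow> real"
  where "marginal_const d k = (SOME c. c > 0 \<and> (\<forall>f \<in> borel_measurable (lebn {..<k}).
    (\<integral>\<^sup>+x. (f :: (nat \<Rightarrow> real) \<Rightarrow> ennreal) (restrict x {..<k}) \<partial>uniform_sphere d) =
    ennreal c * (\<integral>\<^sup>+y. f y * marginal_weight d k y \<partial>lebn {..<k})))"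

lemma uniform_sphere_marginal:
  assumes "k < d"
  shows "marginal_const d k > 0"
    and "f \<in> borel_measurable (lebn {..<k}) \<Longrightarrow>
      (\<integral>\<^sup>+x. (f :: (nat \<Rightarrow> real) \<Rightarrow> ennreal) (restrict x {..<k}) \<partial>uniform_sphere d) =
      ennreal (marginal_const d k) * (\<integral>\<^sup>+y. f y * marginal_weight d k y \<partial>lebn {..<k})"
proof -
  have "\<exists>c. c > 0 \<and> (\<forall>f \<in> borel_measurable (lebn {..<k}).
    (\<integral>\<^sup>+x. (f :: (nat \<Rightarrow> real) \<Rightarrow> ennreal) (restrict x {..<k}) \<partial>uniform_sphere d) =
    ennreal c * (\<integral>\<^sup>+y. f y * marginal_weight d k y \<partial>lebn {..<k}))"
    by (rule nn_integral_uniform_sphere_marginal[OF assms], intro exI conjI ballI)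
  note * = someI_ex[OF this, folded marginal_const_def]
  show "marginal_const d k > 0"
    using * by (rule conjunct1)
  show "(\<integral>\<^sup>+x. f (restrict x {..<k}) \<partial>uniform_sphere d) =
      ennreal (marginal_const d k) * (\<integral>\<^sup>+y. f y * marginal_weight d k y \<partial>lebn {..<k})"
    if "f \<in> borel_measurable (lebn {..<k})"
    using conjunct2[OF *] that by (rule bspec)
qed

text \<open>Test function 1. Products of the constant with an integral are evaluated through this
  identity instead of through an explicit value in terms of Gamma functions.\<close>

lemma marginal_const_normalized:
  assumes "k < d"
  shows "ennreal (marginal_const d k) * (\<integral>\<^sup>+y. marginal_weight d k y \<partial>lebn {..<k}) = 1"
proof -
  interpret prob_space "uniform_sphere d" using assms by (intro prob_space_uniform_sphere) auto
  show ?thesis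
    using uniform_sphere_marginal(2)[OF assms, of "\<lambda>_. 1"] emeasure_space_1 by simp
qed

subsection \<open>Rotations\<close>

definition givens :: "nat \<Rightarrow> nat \<Rightarrow> real \<Rightarrow> real \<Rightarrow> (nat \<Rightarrow> real) \<Rightarrow> nat \<Rightarrow> real"
  where "givens i j c s x = x(i := c * x i + s * x j, j := c * x j - s * x i)"

definition flip :: "nat \<Rightarrow> (nat \<Rightarrow> real) \<Rightarrow> nat \<Rightarrow> real"
  where "flip i x = x(i := - x i)"

lemma nn_integral_lebn_shear:
  assumes "finite I" "i \<in> I" "j \<in> I" "i \<noteq> j" "c \<noteq> 0" "f \<in> borel_measurable (lebn I)"
  shows "(\<integral>\<^sup>+x. f x \<partial>lebn I) = ennreal \<bar>c\<bar> * (\<integral>\<^sup>+x. f (x(i := s * x j + c * x i)) \<partial>lebn I)"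
  by (rule nn_integral_lebn_affine_coordinate) (use assms measurable_lebn_coord[of j I] in auto)

lemma measurable_shear:
  assumes "i \<in> I" "j \<in> I" "f \<in> borel_measurable (lebn I)"
  shows "(\<lambda>x. f (x(i := s * x j + c * x i))) \<in> borel_measurable (lebn I)"
proof -
  have [measurable]: "(\<lambda>x. x i) \<in> borel_measurable (lebn I)" "(\<lambda>x. x j) \<in> borel_measurable (lebn I)"
    using assms by (auto intro: measurable_lebn_coord)
  show ?thesis
    by (rule measurable_compose[OF measurable_update_lebn assms(3)]) (use assms in auto)
qed

text \<open>A plane rotation is a product of shears. For \<open>c \<noteq> 0\<close> two of them
  suffice, with Jacobians \<open>c\<close> and \<open>1 / c\<close> that cancel; a quarter turn
  (\<open>c = 0\<close>) is a product of three shears with Jacobian 1.\<close>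

lemma nn_integral_lebn_givens:
  assumes I: "finite I" "i \<in> I" "j \<in> I" "i \<noteq> j" and cs: "c\<^sup>2 + s\<^sup>2 = 1"
    and f: "f \<in> borel_measurable (lebn I)"
  shows "(\<integral>\<^sup>+x. f (givens i j c s x) \<partial>lebn I) = (\<integral>\<^sup>+x. f x \<partial>lebn I)"
proof (cases "c = 0")
  case False
  let ?B = "\<lambda>x. f (x(j := (- s / c) * x i + (1 / c) * x j))"
  have m: "?B \<in> borel_measurable (lebn I)"
    using measurable_shear[OF I(3,2) f] .
  have "(\<integral>\<^sup>+x. f x \<partial>lebn I) = ennreal \<bar>1 / c\<bar> * (\<integral>\<^sup>+x. ?B x \<partial>lebn I)"
    using I False f by (intro nn_integral_lebn_shear) auto
  also have "(\<integral>\<^sup>+x. ?B x \<partial>lebn I) = ennreal \<bar>c\<bar> * (\<integral>\<^sup>+x. ?B (x(i := s * x j + c * x i)) \<partial>lebn I)"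
    using I False m by (intro nn_integral_lebn_shear)
  also have "(\<lambda>x. ?B (x(i := s * x j + c * x i))) = (\<lambda>x. f (givens i j c s x))"
  proof (intro ext arg_cong[of _ _ f])
    fix x l
    have "(- s / c) * (s * x j + c * x i) + (1 / c) * x j = c * x j - s * x i"
    proof -
      have "(- s / c) * (s * x j + c * x i) + (1 / c) * x j = ((1 - s\<^sup>2) * x j - s * c * x i) / c"
        using False by (simp add: field_simps power2_eq_square)
      also have "1 - s\<^sup>2 = c\<^sup>2" using cs by simp
      also have "(c\<^sup>2 * x j - s * c * x i) / c = c * x j - s * x i"
        using False by (simp add: field_simps power2_eq_square)
      finally show ?thesis .
    qed
    then show "((x(i := s * x j + c * x i))(j := (- s / c) * (x(i := s * x j + c * x i)) i
        + (1 / c) * (x(i := s * x j + c * x i)) j)) l = givens i j c s x l"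
      using I by (simp add: givens_def add_ac)
  qed
  also have "ennreal \<bar>1 / c\<bar> * (ennreal \<bar>c\<bar> * (\<integral>\<^sup>+x. f (givens i j c s x) \<partial>lebn I))
      = (\<integral>\<^sup>+x. f (givens i j c s x) \<partial>lebn I)"
    using False by (subst mult.assoc[symmetric], subst ennreal_mult[symmetric]) auto
  finally show ?thesis by simp
next
  case True
  then have s: "s * s = 1" using cs by (simp add: power2_eq_square)
  let ?A1 = "\<lambda>x. f (x(i := s * x j + 1 * x i))"
  let ?A2 = "\<lambda>x. ?A1 (x(j := (- s) * x i + 1 * x j))"
  have m1: "?A1 \<in> borel_measurable (lebn I)"
    using I f by (intro measurable_shear)
  have m2: "?A2 \<in> borel_measurable (lebn I)"
    using measurable_shear[OF I(3,2) m1] .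
  have "(\<integral>\<^sup>+x. f x \<partial>lebn I) = (\<integral>\<^sup>+x. ?A1 x \<partial>lebn I)"
    using nn_integral_lebn_shear[OF I _ f, of 1 s] by simp
  also have "\<dots> = (\<integral>\<^sup>+x. ?A2 x \<partial>lebn I)"
    using nn_integral_lebn_shear[OF I(1,3,2) I(4)[symmetric] _ m1, of 1 "- s"] by simp
  also have "\<dots> = (\<integral>\<^sup>+x. ?A2 (x(i := s * x j + 1 * x i)) \<partial>lebn I)"
    using nn_integral_lebn_shear[OF I _ m2, of 1 s] by simp
  also have "(\<lambda>x. ?A2 (x(i := s * x j + 1 * x i))) = (\<lambda>x. f (givens i j c s x))"
  proof (intro ext arg_cong[of _ _ f])
    fix x :: "nat \<Rightarrow> real" and l
    have "s * (x j - s * (x i + s * x j)) + (x i + s * x j) = s * x j + (1 - s * s) * (x i + s * x j)"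
      "x j - s * (x i + s * x j) = (1 - s * s) * x j - s * x i"
      by (simp_all add: algebra_simps)
    then have "s * (x j - s * (x i + s * x j)) + (x i + s * x j) = s * x j"
      "x j - s * (x i + s * x j) = - s * x i"
      using s by simp_all
    then show "((x(i := s * x j + 1 * x i))(j := (- s) * (x(i := s * x j + 1 * x i)) i
          + 1 * (x(i := s * x j + 1 * x i)) j,
        i := s * ((x(i := s * x j + 1 * x i))(j := (- s) * (x(i := s * x j + 1 * x i)) i
          + 1 * (x(i := s * x j + 1 * x i)) j)) j
          + 1 * ((x(i := s * x j + 1 * x i))(j := (- s) * (x(i := s * x j + 1 * x i)) i
          + 1 * (x(i := s * x j + 1 * x i)) j)) i)) l = givens i j c s x l"
      using I True by (simp add: givens_def add_ac)
  qed
  finally show ?thesis by simp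
qed

lemma nn_integral_lebn_flip:
  assumes "finite I" "i \<in> I" "f \<in> borel_measurable (lebn I)"
  shows "(\<integral>\<^sup>+x. f (flip i x) \<partial>lebn I) = (\<integral>\<^sup>+x. f x \<partial>lebn I)"
  using nn_integral_lebn_affine_coordinate[of I i "-1" f "\<lambda>_. 0"] assms by (simp add: flip_def)

text \<open>Orthogonal maps, reflections included, are represented by generators that act on the
  coordinates \<open>{p..<q}\<close>, so that each property needed follows by induction from two
  explicit formulas. The range is kept as a parameter since a map acting on \<open>{k..<d}\<close>
  must not disturb what has been arranged in the first \<open>k\<close> coordinates.\<close>

inductive_set rots :: "nat \<Rightarrow> nat \<Rightarrow> ((nat \<Rightarrow> real) \<Rightarrow> nat \<Rightarrow> real) set" for p q where
  id: "(\<lambda>x. x) \<in> rots p q"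
| givens_comp: "Q \<in> rots p q \<Longrightarrow> i \<in> {p..<q} \<Longrightarrow> j \<in> {p..<q} \<Longrightarrow> i \<noteq> j \<Longrightarrow> c\<^sup>2 + s\<^sup>2 = 1
    \<Longrightarrow> (\<lambda>x. givens i j c s (Q x)) \<in> rots p q"
| flip_comp: "Q \<in> rots p q \<Longrightarrow> i \<in> {p..<q} \<Longrightarrow> (\<lambda>x. flip i (Q x)) \<in> rots p q"

lemma rots_comp: "Q \<in> rots p q \<Longrightarrow> R \<in> rots p q \<Longrightarrow> (\<lambda>x. Q (R x)) \<in> rots p q"
  by (induction rule: rots.induct) (auto intro: rots.intros)

lemma rots_mono: "Q \<in> rots p q \<Longrightarrow> p' \<le> p \<Longrightarrow> q \<le> q' \<Longrightarrow> Q \<in> rots p' q'"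
  by (induction rule: rots.induct) (auto intro: rots.intros)

lemma rots_linear: "Q \<in> rots p q \<Longrightarrow> Q (\<lambda>i. x i + a * y i) = (\<lambda>i. Q x i + a * Q y i)"
  by (induction rule: rots.induct) (auto simp: givens_def flip_def fun_eq_iff algebra_simps)

lemma rots_outside: "Q \<in> rots p q \<Longrightarrow> l \<notin> {p..<q} \<Longrightarrow> Q x l = x l"
  by (induction rule: rots.induct) (auto simp: givens_def flip_def)

lemma rots_local:
  "Q \<in> rots p q \<Longrightarrow> (\<And>l. l \<in> {p..<q} \<Longrightarrow> x l = y l) \<Longrightarrow> l \<in> {p..<q} \<Longrightarrow> Q x l = Q y l"
  by (induction arbitrary: l rule: rots.induct) (auto simp: givens_def flip_def)

lemma inner_dim_givens:
  assumes "i < d" "j < d" "i \<noteq> j" "c\<^sup>2 + s\<^sup>2 = 1"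
  shows "inner_dim d (givens i j c s x) (givens i j c s y) = inner_dim d x y"
proof -
  let ?R = "{..<d} - {i, j}"
  have split: "inner_dim d u v = u i * v i + u j * v j + (\<Sum>l\<in>?R. u l * v l)" for u v
  proof -
    have "insert i (insert j ?R) = {..<d}" using assms by auto
    moreover have "(\<Sum>l\<in>insert i (insert j ?R). u l * v l) = u i * v i + u j * v j + (\<Sum>l\<in>?R. u l * v l)"
      using assms by (simp add: add.assoc)
    ultimately show ?thesis
      by (simp add: inner_dim_def)
  qed
  have "(c * x i + s * x j) * (c * y i + s * y j) + (c * x j - s * x i) * (c * y j - s * y i)
     = (c\<^sup>2 + s\<^sup>2) * (x i * y i + x j * y j)"
    by (simp add: power2_eq_square algebra_simps)
  then show ?thesis
    unfolding split using assms by (simp add: givens_def)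
qed

lemma inner_dim_flip: "inner_dim d (flip i x) (flip i y) = inner_dim d x y"
  unfolding inner_dim_def flip_def by (intro sum.cong) auto

lemma rots_inner: "Q \<in> rots p q \<Longrightarrow> q \<le> d \<Longrightarrow> inner_dim d (Q x) (Q y) = inner_dim d x y"
  by (induction rule: rots.induct) (auto simp: inner_dim_givens inner_dim_flip)

text \<open>Givens elimination: the entries of \<open>z\<close> beyond \<open>p\<close> are rotated
  into coordinate \<open>p\<close> one after the other. A reflection makes the entry at
  \<open>p\<close> nonnegative at the start, and every rotation keeps it so.\<close>

lemma rots_align:
  assumes "p < q"
  obtains Q where "Q \<in> rots p q" "Q z p \<ge> 0" "\<And>l. p < l \<Longrightarrow> l < q \<Longrightarrow> Q z l = 0"
proof -
  have "\<exists>Q\<in>rots p q. Q z p \<ge> 0 \<and> (\<forall>l. p < l \<longrightarrow> l < q \<longrightarrow> Q z l = 0)"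
    using assms
  proof (induction q)
    case 0
    then show ?case by simp
  next
    case (Suc q)
    show ?case
    proof (cases "p = q")
      case True
      show ?thesis
      proof (cases "z p \<ge> 0")
        case True
        then show ?thesis using \<open>p = q\<close> by (intro bexI[of _ "\<lambda>x. x"]) (auto intro: rots.intros)
      next
        case False
        then show ?thesis using \<open>p = q\<close>
          by (intro bexI[of _ "\<lambda>x. flip p x"] rots.flip_comp[OF rots.id]) (auto simp: flip_def)
      qed
    next
      case False
      then have "p < q" using Suc by simp
      then obtain Q where Q: "Q \<in> rots p q" "Q z p \<ge> 0" "\<And>l. p < l \<Longrightarrow> l < q \<Longrightarrow> Q z l = 0"
        using Suc.IH by blast
      define a b n where "a = Q z p" and "b = Q z q" and "n = sqrt (a\<^sup>2 + b\<^sup>2)"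
      \<comment> \<open>Cosine and sine of the angle that carries \<open>(a, b)\<close> to
        \<open>(n, 0)\<close>; if both entries vanish, the identity is taken.\<close>
      define c s where "c = (if n = 0 then 1 else a / n)" and "s = (if n = 0 then 0 else b / n)"
      have nn: "n\<^sup>2 = a\<^sup>2 + b\<^sup>2" by (simp add: n_def)
      have cs: "c\<^sup>2 + s\<^sup>2 = 1"
      proof (cases "n = 0")
        case False
        then have "n\<^sup>2 \<noteq> 0" by simp
        with False show ?thesis
          by (simp add: c_def s_def power_divide nn flip: add_divide_distrib)
      qed (simp add: c_def s_def)
      have ab0: "a = 0 \<and> b = 0" if "n = 0"
        using that nn by (simp add: sum_power2_eq_zero_iff)
      have zero: "c * b - s * a = 0"
        using ab0 by (auto simp: c_def s_def)
      have "c * a + s * b \<ge> 0"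
      proof (cases "n = 0")
        case False
        then have "c * a + s * b = (a\<^sup>2 + b\<^sup>2) / n"
          by (simp add: c_def s_def power2_eq_square add_divide_distrib)
        then show ?thesis by (simp add: n_def)
      qed (use ab0 in auto)
      moreover have "(\<lambda>x. givens p q c s (Q x)) \<in> rots p (Suc q)"
        by (rule rots.givens_comp) (use rots_mono[OF Q(1)] \<open>p < q\<close> cs in auto)
      moreover have "givens p q c s (Q z) l = 0" if "p < l" "l < Suc q" for l
        using that zero Q(3)[of l] \<open>p < q\<close> by (auto simp: givens_def a_def b_def less_Suc_eq)
      ultimately show ?thesis
        using \<open>p < q\<close> by (intro bexI[of _ "\<lambda>x. givens p q c s (Q x)"]) (auto simp: givens_def a_def b_def)
    qed
  qed
  then show ?thesis using that by blast
qed

lemma measurable_rots: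
  assumes "Q \<in> rots p q"
  shows "Q \<in> measurable borel borel"
  using assms
proof induction
  case (givens_comp Q i j c s)
  show ?case
    unfolding givens_def
  proof (rule measurable_coordinatewise_then_product)
    fix l
    have [measurable]: "(\<lambda>x. Q x l) \<in> borel_measurable borel" for l
      using givens_comp.IH by (rule measurable_product_then_coordinatewise)
    show "(\<lambda>x. ((Q x)(i := c * Q x i + s * Q x j, j := c * Q x j - s * Q x i)) l) \<in> borel_measurable borel"
      by (cases "l = j"; cases "l = i") simp_all
  qed
next
  case (flip_comp Q i)
  show ?case
    unfolding flip_def
  proof (rule measurable_coordinatewise_then_product)
    fix l
    have [measurable]: "(\<lambda>x. Q x l) \<in> borel_measurable borel" for l
      using flip_comp.IH by (rule measurable_product_then_coordinatewise)
    show "(\<lambda>x. ((Q x)(i := - Q x i)) l) \<in> borel_measurable borel"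
      by (cases "l = i") simp_all
  qed
qed simp

text \<open>Invariance passes from Lebesgue measure to the cone measure because \<open>g\<close>
  preserves the unit ball and commutes with the radial projection.\<close>

lemma nn_integral_uniform_sphere_invariant:
  fixes f :: "(nat \<Rightarrow> real) \<Rightarrow> ennreal"
  assumes [measurable]: "g \<in> measurable borel borel" "f \<in> borel_measurable borel"
    and norm: "\<And>x. norm_dim d (g x) = norm_dim d x"
    and proj: "\<And>x. g (sphere_proj d x) = sphere_proj d (g x)"
    and inv: "\<And>F :: (nat \<Rightarrow> real) \<Rightarrow> ennreal. F \<in> borel_measurable (lebn {..<d}) \<Longrightarrow>
      (\<integral>\<^sup>+x. F (g x) \<partial>lebn {..<d}) = (\<integral>\<^sup>+x. F x \<partial>lebn {..<d})"
  shows "(\<integral>\<^sup>+x. f (g x) \<partial>uniform_sphere d) = (\<integral>\<^sup>+x. f x \<partial>uniform_sphere d)"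
proof -
  let ?F = "\<lambda>x. f (sphere_proj d x) * indicator {x. sqs {..<d} x \<le> 1} x"
  have "(\<integral>\<^sup>+x. f (g (sphere_proj d x)) * indicator {x. sqs {..<d} x \<le> 1} x \<partial>lebn {..<d})
     = (\<integral>\<^sup>+x. ?F (g x) \<partial>lebn {..<d})"
    using norm by (intro nn_integral_cong) (simp add: proj indicator_def norm_dim_sqs)
  also have "\<dots> = (\<integral>\<^sup>+x. ?F x \<partial>lebn {..<d})"
    by (rule inv) measurable
  finally show ?thesis
    by (simp add: nn_integral_uniform_sphere)
qed

lemma nn_integral_uniform_sphere_rotate:
  fixes f :: "(nat \<Rightarrow> real) \<Rightarrow> ennreal"
  assumes "Q \<in> rots p q" "q \<le> d" and "f \<in> borel_measurable borel"
  shows "(\<integral>\<^sup>+x. f (Q x) \<partial>uniform_sphere d) = (\<integral>\<^sup>+x. f x \<partial>uniform_sphere d)"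
  using assms(1,3)
proof (induction arbitrary: f)
  case id
  show ?case ..
next
  case (givens_comp Q i j c s)
  have ij: "i < d" "j < d" using givens_comp.hyps \<open>q \<le> d\<close> by auto
  have meas: "givens i j c s \<in> measurable borel borel"
    using measurable_rots[OF rots.givens_comp[OF rots.id givens_comp.hyps(2-5)]] by simp
  have norm: "norm_dim d (givens i j c s x) = norm_dim d x" for x
    using ij givens_comp.hyps by (simp add: norm_dim_def inner_dim_givens)
  have "(\<integral>\<^sup>+x. f (givens i j c s x) \<partial>uniform_sphere d) = (\<integral>\<^sup>+x. f x \<partial>uniform_sphere d)"
  proof (rule nn_integral_uniform_sphere_invariant[OF meas givens_comp.prems norm])
    show "givens i j c s (sphere_proj d x) = sphere_proj d (givens i j c s x)" for x
      unfolding sphere_proj_def norm using ij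
      by (auto simp: givens_def fun_eq_iff add_divide_distrib diff_divide_distrib)
  qed (rule nn_integral_lebn_givens, use ij givens_comp.hyps in auto)
  then show ?case
    using givens_comp.IH[of "\<lambda>x. f (givens i j c s x)"] measurable_compose[OF meas givens_comp.prems] by simp
next
  case (flip_comp Q i)
  have i: "i < d" using flip_comp.hyps \<open>q \<le> d\<close> by auto
  have meas: "flip i \<in> measurable borel borel"
    using measurable_rots[OF rots.flip_comp[OF rots.id flip_comp.hyps(2)]] by simp
  have norm: "norm_dim d (flip i x) = norm_dim d x" for x
    by (simp add: norm_dim_def inner_dim_flip)
  have "(\<integral>\<^sup>+x. f (flip i x) \<partial>uniform_sphere d) = (\<integral>\<^sup>+x. f x \<partial>uniform_sphere d)"
  proof (rule nn_integral_uniform_sphere_invariant[OF meas flip_comp.prems norm])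
    show "flip i (sphere_proj d x) = sphere_proj d (flip i x)" for x
      unfolding sphere_proj_def norm using i by (auto simp: flip_def fun_eq_iff)
  qed (rule nn_integral_lebn_flip, use i in auto)
  then show ?case
    using flip_comp.IH[of "\<lambda>x. f (flip i x)"] measurable_compose[OF meas flip_comp.prems] by simp
qed


subsection \<open>Gram--Schmidt orthogonalization\<close>

lemma inner_dim_add_left: "inner_dim d (\<lambda>i. u i + a * v i) w = inner_dim d u w + a * inner_dim d v w"
  by (simp add: inner_dim_def algebra_simps sum.distrib sum_distrib_left)

lemma inner_dim_diff_left: "inner_dim d (\<lambda>i. u i - a * v i) w = inner_dim d u w - a * inner_dim d v w"
  using inner_dim_add_left[of d u "- a" v w] by simp

lemma inner_dim_commute: "inner_dim d u v = inner_dim d v u"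
  by (simp add: inner_dim_def mult.commute)

lemma inner_dim_add_right: "inner_dim d w (\<lambda>i. u i + a * v i) = inner_dim d w u + a * inner_dim d w v"
  using inner_dim_add_left[of d u a v w] by (simp add: inner_dim_commute)

lemma inner_dim_diff_right: "inner_dim d w (\<lambda>i. u i - a * v i) = inner_dim d w u - a * inner_dim d w v"
  using inner_dim_add_right[of d w u "- a" v] by simp

lemma inner_dim_zero_left [simp]: "inner_dim d (\<lambda>_. 0) v = 0"
  by (simp add: inner_dim_def)

lemma inner_dim_zero_right [simp]: "inner_dim d v (\<lambda>_. 0) = 0"
  by (simp add: inner_dim_def)

lemma inner_dim_nonneg [simp]: "0 \<le> inner_dim d v v"
  by (simp add: inner_dim_self)

text \<open>
  \<open>gs_res d x k v\<close> is the component of \<open>v\<close> orthogonal to \<open>x 0, \<dots>, x (k - 1)\<close>, and \<open>gs_sol d x k\<close> is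
  the solution \<open>w\<close> of least norm of the equations \<open>\<langle>x j, w\<rangle> = 1\<close>, \<open>j < k\<close>, so that \<open>1 / \<parallel>w\<parallel>\<close> is the
  distance of their affine hull from the origin. This needs \<open>gs_nondeg\<close>: a vanishing direction is
  silently skipped because \<open>a / 0 = 0\<close>.
\<close>

primrec gs_res :: "nat \<Rightarrow> (nat \<Rightarrow> nat \<Rightarrow> real) \<Rightarrow> nat \<Rightarrow> (nat \<Rightarrow> real) \<Rightarrow> nat \<Rightarrow> real" where
  "gs_res d x 0 v = v"
| "gs_res d x (Suc k) v = (\<lambda>i. gs_res d x k v i -
    inner_dim d v (gs_res d x k (x k)) / inner_dim d (gs_res d x k (x k)) (gs_res d x k (x k))
      * gs_res d x k (x k) i)"

abbreviation (input) gs_dir :: "nat \<Rightarrow> (nat \<Rightarrow> nat \<Rightarrow> real) \<Rightarrow> nat \<Rightarrow> nat \<Rightarrow> real"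
  where "gs_dir d x k \<equiv> gs_res d x k (x k)"

primrec gs_sol :: "nat \<Rightarrow> (nat \<Rightarrow> nat \<Rightarrow> real) \<Rightarrow> nat \<Rightarrow> nat \<Rightarrow> real" where
  "gs_sol d x 0 = (\<lambda>_. 0)"
| "gs_sol d x (Suc k) = (\<lambda>i. gs_sol d x k i +
    (1 - inner_dim d (x k) (gs_sol d x k)) / inner_dim d (gs_dir d x k) (gs_dir d x k) * gs_dir d x k i)"

definition gs_norm :: "nat \<Rightarrow> (nat \<Rightarrow> nat \<Rightarrow> real) \<Rightarrow> nat \<Rightarrow> real"
  where "gs_norm d x k = inner_dim d (gs_sol d x k) (gs_sol d x k)"

definition gs_nondeg :: "nat \<Rightarrow> (nat \<Rightarrow> nat \<Rightarrow> real) \<Rightarrow> nat \<Rightarrow> bool"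
  where "gs_nondeg d x k \<longleftrightarrow> (\<forall>j<k. inner_dim d (gs_dir d x j) (gs_dir d x j) \<noteq> 0)"

lemma gs_nondeg_Suc:
  "gs_nondeg d x (Suc k) \<longleftrightarrow> gs_nondeg d x k \<and> inner_dim d (gs_dir d x k) (gs_dir d x k) \<noteq> 0"
  by (auto simp: gs_nondeg_def less_Suc_eq)

lemma gs_res_cong: "(\<And>j. j < k \<Longrightarrow> x j = y j) \<Longrightarrow> gs_res d x k v = gs_res d y k v"
  by (induction k arbitrary: v) auto

lemma gs_sol_cong: "(\<And>j. j < k \<Longrightarrow> x j = y j) \<Longrightarrow> gs_sol d x k = gs_sol d y k"
proof (induction k)
  case (Suc k)
  then have "gs_sol d x k = gs_sol d y k" "gs_res d x k = gs_res d y k" "x k = y k"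
    using gs_res_cong[of k x y d] by auto
  then show ?case by simp
qed simp

lemma gs_nondeg_cong: "(\<And>j. j < k \<Longrightarrow> x j = y j) \<Longrightarrow> gs_nondeg d x k \<longleftrightarrow> gs_nondeg d y k"
proof -
  assume *: "\<And>j. j < k \<Longrightarrow> x j = y j"
  then have "gs_dir d x j = gs_dir d y j" if "j < k" for j
    using gs_res_cong[of j x y d "x j"] that by auto
  then show ?thesis by (simp add: gs_nondeg_def)
qed

lemma gs_norm_cong: "(\<And>j. j < k \<Longrightarrow> x j = y j) \<Longrightarrow> gs_norm d x k = gs_norm d y k"
  using gs_sol_cong[of k x y d] by (simp add: gs_norm_def)

lemma gs_norm_nonneg [simp]: "0 \<le> gs_norm d x k"
  by (simp add: gs_norm_def)

lemma gs_res_linear: "gs_res d x k (\<lambda>i. u i + a * v i) = (\<lambda>i. gs_res d x k u i + a * gs_res d x k v i)"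
  by (induction k) (auto simp: inner_dim_add_left fun_eq_iff add_divide_distrib algebra_simps)

lemma gs_res_linear': "gs_res d x k (\<lambda>i. u i - a * v i) = (\<lambda>i. gs_res d x k u i - a * gs_res d x k v i)"
  using gs_res_linear[of d x k u "- a" v] by simp

text \<open>Each step subtracts a symmetric operator of rank one. Together with idempotence this
  makes \<open>gs_res\<close> an orthogonal projection, from which the orthogonality relations below
  are read off.\<close>

lemma gs_res_selfadjoint: "inner_dim d (gs_res d x k u) v = inner_dim d u (gs_res d x k v)"
proof (induction k)
  case (Suc k)
  then show ?case
    unfolding gs_res.simps inner_dim_diff_left inner_dim_diff_right
    by (simp add: inner_dim_commute[of d v "gs_dir d x k"])
qed simp

text \<open>The new direction is fixed by the previous projection, hence a vector and its residual
  have the same inner product with it, and the new step sends the direction itself to 0.\<close>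

lemma gs_res_idem: "gs_nondeg d x k \<Longrightarrow> gs_res d x k (gs_res d x k v) = gs_res d x k v"
proof (induction k arbitrary: v)
  case (Suc k)
  let ?r = "gs_dir d x k"
  have nd: "gs_nondeg d x k" "inner_dim d ?r ?r \<noteq> 0" using Suc.prems by (auto simp: gs_nondeg_Suc)
  note idem = Suc.IH[OF nd(1)]
  have rr: "gs_res d x (Suc k) ?r = (\<lambda>_. 0)"
    using nd(2) by (simp add: idem)
  have "inner_dim d (gs_res d x k v) ?r = inner_dim d v ?r"
    by (simp add: gs_res_selfadjoint idem)
  then have rv: "gs_res d x (Suc k) (gs_res d x k v) = gs_res d x (Suc k) v"
    by (simp add: idem)
  have "gs_res d x (Suc k) (gs_res d x (Suc k) v)
      = gs_res d x (Suc k) (\<lambda>i. gs_res d x k v i - inner_dim d v ?r / inner_dim d ?r ?r * ?r i)"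
    by simp
  also have "\<dots> = gs_res d x (Suc k) v"
    unfolding gs_res_linear' rv rr by simp
  finally show ?case .
qed simp

lemma gs_res_eq_0: "gs_nondeg d x k \<Longrightarrow> j < k \<Longrightarrow> gs_res d x k (x j) = (\<lambda>_. 0)"
proof (induction k)
  case (Suc k)
  let ?r = "gs_dir d x k"
  have nd: "gs_nondeg d x k" "inner_dim d ?r ?r \<noteq> 0" using Suc.prems by (auto simp: gs_nondeg_Suc)
  show ?case
  proof (cases "j = k")
    case True
    have "inner_dim d (x k) ?r = inner_dim d ?r ?r"
      using gs_res_selfadjoint[of d x k "x k" ?r] gs_res_idem[OF nd(1)] by simp
    then show ?thesis using True nd(2) by simp
  next
    case False
    then have z: "gs_res d x k (x j) = (\<lambda>_. 0)" using Suc nd by simp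
    then have "inner_dim d (x j) ?r = 0"
      using gs_res_selfadjoint[of d x k "x j" "x k"] by simp
    then show ?thesis using z by simp
  qed
qed simp

text \<open>The solution is a combination of the Gram-Schmidt directions, so nothing of it survives
  the projection. This expresses that its norm is minimal, and it makes the next direction
  orthogonal to it.\<close>

lemma gs_res_sol: "gs_nondeg d x k \<Longrightarrow> gs_res d x k (gs_sol d x k) = (\<lambda>_. 0)"
proof (induction k)
  case (Suc k)
  let ?r = "gs_dir d x k"
  have nd: "gs_nondeg d x k" "inner_dim d ?r ?r \<noteq> 0" using Suc.prems by (auto simp: gs_nondeg_Suc)
  then have z: "gs_res d x k (gs_sol d x k) = (\<lambda>_. 0)" using Suc by simp
  then have "inner_dim d (gs_sol d x k) ?r = 0"
    using gs_res_selfadjoint[of d x k "gs_sol d x k" "x k"] by simp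
  then have "gs_res d x (Suc k) (gs_sol d x k) = (\<lambda>_. 0)" using z by simp
  moreover have "gs_res d x (Suc k) ?r = (\<lambda>_. 0)"
    using nd by (simp add: gs_res_idem)
  ultimately show ?case
    unfolding gs_sol.simps gs_res_linear by simp
qed simp

lemma gs_sol_dir: "gs_nondeg d x k \<Longrightarrow> inner_dim d (gs_sol d x k) (gs_dir d x k) = 0"
  using gs_res_sol[of d x k] gs_res_selfadjoint[of d x k "gs_sol d x k" "x k"] by simp

text \<open>Pythagoras: the correction points along the new direction, which is orthogonal to the
  old solution. The new point enters only through two numbers, its inner product with the old
  solution and the squared norm of its residual.\<close>

lemma gs_norm_Suc:
  assumes "gs_nondeg d x (Suc k)"
  shows "gs_norm d x (Suc k) = gs_norm d x k
    + (1 - inner_dim d (x k) (gs_sol d x k))\<^sup>2 / inner_dim d (gs_dir d x k) (gs_dir d x k)"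
proof -
  let ?w = "gs_sol d x k" and ?r = "gs_dir d x k"
  define a where "a = (1 - inner_dim d (x k) ?w) / inner_dim d ?r ?r"
  have rr: "inner_dim d ?r ?r \<noteq> 0" and wr: "inner_dim d ?w ?r = 0" "inner_dim d ?r ?w = 0"
    using assms gs_sol_dir[of d x k] by (auto simp: gs_nondeg_Suc inner_dim_commute)
  have "gs_norm d x (Suc k) = inner_dim d ?w ?w + a * (a * inner_dim d ?r ?r)"
    using wr by (simp add: gs_norm_def inner_dim_add_left inner_dim_add_right flip: a_def)
  also have "a * (a * inner_dim d ?r ?r) = (1 - inner_dim d (x k) ?w)\<^sup>2 / inner_dim d ?r ?r"
    using rr by (simp add: a_def power2_eq_square)
  finally show ?thesis by (simp add: gs_norm_def)
qed

text \<open>The correction is orthogonal to the earlier points and so preserves their equations; its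
  coefficient is the one that makes the new equation hold.\<close>

lemma gs_sol_inner: "gs_nondeg d x k \<Longrightarrow> j < k \<Longrightarrow> inner_dim d (x j) (gs_sol d x k) = 1"
proof (induction k)
  case (Suc k)
  let ?r = "gs_dir d x k"
  have nd: "gs_nondeg d x k" "inner_dim d ?r ?r \<noteq> 0" using Suc.prems by (auto simp: gs_nondeg_Suc)
  show ?case
  proof (cases "j = k")
    case True
    have "inner_dim d (x k) ?r = inner_dim d ?r ?r"
      using gs_res_selfadjoint[of d x k "x k" ?r] gs_res_idem[OF nd(1)] by simp
    then show ?thesis
      unfolding gs_sol.simps inner_dim_add_right using True nd(2) by simp
  next
    case False
    then have "inner_dim d (x j) ?r = 0"
      using gs_res_selfadjoint[of d x k "x j" "x k"] gs_res_eq_0[OF nd(1), of j] Suc.prems by simp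
    then show ?thesis
      unfolding gs_sol.simps inner_dim_add_right using Suc False nd by simp
  qed
qed simp

lemma gs_res_orthogonal:
  "gs_nondeg d x k \<Longrightarrow> (\<And>j. j < k \<Longrightarrow> inner_dim d (x j) z = 0) \<Longrightarrow> gs_res d x k z = z"
proof (induction k)
  case (Suc k)
  then have z: "gs_res d x k z = z" by (auto simp: gs_nondeg_Suc)
  have "inner_dim d z (gs_dir d x k) = inner_dim d z (x k)"
    using gs_res_selfadjoint[of d x k z "x k"] z by simp
  then show ?case using z Suc.prems(2)[of k] by (simp add: inner_dim_commute)
qed simp

lemma rots_zero: "Q \<in> rots p q \<Longrightarrow> Q (\<lambda>_. 0) = (\<lambda>_. 0)"
  using rots_linear[of Q p q "\<lambda>_. 0" "-1" "\<lambda>_. 0"] by (simp add: fun_eq_iff)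

lemma rots_inner_axis:
  assumes Q: "Q \<in> rots 0 d" and k: "k < d" and "\<And>j. j < d \<Longrightarrow> j \<noteq> k \<Longrightarrow> Q u j = 0"
  shows "inner_dim d v u = Q v k * Q u k"
proof -
  have "inner_dim d v u = (\<Sum>i<d. Q v i * Q u i)"
    using rots_inner[OF Q, of d v u] by (simp add: inner_dim_def)
  also have "\<dots> = (\<Sum>i\<in>{k}. Q v i * Q u i)"
    using k assms(3) by (intro sum.mono_neutral_right) auto
  finally show ?thesis by simp
qed

text \<open>In suitable orthonormal coordinates the projection just deletes the first
  \<open>k\<close> entries. In the induction step the new direction, supported on
  \<open>{k..<d}\<close>, is turned onto axis \<open>k\<close> by a rotation of these coordinates
  only.\<close>

lemma gs_frame:
  assumes "gs_nondeg d x k" "k \<le> d"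
  shows "\<exists>Q\<in>rots 0 d. \<forall>v. (\<forall>j<k. Q (gs_res d x k v) j = 0) \<and>
    (\<forall>j. k \<le> j \<longrightarrow> j < d \<longrightarrow> Q (gs_res d x k v) j = Q v j)"
  using assms
proof (induction k)
  case 0
  then show ?case by (intro bexI[OF _ rots.id]) auto
next
  case (Suc k)
  let ?r = "gs_dir d x k"
  have nd: "gs_nondeg d x k" "inner_dim d ?r ?r \<noteq> 0" using Suc.prems by (auto simp: gs_nondeg_Suc)
  have k: "k < d" using Suc.prems by simp
  obtain Q where Q: "Q \<in> rots 0 d"
    "\<And>v j. j < k \<Longrightarrow> Q (gs_res d x k v) j = 0"
    "\<And>v j. k \<le> j \<Longrightarrow> j < d \<Longrightarrow> Q (gs_res d x k v) j = Q v j"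
    using Suc.IH[OF nd(1)] k by auto
  obtain G where G: "G \<in> rots k d" "G (Q ?r) k \<ge> 0" "\<And>l. k < l \<Longrightarrow> l < d \<Longrightarrow> G (Q ?r) l = 0"
    using rots_align[OF k] by metis
  define R where "R = (\<lambda>x. G (Q x))"
  have R: "R \<in> rots 0 d"
    unfolding R_def by (rule rots_comp) (use rots_mono[OF G(1)] Q(1) in auto)
  have Rr: "R ?r j = 0" if "j < d" "j \<noteq> k" for j
  proof (cases "j < k")
    case True
    then show ?thesis using rots_outside[OF G(1), of j] Q(2) by (simp add: R_def)
  next
    case False
    then show ?thesis using that G(3) by (simp add: R_def)
  qed
  have inner_R: "inner_dim d v ?r = R v k * R ?r k" for v
    by (rule rots_inner_axis[OF R k]) (rule Rr)
  have \<rho>: "R ?r k \<noteq> 0" using inner_R[of ?r] nd(2) by auto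
  have "R (gs_res d x (Suc k) v) j = (if j < Suc k then 0 else R v j)" if "j < d" for v j
  proof -
    let ?c = "inner_dim d v ?r / inner_dim d ?r ?r"
    have "R (gs_res d x (Suc k) v) j = R (gs_res d x k v) j - ?c * R ?r j"
      using rots_linear[OF R, of "gs_res d x k v" "- ?c" ?r] by simp
    moreover have "?c = R v k / R ?r k"
      using \<rho> by (simp add: inner_R)
    moreover have "R (gs_res d x k v) j = (if j < k then 0 else R v j)"
    proof (cases "j < k")
      case True
      then show ?thesis using rots_outside[OF G(1), of j] Q(2) by (simp add: R_def)
    next
      case False
      then show ?thesis
        unfolding R_def using rots_local[OF G(1), of "Q (gs_res d x k v)" "Q v" j] Q(3) that by simp
    qed
    ultimately show ?thesis
      using Rr[OF that] \<rho> by (cases "j = k") auto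
  qed
  then show ?case
    using R k by (intro bexI[of _ R] allI conjI impI) (simp_all del: gs_res.simps)
qed

text \<open>The solution occupies only the first \<open>k\<close> coordinates of the frame, so a
  further rotation among them puts it on axis 0 without changing the residual. Both quantities that
  drive the chain thereby become functions of one rotated point.\<close>

lemma gs_frame_sol:
  assumes nd: "gs_nondeg d x k" and k: "0 < k" "k \<le> d"
  obtains Q where "Q \<in> rots 0 d"
    "\<And>v. inner_dim d (gs_res d x k v) (gs_res d x k v) = sqs {k..<d} (Q v)"
    "\<And>v. inner_dim d v (gs_sol d x k) = sqrt (gs_norm d x k) * Q v 0"
proof -
  obtain Q where Q: "Q \<in> rots 0 d"
    "\<And>v j. j < k \<Longrightarrow> Q (gs_res d x k v) j = 0"
    "\<And>v j. k \<le> j \<Longrightarrow> j < d \<Longrightarrow> Q (gs_res d x k v) j = Q v j"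
    using gs_frame[OF nd k(2)] by auto
  let ?w = "gs_sol d x k"
  have w0: "Q ?w j = 0" if "k \<le> j" "j < d" for j
    using Q(3)[OF that, of ?w] gs_res_sol[OF nd] rots_zero[OF Q(1)] by simp
  obtain G where G: "G \<in> rots 0 k" "G (Q ?w) 0 \<ge> 0" "\<And>l. 0 < l \<Longrightarrow> l < k \<Longrightarrow> G (Q ?w) l = 0"
    using rots_align[OF k(1)] by metis
  define R where "R = (\<lambda>x. G (Q x))"
  have R: "R \<in> rots 0 d"
    unfolding R_def by (rule rots_comp) (use rots_mono[OF G(1), of 0 d] Q(1) k in auto)
  have Rw: "R ?w j = 0" if "j < d" "j \<noteq> 0" for j
  proof (cases "j < k")
    case True
    then show ?thesis using that G(3) by (simp add: R_def)
  next
    case False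
    then show ?thesis using rots_outside[OF G(1), of j] w0 that by (simp add: R_def)
  qed
  have inner_R: "inner_dim d v ?w = R v 0 * R ?w 0" for v
    by (rule rots_inner_axis[OF R]) (use k Rw in auto)
  have "gs_norm d x k = (R ?w 0)\<^sup>2"
    using inner_R[of ?w] by (simp add: gs_norm_def power2_eq_square)
  then have \<rho>: "R ?w 0 = sqrt (gs_norm d x k)"
    using G(2) by (simp add: R_def)
  show ?thesis
  proof (rule that[OF R])
    fix v
    show "inner_dim d v ?w = sqrt (gs_norm d x k) * R v 0"
      using inner_R \<rho> by simp
    have "inner_dim d (gs_res d x k v) (gs_res d x k v) = sqs {..<d} (Q (gs_res d x k v))"
      using rots_inner[OF Q(1), of d "gs_res d x k v" "gs_res d x k v"] by (simp add: inner_dim_self)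
    also have "\<dots> = sqs {k..<d} (Q v)"
      unfolding sqs_def using k Q(2,3) by (intro sum.mono_neutral_cong_right) auto
    also have "\<dots> = sqs {k..<d} (R v)"
      unfolding sqs_def R_def using rots_outside[OF G(1)] by (intro sum.cong) auto
    finally show "inner_dim d (gs_res d x k v) (gs_res d x k v) = sqs {k..<d} (R v)" .
  qed
qed

text \<open>A vector orthogonal to all the points is fixed by the projection, which for
  \<open>k = d\<close> deletes all \<open>d\<close> coordinates. The conclusion is about the norm
  because entries of \<open>z\<close> beyond \<open>d\<close> are unconstrained.\<close>

lemma gs_complete:
  assumes "gs_nondeg d x d" and "\<And>j. j < d \<Longrightarrow> inner_dim d (x j) z = 0"
  shows "inner_dim d z z = 0"
proof -
  obtain Q where Q: "Q \<in> rots 0 d" "\<And>j. j < d \<Longrightarrow> Q (gs_res d x d z) j = 0"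
    using gs_frame[OF assms(1)] by auto
  have "gs_res d x d z = z" by (rule gs_res_orthogonal) (use assms in auto)
  then have "inner_dim d (Q z) (Q z) = 0" using Q(2) by (simp add: inner_dim_def)
  then show ?thesis using rots_inner[OF Q(1)] by simp
qed

subsection \<open>The law of one Gram--Schmidt step\<close>

lemma measurable_inner_dim [measurable (raw)]:
  assumes "f \<in> borel_measurable M" "g \<in> borel_measurable M"
  shows "(\<lambda>x. inner_dim d (f x) (g x)) \<in> borel_measurable M"
proof -
  have [measurable]: "(\<lambda>x. f x i) \<in> borel_measurable M" "(\<lambda>x. g x i) \<in> borel_measurable M" for i
    using assms by (auto intro: measurable_product_then_coordinatewise)
  show ?thesis unfolding inner_dim_def by measurable
qed

lemma measurable_gs_res:
  assumes "\<And>j. j < k \<Longrightarrow> (\<lambda>\<omega>. x \<omega> j) \<in> borel_measurable M" "v \<in> borel_measurable M"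
  shows "(\<lambda>\<omega>. gs_res d (x \<omega>) k (v \<omega>)) \<in> borel_measurable M"
  using assms
proof (induction k arbitrary: v)
  case (Suc k)
  have [measurable]: "v \<in> borel_measurable M" "(\<lambda>\<omega>. x \<omega> k) \<in> borel_measurable M"
    "(\<lambda>\<omega>. gs_res d (x \<omega>) k (v \<omega>)) \<in> borel_measurable M"
    "(\<lambda>\<omega>. gs_dir d (x \<omega>) k) \<in> borel_measurable M"
    using Suc by auto
  have [measurable]: "(\<lambda>\<omega>. gs_res d (x \<omega>) k (v \<omega>) i) \<in> borel_measurable M"
    "(\<lambda>\<omega>. gs_dir d (x \<omega>) k i) \<in> borel_measurable M" for i
    by (auto intro: measurable_product_then_coordinatewise)
  show ?case
    by (rule measurable_coordinatewise_then_product) simp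
qed simp

lemma measurable_gs_dir:
  assumes "\<And>j. j \<le> k \<Longrightarrow> (\<lambda>\<omega>. x \<omega> j) \<in> borel_measurable M"
  shows "(\<lambda>\<omega>. gs_dir d (x \<omega>) k) \<in> borel_measurable M"
  by (rule measurable_gs_res) (use assms in auto)

lemma measurable_gs_sol:
  assumes "\<And>j. j < k \<Longrightarrow> (\<lambda>\<omega>. x \<omega> j) \<in> borel_measurable M"
  shows "(\<lambda>\<omega>. gs_sol d (x \<omega>) k) \<in> borel_measurable M"
  using assms
proof (induction k)
  case (Suc k)
  have [measurable]: "(\<lambda>\<omega>. x \<omega> k) \<in> borel_measurable M"
    "(\<lambda>\<omega>. gs_sol d (x \<omega>) k) \<in> borel_measurable M"
    using Suc by auto
  have [measurable]: "(\<lambda>\<omega>. gs_dir d (x \<omega>) k) \<in> borel_measurable M"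
    using Suc.prems by (intro measurable_gs_dir) auto
  have [measurable]: "(\<lambda>\<omega>. gs_sol d (x \<omega>) k i) \<in> borel_measurable M"
    "(\<lambda>\<omega>. gs_dir d (x \<omega>) k i) \<in> borel_measurable M" for i
    by (auto intro: measurable_product_then_coordinatewise)
  show ?case
    by (rule measurable_coordinatewise_then_product) simp
qed simp

lemma measurable_gs_norm:
  assumes "\<And>j. j < k \<Longrightarrow> (\<lambda>\<omega>. x \<omega> j) \<in> borel_measurable M"
  shows "(\<lambda>\<omega>. gs_norm d (x \<omega>) k) \<in> borel_measurable M"
proof -
  have [measurable]: "(\<lambda>\<omega>. gs_sol d (x \<omega>) k) \<in> borel_measurable M"
    using assms by (rule measurable_gs_sol)
  show ?thesis unfolding gs_norm_def by measurable
qed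

lemma measurable_gs_nondeg:
  assumes "\<And>j. j < k \<Longrightarrow> (\<lambda>\<omega>. x \<omega> j) \<in> borel_measurable M"
  shows "Measurable.pred M (\<lambda>\<omega>. gs_nondeg d (x \<omega>) k)"
proof -
  have [measurable]: "(\<lambda>\<omega>. gs_dir d (x \<omega>) j) \<in> borel_measurable M" if "j < k" for j
    using assms that by (intro measurable_gs_dir) auto
  have "Measurable.pred M (\<lambda>\<omega>. \<forall>j\<in>{..<k}. inner_dim d (gs_dir d (x \<omega>) j) (gs_dir d (x \<omega>) j) \<noteq> 0)"
    by (intro pred_intros_finite) auto
  then show ?thesis by (simp add: gs_nondeg_def)
qed

text \<open>The only exception is a point of norm 0, which the radial projection sends to 0 by the
  convention for division; such points are null by the polar formula.\<close>

lemma AE_uniform_sphere_norm: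
  assumes d: "0 < d"
  shows "AE x in uniform_sphere d. sqs {..<d} x = 1"
proof -
  have J: "finite {..<d}" "{..<d} \<noteq> {}" using d by auto
  have [measurable]: "(\<lambda>x. sqs {..<d} x) \<in> borel_measurable borel"
    unfolding inner_dim_self[symmetric] by measurable
  have null: "(\<integral>\<^sup>+x. (indicator {0} (sqs {..<d} x) :: ennreal) \<partial>lebn {..<d}) = 0"
  proof (rule nn_integral_lebn_polar[OF J])
    fix C :: real
    assume *: "\<And>\<Phi>. \<Phi> \<in> borel_measurable borel \<Longrightarrow> (\<integral>\<^sup>+x. \<Phi> (sqs {..<d} x) \<partial>lebn {..<d})
       = ennreal C * (\<integral>\<^sup>+v. \<Phi> v * (ennreal (v powr (card {..<d} / 2 - 1)) * indicator {0<..} v) \<partial>lborel)"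
    have "(\<integral>\<^sup>+v. indicator {0} v * (ennreal (v powr (card {..<d} / 2 - 1)) * indicator {0<..} v) \<partial>lborel)
        = (\<integral>\<^sup>+v. 0 \<partial>(lborel :: real measure))"
      by (intro nn_integral_cong) (auto simp: indicator_def)
    then show ?thesis by (subst *) auto
  qed
  have "(\<integral>\<^sup>+x. indicator {x. sqs {..<d} x \<noteq> 1} (sphere_proj d x) * indicator {x. sqs {..<d} x \<le> 1} x \<partial>lebn {..<d})
    \<le> (\<integral>\<^sup>+x. indicator {0} (sqs {..<d} x) \<partial>lebn {..<d})"
  proof (intro nn_integral_mono)
    fix x
    have "sqs {..<d} (sphere_proj d x) = 1" if "sqs {..<d} x \<noteq> 0"
      using that unfolding sqs_def sphere_proj_def norm_dim_sqs
      by (simp add: power_divide sum_divide_distrib[symmetric] flip: sqs_def)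
    then show "indicator {x. sqs {..<d} x \<noteq> 1} (sphere_proj d x) * indicator {x. sqs {..<d} x \<le> 1} x
       \<le> (indicator {0} (sqs {..<d} x) :: ennreal)"
      by (auto simp: indicator_def)
  qed
  then have "(\<integral>\<^sup>+x. indicator {x. sqs {..<d} x \<noteq> 1} (sphere_proj d x) * indicator {x. sqs {..<d} x \<le> 1} x \<partial>lebn {..<d}) = 0"
    using null by simp
  moreover have "(\<integral>\<^sup>+x. indicator {x. sqs {..<d} x \<noteq> 1} x \<partial>uniform_sphere d) =
    (\<integral>\<^sup>+x. indicator {x. sqs {..<d} x \<noteq> 1} (sphere_proj d x) * indicator {x. sqs {..<d} x \<le> 1} x \<partial>lebn {..<d})
      / emeasure (lebn {..<d}) {x \<in> space (lebn {..<d}). sqs {..<d} x \<le> 1}"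
    by (intro nn_integral_uniform_sphere) measurable
  ultimately have "(\<integral>\<^sup>+x. indicator {x. sqs {..<d} x \<noteq> 1} x \<partial>uniform_sphere d) = 0"
    by simp
  then have "AE x in uniform_sphere d. indicator {x. sqs {..<d} x \<noteq> 1} x = (0 :: ennreal)"
    by (subst (asm) nn_integral_0_iff_AE) measurable
  then show ?thesis by eventually_elim (simp add: indicator_def split: if_splits)
qed

text \<open>Rotation invariance replaces the point by its coordinates in the adapted frame. On the
  sphere the squares of the last \<open>d - k\<close> coordinates add up to 1 minus those of the
  first \<open>k\<close>, so everything depends on the first \<open>k\<close> coordinates and their
  marginal law applies.\<close>

lemma gs_step_law:
  fixes \<phi> :: "real \<Rightarrow> real \<Rightarrow> ennreal"
  assumes k: "0 < k" "k < d" and nd: "gs_nondeg d x k"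
    and \<phi>: "case_prod \<phi> \<in> borel_measurable (borel \<Otimes>\<^sub>M borel)"
  shows "(\<integral>\<^sup>+v. \<phi> (inner_dim d v (gs_sol d x k)) (inner_dim d (gs_res d x k v) (gs_res d x k v)) \<partial>uniform_sphere d)
    = ennreal (marginal_const d k) * (\<integral>\<^sup>+y. \<phi> (sqrt (gs_norm d x k) * y 0) (1 - sqs {..<k} y)
        * marginal_weight d k y \<partial>lebn {..<k})"
proof -
  let ?N = "gs_norm d x k"
  have \<phi>m[measurable (raw)]: "(\<lambda>z. \<phi> (a z) (b z)) \<in> borel_measurable M"
    if "a \<in> borel_measurable M" "b \<in> borel_measurable M" for a b and M :: "(nat \<Rightarrow> real) measure"
    using measurable_compose[OF measurable_Pair[OF that] \<phi>] by simp
  have [measurable]: "(\<lambda>x. sqs J x) \<in> borel_measurable borel" for J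
    unfolding sqs_def by measurable
  have [measurable]: "(\<lambda>y. y 0) \<in> borel_measurable (lebn {..<k})"
    using k by (intro measurable_lebn_coord) auto
  obtain Q where Q: "Q \<in> rots 0 d"
    "\<And>v. inner_dim d (gs_res d x k v) (gs_res d x k v) = sqs {k..<d} (Q v)"
    "\<And>v. inner_dim d v (gs_sol d x k) = sqrt ?N * Q v 0"
    by (rule gs_frame_sol[OF nd k(1)]) (use k in auto)
  have "(\<integral>\<^sup>+v. \<phi> (inner_dim d v (gs_sol d x k)) (inner_dim d (gs_res d x k v) (gs_res d x k v)) \<partial>uniform_sphere d)
    = (\<integral>\<^sup>+v. (\<lambda>v. \<phi> (sqrt ?N * v 0) (sqs {k..<d} v)) (Q v) \<partial>uniform_sphere d)"
    by (simp add: Q)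
  also have "\<dots> = (\<integral>\<^sup>+v. \<phi> (sqrt ?N * v 0) (sqs {k..<d} v) \<partial>uniform_sphere d)"
    by (rule nn_integral_uniform_sphere_rotate[OF Q(1)]) auto
  also have "\<dots> = (\<integral>\<^sup>+v. (\<lambda>y. \<phi> (sqrt ?N * y 0) (1 - sqs {..<k} y)) (restrict v {..<k}) \<partial>uniform_sphere d)"
  proof (rule nn_integral_cong_AE)
    have "0 < d" using k by simp
    show "AE v in uniform_sphere d. \<phi> (sqrt ?N * v 0) (sqs {k..<d} v)
       = \<phi> (sqrt ?N * restrict v {..<k} 0) (1 - sqs {..<k} (restrict v {..<k}))"
      using AE_uniform_sphere_norm[OF \<open>0 < d\<close>]
    proof eventually_elim
      case (elim v)
      have "sqs ({..<k} \<union> {k..<d}) v = sqs {..<k} v + sqs {k..<d} v"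
        unfolding sqs_def by (rule sum.union_disjoint) auto
      moreover have "{..<k} \<union> {k..<d} = {..<d}" using k by auto
      ultimately have "sqs {..<d} v = sqs {..<k} v + sqs {k..<d} v"
        by simp
      moreover have "sqs {..<k} (restrict v {..<k}) = sqs {..<k} v"
        unfolding sqs_def by (intro sum.cong) auto
      ultimately have "1 - sqs {..<k} (restrict v {..<k}) = sqs {k..<d} v"
        using elim by simp
      then show ?case using k by simp
    qed
  qed
  also have "\<dots> = ennreal (marginal_const d k) * (\<integral>\<^sup>+y. \<phi> (sqrt ?N * y 0) (1 - sqs {..<k} y)
        * marginal_weight d k y \<partial>lebn {..<k})"
    by (rule uniform_sphere_marginal(2)[OF k(2)]) measurable
  finally show ?thesis .
qed


subsection \<open>The distance of a random hyperplane from the origin\<close>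

text \<open>
  Completing the square in \<open>y 0\<close> turns the region into a ball, translated and scaled in the
  coordinate \<open>0\<close> only.
\<close>

lemma nn_integral_ppow_ellipsoid:
  assumes k: "0 < k" and N: "0 \<le> N" "H * N < 1" and H: "0 < H" "H < 1"
  shows "(\<integral>\<^sup>+y. ennreal (ppow ((1 - H * N) * (1 - sqs {..<k} y) - H * (1 - sqrt N * y 0)\<^sup>2) a) \<partial>lebn {..<k})
    = ennreal ((1 - H * N) powr (a + 1 / 2) * (1 - H) powr (a + k / 2))
      * (\<integral>\<^sup>+y. ennreal (ppow (1 - sqs {..<k} y) a) \<partial>lebn {..<k})"
proof -
  let ?K = "{..<k}"
  let ?F = "\<lambda>y. ennreal (ppow ((1 - H * N) * (1 - sqs ?K y) - H * (1 - sqrt N * y 0)\<^sup>2) a)"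
  let ?G = "\<lambda>y. ennreal (ppow (1 - H - sqs ?K y) a)"
  let ?I = "\<integral>\<^sup>+y. ennreal (ppow (1 - sqs ?K y) a) \<partial>lebn ?K"
  \<comment> \<open>After the centre \<open>H * sqrt N\<close> on axis 0 is moved to the origin, the
    factor \<open>b\<close> on that axis turns the region into the ball of squared radius
    \<open>1 - H\<close>; the factor \<open>e\<close> then reduces it to the unit ball.\<close>
  define b e where "b = sqrt (1 - H * N)" and "e = sqrt (1 - H)"
  have b: "b > 0" "b\<^sup>2 = 1 - H * N" and e: "e > 0" "e\<^sup>2 = 1 - H"
    using N H by (auto simp: b_def e_def)
  have [measurable]: "(\<lambda>y. y 0) \<in> borel_measurable (lebn ?K)"
    using k by (intro measurable_lebn_coord) auto
  have upd: "sqs ?K (y(0 := z)) = sqs ?K y - (y 0)\<^sup>2 + z\<^sup>2" for y z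
  proof -
    have "sqs ?K u = (u 0)\<^sup>2 + (\<Sum>i\<in>?K - {0}. (u i)\<^sup>2)" for u
      unfolding sqs_def using k by (intro sum.remove) auto
    from this[of y] this[of "y(0 := z)"] show ?thesis by simp
  qed
  have "(\<integral>\<^sup>+y. ?F y \<partial>lebn ?K) = ennreal \<bar>b\<bar> * (\<integral>\<^sup>+y. ?F (y(0 := H * sqrt N + b * y 0)) \<partial>lebn ?K)"
    by (rule nn_integral_lebn_affine_coordinate[where t="\<lambda>_. H * sqrt N"]) (use k b in simp_all)
  also have "(\<integral>\<^sup>+y. ?F (y(0 := H * sqrt N + b * y 0)) \<partial>lebn ?K)
      = (\<integral>\<^sup>+y. ennreal (b\<^sup>2 powr a) * ?G y \<partial>lebn ?K)"
  proof (intro nn_integral_cong)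
    fix y
    define R z where "R = sqs ?K y - (y 0)\<^sup>2" and "z = H * sqrt N + b * y 0"
    have "(1 - H * N) * (1 - (R + z\<^sup>2)) - H * (1 - sqrt N * z)\<^sup>2
       = (1 - H * N) * (1 - R) - z\<^sup>2 - H + 2 * (H * sqrt N) * z - H * (sqrt N * sqrt N - N) * z\<^sup>2"
      by (simp add: power2_eq_square algebra_simps)
    also have "\<dots> = (1 - H * N) * (1 - R) - H + H * H * (sqrt N * sqrt N) - (z - H * sqrt N)\<^sup>2"
      using N by (simp add: power2_eq_square algebra_simps)
    also have "\<dots> = (1 - H * N) * (1 - H - R) - (z - H * sqrt N)\<^sup>2"
      using N by (simp add: algebra_simps)
    also have "(z - H * sqrt N)\<^sup>2 = b\<^sup>2 * (y 0)\<^sup>2"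
      by (simp add: z_def power_mult_distrib)
    also have "(1 - H * N) * (1 - H - R) - b\<^sup>2 * (y 0)\<^sup>2 = b\<^sup>2 * (1 - H - sqs ?K y)"
      unfolding b R_def by (simp add: algebra_simps)
    finally have "(1 - H * N) * (1 - sqs ?K (y(0 := z))) - H * (1 - sqrt N * z)\<^sup>2 = b\<^sup>2 * (1 - H - sqs ?K y)"
      by (simp add: upd R_def)
    then have "?F (y(0 := z)) = ennreal (ppow (b\<^sup>2 * (1 - H - sqs ?K y)) a)"
      by simp
    also have "\<dots> = ennreal (b\<^sup>2 powr a) * ?G y"
      using b(1) by (simp only: ppow_mult zero_less_power ennreal_mult[OF powr_ge_zero ppow_nonneg])
    finally show "?F (y(0 := H * sqrt N + b * y 0)) = ennreal (b\<^sup>2 powr a) * ?G y"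
      by (simp add: z_def)
  qed
  also have "\<dots> = ennreal (b\<^sup>2 powr a) * (\<integral>\<^sup>+y. ?G y \<partial>lebn ?K)"
    by (intro nn_integral_cmult) measurable
  also have "(\<integral>\<^sup>+y. ?G y \<partial>lebn ?K)
      = ennreal (e ^ card ?K) * (\<integral>\<^sup>+y. ?G (\<lambda>i. if i \<in> ?K then e * y i else y i) \<partial>lebn ?K)"
    by (rule nn_integral_lebn_scale[OF finite_lessThan e(1)]) measurable
  also have "(\<integral>\<^sup>+y. ?G (\<lambda>i. if i \<in> ?K then e * y i else y i) \<partial>lebn ?K)
      = (\<integral>\<^sup>+y. ennreal (e\<^sup>2 powr a) * ennreal (ppow (1 - sqs ?K y) a) \<partial>lebn ?K)"
  proof (intro nn_integral_cong)
    fix y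
    have sc: "sqs ?K (\<lambda>i. if i \<in> ?K then e * y i else y i) = e\<^sup>2 * sqs ?K y"
      by (simp add: sqs_def sum_distrib_left power_mult_distrib)
    have "1 - H - sqs ?K (\<lambda>i. if i \<in> ?K then e * y i else y i) = e\<^sup>2 * (1 - sqs ?K y)"
      unfolding sc e(2) by (simp add: algebra_simps)
    then have "ppow (1 - H - sqs ?K (\<lambda>i. if i \<in> ?K then e * y i else y i)) a
       = e\<^sup>2 powr a * ppow (1 - sqs ?K y) a"
      by (simp only:) (rule ppow_mult, use e(1) in simp)
    then show "?G (\<lambda>i. if i \<in> ?K then e * y i else y i) = ennreal (e\<^sup>2 powr a) * ennreal (ppow (1 - sqs ?K y) a)"
      by (simp only: ennreal_mult[OF powr_ge_zero ppow_nonneg])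
  qed
  also have "\<dots> = ennreal (e\<^sup>2 powr a) * ?I"
    by (intro nn_integral_cmult) measurable
  also have "ennreal \<bar>b\<bar> * (ennreal (b\<^sup>2 powr a) * (ennreal (e ^ card ?K) * (ennreal (e\<^sup>2 powr a) * ?I)))
     = ennreal ((b * b\<^sup>2 powr a) * (e ^ k * e\<^sup>2 powr a)) * ?I"
    using b e by (simp add: ennreal_mult mult_ac)
  also have "b * b\<^sup>2 powr a = (1 - H * N) powr (a + 1 / 2)"
    using N by (simp add: b(2) powr_add b_def powr_half_sqrt mult_ac)
  also have "e ^ k * e\<^sup>2 powr a = (1 - H) powr (a + k / 2)"
  proof -
    have "e ^ k = (1 - H) powr (k / 2)"
      using H e by (simp add: e_def powr_half_sqrt[symmetric] powr_powr powr_realpow[symmetric])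
    then show ?thesis by (simp add: e(2) powr_add mult_ac)
  qed
  finally show ?thesis .
qed

text \<open>The exponent equals that of the marginal density, so \<open>v powr a\<close> multiplies
  into the other power and cancels the denominator \<open>v\<close>. What remains is the ellipsoid
  integral. The exponent on the right is larger by 1/2, which is the exponent of the chain one step
  earlier.\<close>

lemma gs_step_expectation:
  assumes k: "k < d" and nd: "gs_nondeg d x k" and H: "0 < H" "H < 1"
  shows "(\<integral>\<^sup>+v. ennreal (ppow (1 - H * (gs_norm d x k + (1 - inner_dim d v (gs_sol d x k))\<^sup>2
            / inner_dim d (gs_res d x k v) (gs_res d x k v))) (real (d - k) / 2 - 1)) \<partial>uniform_sphere d)
    = ennreal (ppow (1 - H * gs_norm d x k) (real (d - k) / 2 - 1 / 2) * (1 - H) powr (d / 2 - 1))"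
proof (cases "k = 0")
  \<comment> \<open>There is no coordinate 0 to rotate onto: the solution is still 0 and the
    residual is the point itself, of norm 1, so the integrand is constant.\<close>
  case True
  interpret S: prob_space "uniform_sphere d" using k by (intro prob_space_uniform_sphere) auto
  have "(\<integral>\<^sup>+v. ennreal (ppow (1 - H * (gs_norm d x k + (1 - inner_dim d v (gs_sol d x k))\<^sup>2
            / inner_dim d (gs_res d x k v) (gs_res d x k v))) (real (d - k) / 2 - 1)) \<partial>uniform_sphere d)
      = (\<integral>\<^sup>+v. ennreal ((1 - H) powr (d / 2 - 1)) \<partial>uniform_sphere d)"
  proof (rule nn_integral_cong_AE)
    have "0 < d" using k by simp
    show "AE v in uniform_sphere d. ennreal (ppow (1 - H * (gs_norm d x k + (1 - inner_dim d v (gs_sol d x k))\<^sup>2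
            / inner_dim d (gs_res d x k v) (gs_res d x k v))) (real (d - k) / 2 - 1)) = ennreal ((1 - H) powr (d / 2 - 1))"
      using AE_uniform_sphere_norm[OF \<open>0 < d\<close>]
      by eventually_elim (use True H in \<open>simp add: gs_norm_def inner_dim_self[of d] ppow_def\<close>)
  qed
  then show ?thesis
    using True S.emeasure_space_1 by (simp add: gs_norm_def ppow_def)
next
  case False
  then have k0: "0 < k" by simp
  let ?N = "gs_norm d x k" and ?a = "real (d - k) / 2 - 1"
  let ?\<phi> = "\<lambda>u v. ennreal (ppow (1 - H * (?N + (1 - u)\<^sup>2 / v)) ?a)"
  show ?thesis
  proof (cases "H * ?N < 1")
    \<comment> \<open>The norm of the solution never decreases, so both sides are 0.\<close>
    case False
    have "ppow (1 - H * (?N + (1 - inner_dim d v (gs_sol d x k))\<^sup>2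
            / inner_dim d (gs_res d x k v) (gs_res d x k v))) ?a = 0" for v
    proof -
      have "0 \<le> H * ((1 - inner_dim d v (gs_sol d x k))\<^sup>2 / inner_dim d (gs_res d x k v) (gs_res d x k v))"
        using H by simp
      then show ?thesis using False by (simp add: ppow_def distrib_left)
    qed
    then show ?thesis using False by (simp add: ppow_def)
  next
    case HN: True
    show ?thesis
    proof -
      let ?c = "ennreal (marginal_const d k)"
      let ?I = "\<integral>\<^sup>+y. marginal_weight d k y \<partial>lebn {..<k}"
      have "(\<integral>\<^sup>+v. ?\<phi> (inner_dim d v (gs_sol d x k)) (inner_dim d (gs_res d x k v) (gs_res d x k v)) \<partial>uniform_sphere d)
        = ?c * (\<integral>\<^sup>+y. ?\<phi> (sqrt ?N * y 0) (1 - sqs {..<k} y) * marginal_weight d k y \<partial>lebn {..<k})"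
        by (rule gs_step_law[OF k0 k nd]) (simp add: split_def)
      also have "(\<integral>\<^sup>+y. ?\<phi> (sqrt ?N * y 0) (1 - sqs {..<k} y) * ennreal (ppow (1 - sqs {..<k} y) ?a) \<partial>lebn {..<k})
        = (\<integral>\<^sup>+y. ennreal (ppow ((1 - H * ?N) * (1 - sqs {..<k} y) - H * (1 - sqrt ?N * y 0)\<^sup>2) ?a) \<partial>lebn {..<k})"
      proof (intro nn_integral_cong)
        fix y
        let ?v = "1 - sqs {..<k} y"
        show "?\<phi> (sqrt ?N * y 0) ?v * ennreal (ppow ?v ?a)
          = ennreal (ppow ((1 - H * ?N) * ?v - H * (1 - sqrt ?N * y 0)\<^sup>2) ?a)"
        proof (cases "?v > 0")
          case True
          have "ppow (?v * (1 - H * (?N + (1 - sqrt ?N * y 0)\<^sup>2 / ?v))) ?a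
             = ?v powr ?a * ppow (1 - H * (?N + (1 - sqrt ?N * y 0)\<^sup>2 / ?v)) ?a"
            using True by (rule ppow_mult)
          also have "?v powr ?a = ppow ?v ?a" using True by (simp add: ppow_def)
          also have "?v * (1 - H * (?N + (1 - sqrt ?N * y 0)\<^sup>2 / ?v))
              = (1 - H * ?N) * ?v - H * (1 - sqrt ?N * y 0)\<^sup>2"
            using True by (simp add: field_simps)
          finally show ?thesis
            by (simp add: ennreal_mult mult_ac)
        next
          case False
          then have "(1 - H * ?N) * ?v \<le> 0" using HN by (simp add: mult_le_0_iff)
          moreover have "0 \<le> H * (1 - sqrt ?N * y 0)\<^sup>2" using H by simp
          ultimately have "\<not> (1 - H * ?N) * ?v - H * (1 - sqrt ?N * y 0)\<^sup>2 > 0" by linarith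
          then show ?thesis using False by (simp add: ppow_def)
        qed
      qed
      also have "\<dots> = ennreal ((1 - H * ?N) powr (?a + 1 / 2) * (1 - H) powr (?a + k / 2)) * ?I"
        by (rule nn_integral_ppow_ellipsoid) (use k0 HN H in auto)
      also have "?c * (ennreal ((1 - H * ?N) powr (?a + 1 / 2) * (1 - H) powr (?a + k / 2)) * ?I)
         = ennreal ((1 - H * ?N) powr (?a + 1 / 2) * (1 - H) powr (?a + k / 2))"
        by (simp only: mult.left_commute[of ?c] marginal_const_normalized[OF k] mult_1_right)
      also have "?a + k / 2 = d / 2 - 1" using k by (simp add: of_nat_diff field_simps)
      also have "?a + 1 / 2 = real (d - k) / 2 - 1 / 2" by simp
      finally show ?thesis using HN by (simp add: ppow_def)
    qed
  qed
qed

section \<open>Independent uniform points\<close>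

abbreviation (input) sph :: "nat \<Rightarrow> nat set \<Rightarrow> (nat \<Rightarrow> nat \<Rightarrow> real) measure"
  where "sph d I \<equiv> PiM I (\<lambda>_. uniform_sphere d)"

lemma product_sigma_finite_sphere: "0 < d \<Longrightarrow> product_sigma_finite (\<lambda>_::nat. uniform_sphere d)"
  using prob_space_uniform_sphere[of d]
  by (simp add: product_sigma_finite_def prob_space_imp_sigma_finite)

lemma measurable_sph_component: "j \<in> I \<Longrightarrow> (\<lambda>x. x j) \<in> borel_measurable (sph d I)"
  using measurable_component_singleton[of j I "\<lambda>_. uniform_sphere d"]
  by (simp add: measurable_cong_sets[OF refl sets_uniform_sphere])

lemma nn_integral_sph_Suc:
  assumes "0 < d" "f \<in> borel_measurable (sph d {..<Suc k})"
  shows "(\<integral>\<^sup>+x. f x \<partial>sph d {..<Suc k}) = (\<integral>\<^sup>+x. (\<integral>\<^sup>+v. f (x(k := v)) \<partial>uniform_sphere d) \<partial>sph d {..<k})"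
proof -
  interpret product_sigma_finite "\<lambda>_::nat. uniform_sphere d"
    using assms(1) by (rule product_sigma_finite_sphere)
  show ?thesis
    using product_nn_integral_insert[of "{..<k}" k f] assms(2) by (simp add: lessThan_Suc)
qed

lemma prob_space_sph: "0 < d \<Longrightarrow> prob_space (sph d I)"
  by (intro prob_space_PiM prob_space_uniform_sphere)

lemma gs_update [simp]:
  "gs_res d (x(k := v)) k u = gs_res d x k u"
  "gs_sol d (x(k := v)) k = gs_sol d x k"
  "gs_norm d (x(k := v)) k = gs_norm d x k"
  "gs_nondeg d (x(k := v)) k \<longleftrightarrow> gs_nondeg d x k"
  by (rule gs_res_cong gs_sol_cong gs_norm_cong gs_nondeg_cong; simp)+

text \<open>In the law of one step, a vanishing residual means \<open>1 - sqs {..<k} y = 0\<close>,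
  and there the marginal weight is 0 by the convention of \<open>ppow\<close>.\<close>

lemma AE_gs_nondeg_step:
  assumes k: "k < d" and nd: "gs_nondeg d x k"
  shows "AE v in uniform_sphere d. gs_nondeg d (x(k := v)) (Suc k)"
proof -
  have "AE v in uniform_sphere d. inner_dim d (gs_res d x k v) (gs_res d x k v) \<noteq> 0"
  proof (cases "k = 0")
    case True
    have "0 < d" using k by simp
    show ?thesis
      using AE_uniform_sphere_norm[OF \<open>0 < d\<close>]
      by eventually_elim (simp add: True inner_dim_self)
  next
    case False
    then have k0: "0 < k" by simp
    have [measurable]: "(\<lambda>v. gs_res d x k v) \<in> borel_measurable borel"
      by (rule measurable_gs_res[of k "\<lambda>_. x"]) simp_all
    have "(\<integral>\<^sup>+v. indicator {0} (inner_dim d (gs_res d x k v) (gs_res d x k v)) \<partial>uniform_sphere d) = (0 :: ennreal)"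
    proof -
      have "(\<integral>\<^sup>+y. indicator {0} (1 - sqs {..<k} y) * ennreal (ppow (1 - sqs {..<k} y) (real (d - k) / 2 - 1)) \<partial>lebn {..<k})
         = (\<integral>\<^sup>+y. 0 \<partial>lebn {..<k})"
        by (intro nn_integral_cong) (auto simp: indicator_def ppow_def)
      then show "(\<integral>\<^sup>+v. indicator {0} (inner_dim d (gs_res d x k v) (gs_res d x k v)) \<partial>uniform_sphere d) = (0 :: ennreal)"
        using gs_step_law[OF k0 k nd, of "\<lambda>_ v. indicator {0} v"] by (simp add: split_def)
    qed
    then have "AE v in uniform_sphere d. indicator {0} (inner_dim d (gs_res d x k v) (gs_res d x k v)) = (0 :: ennreal)"
      by (subst (asm) nn_integral_0_iff_AE) measurable
    then show ?thesis by eventually_elim (simp add: indicator_def split: if_splits)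
  qed
  then show ?thesis
    by eventually_elim (simp add: gs_nondeg_Suc nd)
qed

lemma AE_gs_nondeg: "k \<le> d \<Longrightarrow> AE x in sph d {..<k}. gs_nondeg d x k"
proof (induction k)
  case 0
  then show ?case by (simp add: gs_nondeg_def)
next
  case (Suc k)
  then have k: "k < d" and d: "0 < d" by auto
  let ?f = "\<lambda>x. indicator {x. \<not> gs_nondeg d x (Suc k)} x :: ennreal"
  have pred[measurable]: "Measurable.pred (sph d {..<Suc k}) (\<lambda>x. gs_nondeg d x (Suc k))"
    by (rule measurable_gs_nondeg) (rule measurable_sph_component, simp)
  have f[measurable]: "?f \<in> borel_measurable (sph d {..<Suc k})"
    by (simp add: indicator_def)
  have "(\<integral>\<^sup>+x. ?f x \<partial>sph d {..<Suc k}) = (\<integral>\<^sup>+x. (\<integral>\<^sup>+v. ?f (x(k := v)) \<partial>uniform_sphere d) \<partial>sph d {..<k})"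
    by (rule nn_integral_sph_Suc[OF d f])
  also have "\<dots> = (\<integral>\<^sup>+x. 0 \<partial>sph d {..<k})"
  proof (rule nn_integral_cong_AE)
    show "AE x in sph d {..<k}. (\<integral>\<^sup>+v. ?f (x(k := v)) \<partial>uniform_sphere d) = 0"
      using Suc.IH[OF less_imp_le[OF k]]
    proof eventually_elim
      case (elim x)
      have "(\<integral>\<^sup>+v. ?f (x(k := v)) \<partial>uniform_sphere d) = (\<integral>\<^sup>+v. 0 \<partial>uniform_sphere d)"
        by (rule nn_integral_cong_AE) (use AE_gs_nondeg_step[OF k elim] in \<open>eventually_elim, simp add: indicator_def\<close>)
      then show ?case by simp
    qed
  qed
  finally have "AE x in sph d {..<Suc k}. ?f x = 0"
    by (simp add: nn_integral_0_iff_AE)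
  then show ?case by eventually_elim (simp add: indicator_def split: if_splits)
qed

lemma measurable_gs_norm_sph: "{..<k} \<subseteq> I \<Longrightarrow> (\<lambda>x. gs_norm d x k) \<in> borel_measurable (sph d I)"
  by (rule measurable_gs_norm) (rule measurable_sph_component, auto)

text \<open>
  The exponent is chosen so that \<open>ppow (1 - H * gs_norm d x k) _\<close> is, up to a constant factor, a
  martingale; at \<open>k = d - 1\<close> it is the indicator of \<open>H * gs_norm d x k < 1\<close>.
\<close>

lemma gs_norm_expectation:
  assumes H: "0 < H" "H < 1" and k: "k < d"
  shows "(\<integral>\<^sup>+x. ennreal (ppow (1 - H * gs_norm d x k) (real (d - k) / 2 - 1 / 2)) \<partial>sph d {..<k})
    = ennreal ((1 - H) powr (k * (d / 2 - 1)))"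
  using k
proof (induction k)
  case 0
  interpret prob_space "sph d {..<0}" using 0 by (intro prob_space_sph) auto
  show ?case
    using emeasure_space_1 H by (simp add: gs_norm_def ppow_def)
next
  case (Suc k)
  then have k: "k < d" and d: "0 < d" by auto
  have [measurable]: "(\<lambda>x. gs_norm d x (Suc k)) \<in> borel_measurable (sph d {..<Suc k})"
    "(\<lambda>x. gs_norm d x k) \<in> borel_measurable (sph d {..<k})"
    by (auto intro: measurable_gs_norm_sph)
  let ?a = "real (d - Suc k) / 2 - 1 / 2"
  have a: "?a = real (d - k) / 2 - 1" using k by (simp add: of_nat_diff field_simps)
  have "(\<integral>\<^sup>+x. ennreal (ppow (1 - H * gs_norm d x (Suc k)) ?a) \<partial>sph d {..<Suc k})
    = (\<integral>\<^sup>+x. (\<integral>\<^sup>+v. ennreal (ppow (1 - H * gs_norm d (x(k := v)) (Suc k)) ?a) \<partial>uniform_sphere d) \<partial>sph d {..<k})"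
    by (rule nn_integral_sph_Suc[OF d]) measurable
  also have "\<dots> = (\<integral>\<^sup>+x. ennreal ((1 - H) powr (d / 2 - 1)) *
      ennreal (ppow (1 - H * gs_norm d x k) (real (d - k) / 2 - 1 / 2)) \<partial>sph d {..<k})"
  proof (rule nn_integral_cong_AE)
    show "AE x in sph d {..<k}. (\<integral>\<^sup>+v. ennreal (ppow (1 - H * gs_norm d (x(k := v)) (Suc k)) ?a) \<partial>uniform_sphere d)
      = ennreal ((1 - H) powr (d / 2 - 1)) * ennreal (ppow (1 - H * gs_norm d x k) (real (d - k) / 2 - 1 / 2))"
      using AE_gs_nondeg[OF less_imp_le[OF k]]
    proof eventually_elim
      case (elim x)
      have "(\<integral>\<^sup>+v. ennreal (ppow (1 - H * gs_norm d (x(k := v)) (Suc k)) ?a) \<partial>uniform_sphere d)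
         = (\<integral>\<^sup>+v. ennreal (ppow (1 - H * (gs_norm d x k + (1 - inner_dim d v (gs_sol d x k))\<^sup>2
            / inner_dim d (gs_res d x k v) (gs_res d x k v))) (real (d - k) / 2 - 1)) \<partial>uniform_sphere d)"
        by (rule nn_integral_cong_AE)
          (use AE_gs_nondeg_step[OF k elim] in \<open>eventually_elim, simp add: gs_norm_Suc a\<close>)
      also have "\<dots> = ennreal (ppow (1 - H * gs_norm d x k) (real (d - k) / 2 - 1 / 2) * (1 - H) powr (d / 2 - 1))"
        by (rule gs_step_expectation[OF k elim H])
      finally show ?case by (simp add: ennreal_mult mult_ac)
    qed
  qed
  also have "\<dots> = ennreal ((1 - H) powr (d / 2 - 1)) * ennreal ((1 - H) powr (k * (d / 2 - 1)))"
    by (subst nn_integral_cmult) (simp_all add: Suc.IH[OF k])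
  also have "\<dots> = ennreal ((1 - H) powr (Suc k * (d / 2 - 1)))"
    by (subst ennreal_mult[symmetric]) (auto simp: powr_add[symmetric] algebra_simps add_divide_distrib)
  finally show ?case .
qed

section \<open>Tails of the distance, and the effect of the last point\<close>

lemma ppow_0: "ennreal (ppow t 0) = indicator {0<..} t"
  by (simp add: ppow_def indicator_def)

lemma emeasure_gs_norm_penultimate:
  assumes H: "0 < H" "H < 1" and d: "2 \<le> d"
  shows "(\<integral>\<^sup>+x. indicator {0<..} (1 - H * gs_norm d x (d - 1)) \<partial>sph d {..<d - 1})
    = ennreal ((1 - H) powr (real (d - 1) * (d / 2 - 1)))"
proof -
  have "real (d - (d - 1)) / 2 - 1 / 2 = 0" using d by simp
  then show ?thesis
    using gs_norm_expectation[OF H, of "d - 1" d] d by (simp add: ppow_0)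
qed

text \<open>The last point enlarges the affine hull, hence brings it closer to the origin, and the
  exact tail for \<open>d - 1\<close> points remains an upper bound.\<close>

lemma emeasure_gs_norm_upper:
  assumes H: "0 < H" "H < 1" and d: "2 \<le> d"
  shows "(\<integral>\<^sup>+x. indicator {0<..} (1 - H * gs_norm d x d) \<partial>sph d {..<d})
    \<le> ennreal ((1 - H) powr (real (d - 1) * (d / 2 - 1)))"
proof -
  define k where "k = d - 1"
  have k: "d = Suc k" "k < d" and d0: "0 < d" using d by (auto simp: k_def)
  interpret S: prob_space "uniform_sphere d" using d0 by (rule prob_space_uniform_sphere)
  have [measurable]: "(\<lambda>x. gs_norm d x k) \<in> borel_measurable (sph d {..<Suc k})"
    "(\<lambda>x. gs_norm d x (Suc k)) \<in> borel_measurable (sph d {..<Suc k})"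
    by (auto intro!: measurable_gs_norm_sph)
  have "(\<integral>\<^sup>+x. indicator {0<..} (1 - H * gs_norm d x d) \<partial>sph d {..<d})
     \<le> (\<integral>\<^sup>+x. indicator {0<..} (1 - H * gs_norm d x k) \<partial>sph d {..<d})"
  proof (rule nn_integral_mono_AE)
    show "AE x in sph d {..<d}. indicator {0<..} (1 - H * gs_norm d x d)
       \<le> (indicator {0<..} (1 - H * gs_norm d x k) :: ennreal)"
      using AE_gs_nondeg[of d d, OF order_refl]
    proof eventually_elim
      case (elim x)
      then have "gs_norm d x k \<le> gs_norm d x d"
        using gs_norm_Suc[of d x k] by (simp add: k(1)[symmetric] gs_norm_nonneg)
      then have "H * gs_norm d x k \<le> H * gs_norm d x d" using H by simp
      then show ?case by (auto simp: indicator_def)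
    qed
  qed
  also have "\<dots> = (\<integral>\<^sup>+x. indicator {0<..} (1 - H * gs_norm d x k) \<partial>sph d {..<Suc k})"
    using k(1) by simp
  also have "\<dots> = (\<integral>\<^sup>+x. (\<integral>\<^sup>+v. indicator {0<..} (1 - H * gs_norm d (x(k := v)) k) \<partial>uniform_sphere d) \<partial>sph d {..<k})"
    by (rule nn_integral_sph_Suc[OF d0]) measurable
  also have "\<dots> = (\<integral>\<^sup>+x. indicator {0<..} (1 - H * gs_norm d x k) \<partial>sph d {..<k})"
    using S.emeasure_space_1 by simp
  finally show ?thesis
    using emeasure_gs_norm_penultimate[OF assms] by (simp add: k_def)
qed

text \<open>In polar form the left integral is at most 2, since
  \<open>v powr (k / 2 - 1) \<le> 1\<close> on the unit interval for \<open>k \<ge> 2\<close>, while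
  the right one is at least \<open>2 / k\<close>. This compares the normalization of the marginal at
  \<open>k = d - 1\<close> with the volume of the ball.\<close>

lemma nn_integral_ppow_compare:
  assumes k: "2 \<le> k"
  shows "(\<integral>\<^sup>+y. ennreal (ppow (1 - sqs {..<k} y) (-1/2)) \<partial>lebn {..<k})
    \<le> ennreal k * (\<integral>\<^sup>+y. ennreal (ppow (1 - sqs {..<k} y) 0) \<partial>lebn {..<k})"
proof -
  have K: "finite {..<k}" "{..<k} \<noteq> {}" using k by (auto simp: lessThan_empty_iff)
  show ?thesis
  proof (rule nn_integral_lebn_polar[OF K])
    fix C :: real
    assume C: "C > 0" and polar: "\<And>\<Phi>. \<Phi> \<in> borel_measurable borel \<Longrightarrow> (\<integral>\<^sup>+x. \<Phi> (sqs {..<k} x) \<partial>lebn {..<k})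
       = ennreal C * (\<integral>\<^sup>+v. \<Phi> v * (ennreal (v powr (card {..<k} / 2 - 1)) * indicator {0<..} v) \<partial>lborel)"
    have "(\<integral>\<^sup>+v. ennreal (ppow (1 - v) (-1/2)) * (ennreal (v powr (k / 2 - 1)) * indicator {0<..} v) \<partial>lborel)
       \<le> (\<integral>\<^sup>+v. (\<lambda>u. ennreal (u powr (1/2 - 1)) * indicator {0<..1} u) (1 + (-1) * v) \<partial>lborel)"
    proof (intro nn_integral_mono)
      fix v :: real
      have "v powr (k / 2 - 1) \<le> 1" if "0 < v" "v < 1"
        using that k by (intro powr_le1) auto
      then have "(1 - v) powr (-1/2) * v powr (k / 2 - 1) \<le> (1 - v) powr (-1/2)" if "0 < v" "v < 1"
        using that by (intro mult_left_le) auto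
      then show "ennreal (ppow (1 - v) (-1/2)) * (ennreal (v powr (k / 2 - 1)) * indicator {0<..} v)
         \<le> ennreal ((1 + (-1) * v) powr (1/2 - 1)) * indicator {0<..1} (1 + (-1) * v)"
        by (auto simp: ppow_def indicator_def ennreal_mult[symmetric] intro!: ennreal_leI)
    qed
    also have "\<dots> = (\<integral>\<^sup>+u. ennreal (u powr (1/2 - 1)) * indicator {0<..1} u \<partial>lborel)"
      by (subst nn_integral_real_affine[where c="-1" and t=1 and f="\<lambda>u. ennreal (u powr (1/2 - 1)) * indicator {0<..1} u"]) auto
    also have "\<dots> = ennreal 2"
      by (subst nn_integral_powr_from_0) auto
    finally have 1: "(\<integral>\<^sup>+v. ennreal (ppow (1 - v) (-1/2)) * (ennreal (v powr (k / 2 - 1)) * indicator {0<..} v) \<partial>lborel) \<le> ennreal 2" .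
    have "(\<integral>\<^sup>+v. ennreal (ppow (1 - v) 0) * (ennreal (v powr (k / 2 - 1)) * indicator {0<..} v) \<partial>lborel)
       \<ge> (\<integral>\<^sup>+v. ennreal (v powr (k / 2 - 1)) * indicator {0<..1} v \<partial>lborel)"
    proof (rule nn_integral_mono_AE)
      show "AE v in lborel. ennreal (v powr (k / 2 - 1)) * indicator {0<..1} v
         \<le> ennreal (ppow (1 - v) 0) * (ennreal (v powr (k / 2 - 1)) * indicator {0<..} v)"
        using AE_lborel_singleton[of "1::real"]
        by eventually_elim (auto simp: ppow_def indicator_def)
    qed
    also have "(\<integral>\<^sup>+v. ennreal (v powr (k / 2 - 1)) * indicator {0<..1} v \<partial>lborel) = ennreal (2 / k)"
      by (subst nn_integral_powr_from_0) (use k in auto)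
    finally have 2: "ennreal (2 / k) \<le> (\<integral>\<^sup>+v. ennreal (ppow (1 - v) 0) * (ennreal (v powr (k / 2 - 1)) * indicator {0<..} v) \<partial>lborel)" .
    have "(\<integral>\<^sup>+y. ennreal (ppow (1 - sqs {..<k} y) (-1/2)) \<partial>lebn {..<k}) \<le> ennreal C * ennreal 2"
      using 1 polar[of "\<lambda>v. ennreal (ppow (1 - v) (-1/2))"] by (simp add: mult_left_mono)
    also have "\<dots> = ennreal k * (ennreal C * ennreal (2 / k))"
      using C k by (simp add: ennreal_mult[symmetric] del: ennreal_numeral)
    also have "\<dots> \<le> ennreal k * (\<integral>\<^sup>+y. ennreal (ppow (1 - sqs {..<k} y) 0) \<partial>lebn {..<k})"
      using 2 polar[of "\<lambda>v. ennreal (ppow (1 - v) 0)"] by (simp add: mult_left_mono)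
    finally show ?thesis .
  qed
qed

text \<open>At \<open>k = d - 1\<close> the marginal weight is \<open>v powr (-1/2) \<ge> 1\<close>.
  Dropping it leaves the volume of the ellipsoid, known from exponent 0, and the comparison of
  normalizations costs only the factor \<open>1 / k\<close>.\<close>

lemma emeasure_gs_norm_last_step:
  assumes H: "0 < H" "H < 1" and d: "d = Suc k" "2 \<le> k" and nd: "gs_nondeg d x k"
  shows "ennreal (ppow (1 - H * gs_norm d x k) (1 / 2) * (1 - H) powr (k / 2) / k)
    \<le> (\<integral>\<^sup>+v. indicator {0<..} (1 - H * gs_norm d (x(k := v)) (Suc k)) \<partial>uniform_sphere d)"
proof -
  have k: "d = Suc k" "k < d" "0 < k" "2 \<le> k" using d by auto
  let ?N = "gs_norm d x k"
  show ?thesis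
  proof (cases "H * ?N < 1")
    case False
    then show ?thesis by (simp add: ppow_def)
  next
    case HN: True
    show ?thesis
    proof -
      let ?c = "ennreal (marginal_const d k)"
      have a: "real (d - k) / 2 - 1 = -1/2" using k by simp
      let ?I0 = "\<integral>\<^sup>+y. ennreal (ppow (1 - sqs {..<k} y) 0) \<partial>lebn {..<k}"
      let ?\<phi> = "\<lambda>u v. indicator {0<..} (1 - H * (?N + (1 - u)\<^sup>2 / v)) :: ennreal"
      have "1 \<le> ?c * (ennreal k * ?I0)"
        using marginal_const_normalized[OF k(2)] mult_left_mono[OF nn_integral_ppow_compare[OF k(4)], of ?c]
        by (simp add: a)
      then have I0: "ennreal (1 / k) \<le> ?c * ?I0"
      proof -
        have "ennreal (1 / k) * 1 \<le> ennreal (1 / k) * (?c * (ennreal k * ?I0))"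
          using \<open>1 \<le> ?c * (ennreal k * ?I0)\<close> by (intro mult_left_mono) auto
        also have "\<dots> = (ennreal (1 / k) * ennreal k) * (?c * ?I0)"
          by (simp add: mult_ac)
        also have "ennreal (1 / k) * ennreal k = 1"
          using k by (simp add: ennreal_mult[symmetric])
        finally show ?thesis by simp
      qed
      have "ennreal (ppow (1 - H * ?N) (1 / 2) * (1 - H) powr (k / 2) / k)
        = ennreal ((1 - H * ?N) powr (0 + 1 / 2) * (1 - H) powr (0 + k / 2)) * ennreal (1 / k)"
        using HN by (subst ennreal_mult[symmetric]) (auto simp: ppow_def)
      also have "\<dots> \<le> ennreal ((1 - H * ?N) powr (0 + 1 / 2) * (1 - H) powr (0 + k / 2)) * (?c * ?I0)"
        using I0 by (intro mult_left_mono) auto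
      also have "\<dots> = ?c * (ennreal ((1 - H * ?N) powr (0 + 1 / 2) * (1 - H) powr (0 + k / 2)) * ?I0)"
        by (simp add: mult_ac)
      also have "ennreal ((1 - H * ?N) powr (0 + 1 / 2) * (1 - H) powr (0 + k / 2)) * ?I0
        = (\<integral>\<^sup>+y. ennreal (ppow ((1 - H * ?N) * (1 - sqs {..<k} y) - H * (1 - sqrt ?N * y 0)\<^sup>2) 0) \<partial>lebn {..<k})"
        by (rule nn_integral_ppow_ellipsoid[symmetric]) (use k HN H in auto)
      also have "\<dots> \<le> (\<integral>\<^sup>+y. ?\<phi> (sqrt ?N * y 0) (1 - sqs {..<k} y) * ennreal (ppow (1 - sqs {..<k} y) (-1/2)) \<partial>lebn {..<k})"
      proof (intro nn_integral_mono)
        fix y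
        let ?v = "1 - sqs {..<k} y"
        show "ennreal (ppow ((1 - H * ?N) * ?v - H * (1 - sqrt ?N * y 0)\<^sup>2) 0)
          \<le> ?\<phi> (sqrt ?N * y 0) ?v * ennreal (ppow ?v (-1/2))"
        proof (cases "(1 - H * ?N) * ?v - H * (1 - sqrt ?N * y 0)\<^sup>2 > 0")
          case True
          have "0 \<le> H * (1 - sqrt ?N * y 0)\<^sup>2" using H by simp
          then have "(1 - H * ?N) * ?v > 0" using True by linarith
          then have v: "?v > 0" using HN by (simp add: zero_less_mult_iff)
          have "?v * (1 - H * (?N + (1 - sqrt ?N * y 0)\<^sup>2 / ?v))
              = (1 - H * ?N) * ?v - H * (1 - sqrt ?N * y 0)\<^sup>2"
            using v by (simp add: field_simps)
          then have "?v * (1 - H * (?N + (1 - sqrt ?N * y 0)\<^sup>2 / ?v)) > 0"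
            using True by simp
          then have "1 - H * (?N + (1 - sqrt ?N * y 0)\<^sup>2 / ?v) > 0"
            using v by (simp add: zero_less_mult_iff)
          moreover have "1 \<le> ?v powr (-1/2)"
            using v powr_mono'[of "-1/2" 0 ?v] by simp
          ultimately show ?thesis
            using v True by (simp add: ppow_def indicator_def)
        qed (simp add: ppow_def)
      qed
      also have "?c * (\<integral>\<^sup>+y. ?\<phi> (sqrt ?N * y 0) (1 - sqs {..<k} y) * ennreal (ppow (1 - sqs {..<k} y) (-1/2)) \<partial>lebn {..<k})
        = (\<integral>\<^sup>+v. ?\<phi> (inner_dim d v (gs_sol d x k)) (inner_dim d (gs_res d x k v) (gs_res d x k v)) \<partial>uniform_sphere d)"
        by (subst gs_step_law[OF k(3,2) nd]) (simp_all add: split_def a)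
      also have "\<dots> = (\<integral>\<^sup>+v. indicator {0<..} (1 - H * gs_norm d (x(k := v)) (Suc k)) \<partial>uniform_sphere d)"
        by (rule nn_integral_cong_AE)
          (use AE_gs_nondeg_step[OF k(2) nd] in \<open>eventually_elim, simp add: gs_norm_Suc\<close>)
      finally show ?thesis
        by (simp add: mult_left_mono)
    qed
  qed
qed

text \<open>The first \<open>d - 1\<close> points are required to satisfy the stronger bound with
  \<open>H'\<close>. On that event \<open>1 - H * gs_norm d x k\<close> stays above
  \<open>1 - H / H'\<close>, so the estimate of the last step is uniform and the exact tail at
  \<open>H'\<close> can be used.\<close>

lemma emeasure_gs_norm_lower:
  assumes H: "0 < H" "H < H'" "H' < 1" and d: "3 \<le> d"
  shows "ennreal ((1 - H / H') powr (1 / 2) * (1 - H) powr (real (d - 1) / 2) / real (d - 1)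
      * (1 - H') powr (real (d - 1) * (d / 2 - 1)))
    \<le> (\<integral>\<^sup>+x. indicator {0<..} (1 - H * gs_norm d x d) \<partial>sph d {..<d})"
proof -
  define k where "k = d - 1"
  have k: "d = Suc k" "k < d" and d0: "0 < d" using d by (auto simp: k_def)
  let ?A = "(1 - H / H') powr (1 / 2) * (1 - H) powr (k / 2) / k"
  have [measurable]: "(\<lambda>x. gs_norm d x (Suc k)) \<in> borel_measurable (sph d {..<Suc k})"
    "(\<lambda>x. gs_norm d x k) \<in> borel_measurable (sph d {..<k})"
    by (auto intro!: measurable_gs_norm_sph)
  have "ennreal (?A * (1 - H') powr (real (d - 1) * (d / 2 - 1)))
      = ennreal ?A * (\<integral>\<^sup>+x. indicator {0<..} (1 - H' * gs_norm d x k) \<partial>sph d {..<k})"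
    using emeasure_gs_norm_penultimate[of H' d] H d
    by (subst ennreal_mult) (auto simp: k_def)
  also have "\<dots> = (\<integral>\<^sup>+x. ennreal ?A * indicator {0<..} (1 - H' * gs_norm d x k) \<partial>sph d {..<k})"
    by (subst nn_integral_cmult) auto
  also have "\<dots> \<le> (\<integral>\<^sup>+x. (\<integral>\<^sup>+v. indicator {0<..} (1 - H * gs_norm d (x(k := v)) (Suc k)) \<partial>uniform_sphere d) \<partial>sph d {..<k})"
  proof (rule nn_integral_mono_AE)
    show "AE x in sph d {..<k}. ennreal ?A * indicator {0<..} (1 - H' * gs_norm d x k)
       \<le> (\<integral>\<^sup>+v. indicator {0<..} (1 - H * gs_norm d (x(k := v)) (Suc k)) \<partial>uniform_sphere d)"
      using AE_gs_nondeg[OF less_imp_le[OF k(2)]]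
    proof eventually_elim
      case (elim x)
      have "ennreal ?A * indicator {0<..} (1 - H' * gs_norm d x k)
        \<le> ennreal (ppow (1 - H * gs_norm d x k) (1 / 2) * (1 - H) powr (k / 2) / k)"
      proof (cases "H' * gs_norm d x k < 1")
        case True
        have "H * gs_norm d x k = H / H' * (H' * gs_norm d x k)" using H by simp
        also have "\<dots> \<le> H / H' * 1" using True H by (intro mult_left_mono) auto
        finally have le: "1 - H / H' \<le> 1 - H * gs_norm d x k" by simp
        have pos: "0 < 1 - H / H'" using H by simp
        have "(1 - H / H') powr (1 / 2) \<le> ppow (1 - H * gs_norm d x k) (1 / 2)"
          using le pos by (auto simp: ppow_def intro!: powr_mono2)
        then show ?thesis using True
          by (auto simp: indicator_def intro!: ennreal_leI mult_right_mono divide_right_mono)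
      qed (simp add: indicator_def)
      also have "\<dots> \<le> (\<integral>\<^sup>+v. indicator {0<..} (1 - H * gs_norm d (x(k := v)) (Suc k)) \<partial>uniform_sphere d)"
        by (rule emeasure_gs_norm_last_step) (use H d k elim in auto)
      finally show ?case .
    qed
  qed
  also have "\<dots> = (\<integral>\<^sup>+x. indicator {0<..} (1 - H * gs_norm d x (Suc k)) \<partial>sph d {..<Suc k})"
    by (rule nn_integral_sph_Suc[OF d0, symmetric]) measurable
  finally show ?thesis
    unfolding k(1)[symmetric] unfolding k_def .
qed


subsection \<open>Caps of the sphere\<close>

definition sphere_cdf :: "nat \<Rightarrow> real \<Rightarrow> real"
  where "sphere_cdf d t = measure (uniform_sphere d) {x. x 0 \<le> t}"

text \<open>A map in \<open>rots\<close> carries the unit vector \<open>u\<close> to axis 0.\<close>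

lemma emeasure_uniform_sphere_linear:
  assumes d: "0 < d" and u: "inner_dim d u u = 1" and A[measurable]: "A \<in> sets borel"
  shows "emeasure (uniform_sphere d) {x. inner_dim d x u \<in> A} = emeasure (uniform_sphere d) {x. x 0 \<in> A}"
proof -
  obtain Q where Q: "Q \<in> rots 0 d" "Q u 0 \<ge> 0" "\<And>l. 0 < l \<Longrightarrow> l < d \<Longrightarrow> Q u l = 0"
    using rots_align[OF d] by metis
  have eq: "inner_dim d x u = Q x 0 * Q u 0" for x
    by (rule rots_inner_axis[OF Q(1) d]) (use Q(3) in auto)
  have "(Q u 0)\<^sup>2 = 1" using eq[of u] u by (simp add: power2_eq_square)
  then have "Q u 0 = 1" using Q(2) by (simp add: power2_eq_1_iff)
  then have inner: "inner_dim d x u = Q x 0" for x using eq by simp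
  have [measurable]: "(\<lambda>x. inner_dim d x u) \<in> borel_measurable borel"
    by measurable
  have "emeasure (uniform_sphere d) {x. inner_dim d x u \<in> A}
      = (\<integral>\<^sup>+x. indicator {x. inner_dim d x u \<in> A} x \<partial>uniform_sphere d)"
    by simp
  also have "\<dots> = (\<integral>\<^sup>+x. indicator {x. x 0 \<in> A} (Q x) \<partial>uniform_sphere d)"
    by (simp add: inner indicator_def)
  also have "\<dots> = (\<integral>\<^sup>+x. indicator {x. x 0 \<in> A} x \<partial>uniform_sphere d)"
    by (rule nn_integral_uniform_sphere_rotate[OF Q(1)]) auto
  also have "\<dots> = emeasure (uniform_sphere d) {x. x 0 \<in> A}"
    by simp
  finally show ?thesis .
qed

lemma uniform_sphere_first_coordinate:
  assumes d: "2 \<le> d" and [measurable]: "f \<in> borel_measurable borel"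
  shows "(\<integral>\<^sup>+x. f (x 0) \<partial>uniform_sphere d) = ennreal (marginal_const d 1)
    * (\<integral>\<^sup>+t. f t * ennreal (ppow (1 - t\<^sup>2) (real (d - 1) / 2 - 1)) \<partial>lborel)"
proof -
  have one: "{..<1::nat} = {0}" by auto
  have [measurable]: "(\<lambda>y. y 0) \<in> borel_measurable (lebn {..<1})"
    by (intro measurable_lebn_coord) auto
  have "(\<integral>\<^sup>+x. f (x 0) \<partial>uniform_sphere d) = (\<integral>\<^sup>+x. (\<lambda>y. f (y 0)) (restrict x {..<1}) \<partial>uniform_sphere d)"
    by simp
  also have "\<dots> = ennreal (marginal_const d 1) * (\<integral>\<^sup>+y. f (y 0) * marginal_weight d 1 y \<partial>lebn {..<1})"
    by (rule uniform_sphere_marginal(2)) (use d in \<open>simp, measurable\<close>)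
  also have "(\<integral>\<^sup>+y. f (y 0) * marginal_weight d 1 y \<partial>lebn {..<1})
     = (\<integral>\<^sup>+y. (\<lambda>t. f t * ennreal (ppow (1 - t\<^sup>2) (real (d - 1) / 2 - 1))) (y 0) \<partial>lebn {0})"
    unfolding one by (simp add: sqs_def)
  also have "\<dots> = (\<integral>\<^sup>+t. f t * ennreal (ppow (1 - t\<^sup>2) (real (d - 1) / 2 - 1)) \<partial>lborel)"
  proof -
    have "(\<lambda>t. f t * ennreal (ppow (1 - t\<^sup>2) (real (d - 1) / 2 - 1))) \<in> borel_measurable borel"
      by measurable
    then show ?thesis
      by (intro lebn.product_nn_integral_singleton) (simp add: measurable_lborel1)
  qed
  finally show ?thesis .
qed

lemma emeasure_uniform_sphere_eq_0:
  assumes d: "2 \<le> d"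
  shows "emeasure (uniform_sphere d) {x. x 0 = t} = 0"
proof -
  have "emeasure (uniform_sphere d) {x. x 0 = t} = (\<integral>\<^sup>+x. indicator {x. x 0 = t} x \<partial>uniform_sphere d)"
    by simp
  also have "\<dots> = (\<integral>\<^sup>+x. indicator {t} (x 0) \<partial>uniform_sphere d)"
    by (intro nn_integral_cong) (simp add: indicator_def)
  also have "\<dots> = ennreal (marginal_const d 1)
      * (\<integral>\<^sup>+s. indicator {t} s * ennreal (ppow (1 - s\<^sup>2) (real (d - 1) / 2 - 1)) \<partial>lborel)"
    by (rule uniform_sphere_first_coordinate[OF d]) measurable
  also have "(\<integral>\<^sup>+s. indicator {t} s * ennreal (ppow (1 - s\<^sup>2) (real (d - 1) / 2 - 1)) \<partial>lborel) = (\<integral>\<^sup>+s. 0 \<partial>(lborel :: real measure))"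
    by (rule nn_integral_cong_AE)
       (use AE_lborel_singleton[of t] in \<open>eventually_elim, simp add: indicator_def\<close>)
  finally show ?thesis by simp
qed

lemma sphere_cdf_bounds: "0 < d \<Longrightarrow> 0 \<le> sphere_cdf d t \<and> sphere_cdf d t \<le> 1"
  using prob_space.prob_le_1[OF prob_space_uniform_sphere] by (simp add: sphere_cdf_def)

lemma sphere_cdf_mono: "0 < d \<Longrightarrow> s \<le> t \<Longrightarrow> sphere_cdf d s \<le> sphere_cdf d t"
proof -
  assume d: "0 < d" and st: "s \<le> t"
  interpret prob_space "uniform_sphere d" using d by (rule prob_space_uniform_sphere)
  show ?thesis
    unfolding sphere_cdf_def using st by (intro finite_measure_mono) auto
qed

text \<open>The signed unit normal is \<open>s * w / sqrt N\<close>, and a coordinate has no atoms.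
  The equality of the closed and the open case is what later makes the upper and the lower estimate
  of the facet count coincide in expectation.\<close>

lemma emeasure_halfspace:
  assumes d: "2 \<le> d" and w: "inner_dim d w w = N" "N > 0" and s: "s \<in> {1, -1}"
  shows "emeasure (uniform_sphere d) {x. s * inner_dim d x w \<le> s} = ennreal (sphere_cdf d (s / sqrt N))"
    and "emeasure (uniform_sphere d) {x. s * inner_dim d x w < s} = ennreal (sphere_cdf d (s / sqrt N))"
proof -
  have d0: "0 < d" using d by simp
  interpret prob_space "uniform_sphere d" using d0 by (rule prob_space_uniform_sphere)
  define u where "u = (\<lambda>i. s / sqrt N * w i)"
  have ss: "s * s = 1" using s by auto
  have xu: "inner_dim d x u = s / sqrt N * inner_dim d x w" for x
    by (simp add: inner_dim_def u_def sum_distrib_left mult_ac)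
  have "inner_dim d u u = s / sqrt N * (s / sqrt N * inner_dim d w w)"
    using xu[of u] xu[of w] by (simp add: inner_dim_commute[of d u w])
  then have u1: "inner_dim d u u = 1" using ss w by (simp add: field_simps)
  have "{x. s * inner_dim d x w \<le> s} = {x. inner_dim d x u \<in> {..s / sqrt N}}"
    using w by (simp add: xu field_simps)
  then show 1: "emeasure (uniform_sphere d) {x. s * inner_dim d x w \<le> s} = ennreal (sphere_cdf d (s / sqrt N))"
    using emeasure_uniform_sphere_linear[OF d0 u1, of "{..s / sqrt N}"]
    by (simp add: sphere_cdf_def emeasure_eq_measure)
  have "{x. s * inner_dim d x w < s} = {x. inner_dim d x u \<in> {..<s / sqrt N}}"
    using w by (simp add: xu field_simps)
  then have "emeasure (uniform_sphere d) {x. s * inner_dim d x w < s} = emeasure (uniform_sphere d) {x. x 0 < s / sqrt N}"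
    using emeasure_uniform_sphere_linear[OF d0 u1, of "{..<s / sqrt N}"] by simp
  also have "\<dots> = emeasure (uniform_sphere d) ({x. x 0 < s / sqrt N} \<union> {x. x 0 = s / sqrt N})"
    by (rule emeasure_Un_null_set[symmetric]) (auto simp: null_sets_def emeasure_uniform_sphere_eq_0[OF d])
  also have "{x. x 0 < s / sqrt N} \<union> {x. x 0 = s / sqrt N} = {x :: nat \<Rightarrow> real. x 0 \<le> s / sqrt N}"
    by auto
  finally show "emeasure (uniform_sphere d) {x. s * inner_dim d x w < s} = ennreal (sphere_cdf d (s / sqrt N))"
    by (simp add: sphere_cdf_def emeasure_eq_measure)
qed

subsection \<open>Convergence of the cap probabilities to the normal distribution\<close>

text \<open>Unnormalized density of \<open>sqrt d\<close> times a coordinate of a uniform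
  point.\<close>

definition cap_density :: "nat \<Rightarrow> real \<Rightarrow> real"
  where "cap_density d x = ppow (1 - x\<^sup>2 / d) (real (d - 1) / 2 - 1)"

lemma measurable_cap_density [measurable]: "cap_density d \<in> borel_measurable borel"
  unfolding cap_density_def by measurable

lemma cap_density_nonneg [simp]: "0 \<le> cap_density d x"
  by (simp add: cap_density_def)

text \<open>From \<open>1 - t \<le> exp (- t)\<close>; the bound \<open>6 \<le> d\<close> is what
  makes \<open>(d - 3) / (2 * d)\<close> at least 1/4. This is the integrable majorant for dominated
  convergence.\<close>

lemma cap_density_le:
  assumes d: "6 \<le> d"
  shows "cap_density d x \<le> exp (- (x\<^sup>2 / 4))"
proof (cases "1 - x\<^sup>2 / d > 0")
  case True
  have a: "real (d - 1) / 2 - 1 = (real d - 3) / 2" using d by (simp add: of_nat_diff field_simps)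
  have "cap_density d x = (1 - x\<^sup>2 / d) powr ((real d - 3) / 2)"
    using True by (simp only: cap_density_def ppow_def a if_True)
  also have "\<dots> \<le> exp (- (x\<^sup>2 / d)) powr ((real d - 3) / 2)"
    using True d exp_ge_add_one_self[of "- x\<^sup>2 / d"] by (intro powr_mono2) auto
  also have "\<dots> = exp (- x\<^sup>2 * ((real d - 3) / (2 * d)))"
    by (simp add: powr_def)
  also have "\<dots> \<le> exp (- (x\<^sup>2 / 4))"
  proof -
    have "1 / 4 \<le> (real d - 3) / (2 * d)" using d by (simp add: field_simps)
    then have "x\<^sup>2 * (1 / 4) \<le> x\<^sup>2 * ((real d - 3) / (2 * d))" by (intro mult_left_mono) auto
    then show ?thesis by simp
  qed
  finally show ?thesis .
qed (simp add: cap_density_def ppow_def)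

lemma cap_density_tendsto: "(\<lambda>d. cap_density d x) \<longlonglongrightarrow> exp (- (x\<^sup>2 / 2))"
proof -
  have "(\<lambda>d. 1 - x\<^sup>2 / real d) \<longlonglongrightarrow> 1" by real_asymp
  then have "\<forall>\<^sub>F d in sequentially. 1 - x\<^sup>2 / real d > 0"
    by (rule order_tendstoD) simp
  then have "\<forall>\<^sub>F d in sequentially. (1 - x\<^sup>2 / real d) powr ((real d - 3) / 2) = cap_density d x"
    using eventually_ge_at_top[of 3]
  proof eventually_elim
    case (elim d)
    have "real (d - 1) / 2 - 1 = (real d - 3) / 2" using elim by (simp add: of_nat_diff field_simps)
    then show ?case using elim by (simp only: cap_density_def ppow_def if_True)
  qed
  moreover have "(\<lambda>d. (1 - x\<^sup>2 / real d) powr ((real d - 3) / 2)) \<longlonglongrightarrow> exp (- (x\<^sup>2 / 2))"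
    by real_asymp
  ultimately show ?thesis by (rule Lim_transform_eventually[rotated])
qed

lemma integrable_exp_minus_square: "0 < a \<Longrightarrow> integrable lborel (\<lambda>x::real. exp (- (x\<^sup>2 / a)))"
proof -
  assume a: "0 < a"
  have "integrable lborel (\<lambda>x. sqrt (pi * a) * normal_density 0 (sqrt (a / 2)) x)"
    using a by (intro integrable_mult_right integrable_normal_density) auto
  also have "(\<lambda>x. sqrt (pi * a) * normal_density 0 (sqrt (a / 2)) x) = (\<lambda>x. exp (- (x\<^sup>2 / a)))"
    using a by (auto simp: normal_density_def fun_eq_iff)
  finally show ?thesis .
qed

lemma integrable_cap_density: "6 \<le> d \<Longrightarrow> integrable lborel (\<lambda>x. indicator A x * cap_density d x)"
  if "A \<in> sets borel" for A
  using that
  by (intro Bochner_Integration.integrable_bound[OF integrable_exp_minus_square[of 4]])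
     (auto simp: indicator_def intro: cap_density_le)

text \<open>Substitution \<open>t = x / sqrt d\<close> in the law of the first coordinate; taking
  the whole line as \<open>A\<close> determines the constant, which then cancels in the
  quotient.\<close>

lemma sphere_cdf_eq:
  assumes d: "6 \<le> d"
  shows "sphere_cdf d (r / sqrt d) = (LINT x|lborel. indicator {..r} x * cap_density d x)
    / (LINT x|lborel. cap_density d x)"
    and "(LINT x|lborel. cap_density d x) > 0"
proof -
  have d2: "2 \<le> d" and d0: "0 < d" using d by auto
  let ?s = "sqrt (real d)"
  have s: "?s > 0" using d by simp
  interpret prob_space "uniform_sphere d" using d0 by (rule prob_space_uniform_sphere)
  define c where "c = marginal_const d 1"
  have c: "c > 0" unfolding c_def by (rule uniform_sphere_marginal) (use d in simp)
  have meas: "emeasure (uniform_sphere d) {x. x 0 \<in> (\<lambda>x. x / ?s) ` A}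
     = ennreal (c / ?s * (LINT x|lborel. indicator A x * cap_density d x))"
    if [measurable]: "A \<in> sets borel" "(\<lambda>x. x / ?s) ` A \<in> sets borel" for A
  proof -
    let ?B = "(\<lambda>x. x / ?s) ` A"
    have "emeasure (uniform_sphere d) {x. x 0 \<in> ?B} = (\<integral>\<^sup>+x. indicator {x. x 0 \<in> ?B} x \<partial>uniform_sphere d)"
      by simp
    also have "\<dots> = (\<integral>\<^sup>+x. indicator ?B (x 0) \<partial>uniform_sphere d)"
      by (intro nn_integral_cong) (simp add: indicator_def)
    also have "\<dots> = ennreal c * (\<integral>\<^sup>+t. indicator ?B t * ennreal (ppow (1 - t\<^sup>2) (real (d - 1) / 2 - 1)) \<partial>lborel)"
      unfolding c_def by (rule uniform_sphere_first_coordinate[OF d2]) measurable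
    also have "(\<integral>\<^sup>+t. indicator ?B t * ennreal (ppow (1 - t\<^sup>2) (real (d - 1) / 2 - 1)) \<partial>lborel)
      = ennreal \<bar>1 / ?s\<bar> * (\<integral>\<^sup>+x. indicator ?B (0 + 1 / ?s * x) * ennreal (ppow (1 - (0 + 1 / ?s * x)\<^sup>2) (real (d - 1) / 2 - 1)) \<partial>lborel)"
      by (rule nn_integral_real_affine) (use s in auto)
    also have "(\<integral>\<^sup>+x. indicator ?B (0 + 1 / ?s * x) * ennreal (ppow (1 - (0 + 1 / ?s * x)\<^sup>2) (real (d - 1) / 2 - 1)) \<partial>lborel)
      = (\<integral>\<^sup>+x. ennreal (indicator A x * cap_density d x) \<partial>lborel)"
      using s by (intro nn_integral_cong) (auto simp: indicator_def cap_density_def power_divide)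
    also have "\<dots> = ennreal (LINT x|lborel. indicator A x * cap_density d x)"
      by (rule nn_integral_eq_integral) (use integrable_cap_density[OF that(1) d] in auto)
    also have "ennreal c * (ennreal \<bar>1 / ?s\<bar> * ennreal (LINT x|lborel. indicator A x * cap_density d x))
      = ennreal (c / ?s * (LINT x|lborel. indicator A x * cap_density d x))"
      using c s by (subst ennreal_mult[symmetric], simp, simp, subst ennreal_mult[symmetric]) auto
    finally show ?thesis .
  qed
  have nn: "(LINT x|lborel. cap_density d x) \<ge> 0"
    by (intro Bochner_Integration.integral_nonneg) auto
  have img: "(\<lambda>x. x / ?s) ` UNIV = UNIV"
    using s by (auto simp: image_iff intro!: exI[of _ "y * ?s" for y])
  have "ennreal (c / ?s * (LINT x|lborel. indicator UNIV x * cap_density d x)) = 1"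
    by (subst meas[of UNIV, unfolded img, symmetric]) (use emeasure_space_1 in simp_all)
  then have "ennreal 1 = ennreal (c / ?s * (LINT x|lborel. cap_density d x))"
    by (simp only: indicator_UNIV mult_1 ennreal_1)
  then have one: "c / ?s * (LINT x|lborel. cap_density d x) = 1"
    using c s nn by (metis ennreal_inj less_imp_le divide_nonneg_pos mult_nonneg_nonneg zero_le_one)
  have "(\<lambda>x. x / ?s) ` {..r} = {..r / ?s}"
  proof (intro equalityI subsetI)
    fix y assume "y \<in> {..r / ?s}"
    then have "y * ?s \<in> {..r}" "y = (y * ?s) / ?s" using s by (auto simp: field_simps)
    then show "y \<in> (\<lambda>x. x / ?s) ` {..r}" by blast
  qed (use s in \<open>auto simp: divide_right_mono\<close>)
  then have "ennreal (sphere_cdf d (r / ?s)) = ennreal (c / ?s * (LINT x|lborel. indicator {..r} x * cap_density d x))"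
    using meas[of "{..r}"] by (simp add: sphere_cdf_def emeasure_eq_measure)
  then have cdf: "sphere_cdf d (r / ?s) = c / ?s * (LINT x|lborel. indicator {..r} x * cap_density d x)"
    using c s sphere_cdf_bounds[OF d0]
    by (subst (asm) ennreal_inj) (auto intro!: mult_nonneg_nonneg Bochner_Integration.integral_nonneg)
  have pos: "(LINT x|lborel. cap_density d x) > 0"
  proof -
    have "(LINT x|lborel. cap_density d x) \<noteq> 0" using one by auto
    then show ?thesis using nn by (simp add: less_le)
  qed
  show "(LINT x|lborel. cap_density d x) > 0" by (rule pos)
  have "c / ?s = 1 / (LINT x|lborel. cap_density d x)" using one pos by (simp only: eq_divide_eq) simp
  then show "sphere_cdf d (r / ?s) = (LINT x|lborel. indicator {..r} x * cap_density d x)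
    / (LINT x|lborel. cap_density d x)"
    unfolding cdf by simp
qed

lemma cap_integral_tendsto:
  assumes [measurable]: "A \<in> sets borel"
  shows "(\<lambda>d. LINT x|lborel. indicator A x * cap_density d x) \<longlonglongrightarrow> (LINT x|lborel. indicator A x * exp (- (x\<^sup>2 / 2)))"
proof -
  have "(\<lambda>d. LINT x|lborel. indicator A x * cap_density (d + 6) x) \<longlonglongrightarrow> (LINT x|lborel. indicator A x * exp (- (x\<^sup>2 / 2)))"
  proof (rule integral_dominated_convergence[where w="\<lambda>x. exp (- (x\<^sup>2 / 4))"])
    show "integrable lborel (\<lambda>x::real. exp (- (x\<^sup>2 / 4)))" by (rule integrable_exp_minus_square) simp
    show "AE x in lborel. (\<lambda>d. indicator A x * cap_density (d + 6) x) \<longlonglongrightarrow> indicator A x * exp (- (x\<^sup>2 / 2))"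
      by (intro AE_I2 tendsto_mult tendsto_const LIMSEQ_ignore_initial_segment cap_density_tendsto)
    show "AE x in lborel. norm (indicator A x * cap_density (d + 6) x) \<le> exp (- (x\<^sup>2 / 4))" for d
      by (intro AE_I2) (auto simp: indicator_def intro: cap_density_le)
  qed auto
  then show ?thesis by (rule LIMSEQ_offset)
qed

lemma std_normal_cdf_eq: "std_normal_cdf r = (LINT x|lborel. indicator {..r} x * exp (- (x\<^sup>2 / 2))) / sqrt (2 * pi)"
proof -
  have int: "integrable lborel (\<lambda>x. indicator {..r} x * exp (- (x\<^sup>2 / 2)))"
    by (rule Bochner_Integration.integrable_bound[OF integrable_exp_minus_square[of 2]]) (auto simp: indicator_def)
  have "emeasure std_normal_distribution {..r} = (\<integral>\<^sup>+x. ennreal (std_normal_density x) * indicator {..r} x \<partial>lborel)"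
    by (subst emeasure_density) auto
  also have "\<dots> = (\<integral>\<^sup>+x. ennreal (1 / sqrt (2 * pi) * (indicator {..r} x * exp (- (x\<^sup>2 / 2)))) \<partial>lborel)"
    by (intro nn_integral_cong) (auto simp: indicator_def std_normal_density_def)
  also have "\<dots> = ennreal (LINT x|lborel. 1 / sqrt (2 * pi) * (indicator {..r} x * exp (- (x\<^sup>2 / 2))))"
    using int by (intro nn_integral_eq_integral) auto
  finally show ?thesis
    by (simp add: std_normal_cdf_def cdf_def measure_def integral_nonneg)
qed

lemma integral_exp_minus_half_square: "(LINT x|lborel. exp (- ((x::real)\<^sup>2 / 2))) = sqrt (2 * pi)"
proof -
  have "(LINT x|lborel. sqrt (2 * pi) * std_normal_density x) = sqrt (2 * pi)"
    by (simp add: integral_normal_density)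
  then show ?thesis by (simp add: std_normal_density_def)
qed

text \<open>The Poincare-Borel limit, obtained separately for numerator and denominator.\<close>

lemma sphere_cdf_tendsto: "(\<lambda>d. sphere_cdf d (r / sqrt (real d))) \<longlonglongrightarrow> std_normal_cdf r"
proof -
  have "(\<lambda>d. LINT x|lborel. cap_density d x) \<longlonglongrightarrow> sqrt (2 * pi)"
    using cap_integral_tendsto[of UNIV] by (simp add: integral_exp_minus_half_square)
  then have "(\<lambda>d. (LINT x|lborel. indicator {..r} x * cap_density d x) / (LINT x|lborel. cap_density d x))
      \<longlonglongrightarrow> std_normal_cdf r"
    unfolding std_normal_cdf_eq by (intro tendsto_divide cap_integral_tendsto) auto
  then show ?thesis
    by (rule Lim_transform_eventually)
       (use eventually_ge_at_top[of 6] in \<open>eventually_elim, simp add: sphere_cdf_eq\<close>)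
qed

subsection \<open>The standard normal distribution function\<close>

lemma std_normal_cdf_diff:
  assumes "a \<le> b"
  shows "std_normal_cdf b - std_normal_cdf a = integral {a..b} (\<lambda>x. std_normal_density x)"
proof -
  interpret real_distribution std_normal_distribution by (rule real_dist_normal_dist)
  have cont: "continuous_on {a..b} (\<lambda>x. std_normal_density x)"
    unfolding std_normal_density_def by (intro continuous_intros) auto
  have hi: "((\<lambda>x. std_normal_density x) has_integral integral {a..b} (\<lambda>x. std_normal_density x)) {a..b}"
    using integrable_continuous_interval[OF cont] by (rule integrable_integral)
  show ?thesis
  proof (cases "a = b")
    case False
    then have ab: "a < b" using assms by simp
    have "emeasure std_normal_distribution {a<..b} = (\<integral>\<^sup>+x. ennreal (std_normal_density x) * indicator {a<..b} x \<partial>lborel)"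
      by (subst emeasure_density) auto
    also have "\<dots> = (\<integral>\<^sup>+x. ennreal (std_normal_density x) * indicator {a..b} x \<partial>lborel)"
      by (rule nn_integral_cong_AE)
         (use AE_lborel_singleton[of a] in \<open>eventually_elim, auto simp: indicator_def\<close>)
    also have "\<dots> = ennreal (integral {a..b} (\<lambda>x. std_normal_density x))"
      by (rule nn_integral_has_integral_lebesgue'[OF _ hi]) auto
    finally have "measure std_normal_distribution {a<..b} = integral {a..b} (\<lambda>x. std_normal_density x)"
      by (simp add: measure_def integral_nonneg[OF has_integral_integrable[OF hi]])
    then show ?thesis
      using cdf_diff_eq[OF ab] by (simp add: std_normal_cdf_def)
  qed simp
qed

lemma std_normal_cdf_deriv:
  "(std_normal_cdf has_real_derivative std_normal_density x) (at x)"
proof -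
  let ?I = "\<lambda>u. integral {x - 1..u} (\<lambda>x. std_normal_density x)"
  have cont: "continuous_on {x - 1..x + 1} (\<lambda>x. std_normal_density x)"
    unfolding std_normal_density_def by (intro continuous_intros) auto
  have "(?I has_real_derivative std_normal_density x) (at x within {x - 1..x + 1})"
    by (rule integral_has_real_derivative[OF cont]) auto
  then have "(?I has_real_derivative std_normal_density x) (at x)"
    by (simp add: at_within_Icc_at)
  then have "((\<lambda>u. std_normal_cdf (x - 1) + ?I u) has_real_derivative std_normal_density x) (at x)"
    by (auto intro!: derivative_eq_intros)
  moreover have "\<forall>\<^sub>F u in nhds x. std_normal_cdf (x - 1) + ?I u = std_normal_cdf u"
  proof -
    have "\<forall>\<^sub>F u in nhds x. u \<in> {x - 1<..}"
      by (rule eventually_nhds_in_open) auto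
    then show ?thesis
    proof eventually_elim
      case (elim u)
      then show ?case using std_normal_cdf_diff[of "x - 1" u] by simp
    qed
  qed
  ultimately show ?thesis
    using DERIV_cong_ev[OF refl _ refl] by metis
qed

lemma std_normal_cdf_less: "a < b \<Longrightarrow> std_normal_cdf a < std_normal_cdf b"
  by (rule DERIV_pos_imp_increasing[of a b std_normal_cdf])
     (use std_normal_cdf_deriv normal_density_pos[of 1] in \<open>auto intro!: exI[of _ "std_normal_density x" for x]\<close>)

lemma std_normal_cdf_mono: "a \<le> b \<Longrightarrow> std_normal_cdf a \<le> std_normal_cdf b"
  using std_normal_cdf_less[of a b] by (cases "a = b") auto

lemma std_normal_cdf_pos: "0 < std_normal_cdf r"
proof -
  have "0 \<le> std_normal_cdf (r - 1)"
    by (simp add: std_normal_cdf_def cdf_def)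
  then show ?thesis using std_normal_cdf_less[of "r - 1" r] by simp
qed

lemma std_normal_cdf_less_1: "std_normal_cdf r < 1"
proof -
  interpret real_distribution std_normal_distribution by (rule real_dist_normal_dist)
  have "std_normal_cdf (r + 1) \<le> 1"
    by (simp add: std_normal_cdf_def cdf_bounded_prob)
  then show ?thesis using std_normal_cdf_less[of r "r + 1"] by simp
qed

lemma isCont_std_normal_cdf: "isCont std_normal_cdf r"
  using std_normal_cdf_deriv by (rule DERIV_isCont)

lemma std_normal_cdf_at_top: "(std_normal_cdf \<longlongrightarrow> 1) at_top"
proof -
  interpret real_distribution std_normal_distribution by (rule real_dist_normal_dist)
  show ?thesis using cdf_lim_at_top_prob by (simp add: std_normal_cdf_def)
qed


subsection \<open>Facets and their vertex sets\<close>

lemma linear_inner_dim: "linear (\<lambda>x. inner_dim d x u)"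
  by (rule linearI)
     (simp_all add: inner_dim_def plus_fun_def scaleR_fun_def algebra_simps sum.distrib sum_distrib_left)

text \<open>For a convex combination that attains the maximal value \<open>h\<close>, the
  nonnegative terms \<open>u x * (h - f x)\<close> sum to 0, so every point below the level has
  weight 0.\<close>

lemma convex_hull_Int_supporting_hyperplane:
  fixes f :: "'a::real_vector \<Rightarrow> real"
  assumes S: "finite S" and f: "linear f" and le: "\<And>x. x \<in> S \<Longrightarrow> f x \<le> h"
  shows "convex hull S \<inter> {x. f x = h} = convex hull {x \<in> S. f x = h}"
proof
  show "convex hull S \<inter> {x. f x = h} \<subseteq> convex hull {x \<in> S. f x = h}"
  proof
    fix y assume y: "y \<in> convex hull S \<inter> {x. f x = h}"
    then obtain u where u: "\<And>x. x \<in> S \<Longrightarrow> 0 \<le> u x" "sum u S = 1" "(\<Sum>x\<in>S. u x *\<^sub>R x) = y"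
      by (auto simp: convex_hull_finite[OF S])
    have "(\<Sum>x\<in>S. u x * (h - f x)) = h * sum u S - (\<Sum>x\<in>S. u x * f x)"
      by (simp add: algebra_simps sum_subtractf sum_distrib_left)
    also have "(\<Sum>x\<in>S. u x * f x) = f y"
      using f by (simp add: u(3)[symmetric] linear_sum linear_scale)
    finally have "(\<Sum>x\<in>S. u x * (h - f x)) = 0" using y u(2) by simp
    then have "u x * (h - f x) = 0" if "x \<in> S" for x
      using sum_nonneg_eq_0_iff[OF S, of "\<lambda>x. u x * (h - f x)"] u(1) le that by (simp add: mult_nonneg_nonneg)
    then have u0: "u x = 0" if "x \<in> S" "f x \<noteq> h" for x using that by auto
    have "sum u {x \<in> S. f x = h} = sum u S"
      by (rule sum.mono_neutral_left) (use S u0 in auto)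
    moreover have "(\<Sum>x\<in>{x \<in> S. f x = h}. u x *\<^sub>R x) = (\<Sum>x\<in>S. u x *\<^sub>R x)"
      by (rule sum.mono_neutral_left) (use S u0 in auto)
    ultimately show "y \<in> convex hull {x \<in> S. f x = h}"
      using u S by (auto simp: convex_hull_finite intro!: exI[of _ u])
  qed
next
  have "convex {x. f x = h}"
    using f by (auto simp: convex_def linear_add linear_scale simp flip: distrib_right)
  then have "convex hull {x \<in> S. f x = h} \<subseteq> {x. f x = h}"
    by (intro hull_minimal) auto
  moreover have "convex hull {x \<in> S. f x = h} \<subseteq> convex hull S"
    by (intro hull_mono) auto
  ultimately show "convex hull {x \<in> S. f x = h} \<subseteq> convex hull S \<inter> {x. f x = h}" by simp
qed

lemma face_of_Int_supporting_level_set: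
  fixes f :: "'a::real_vector \<Rightarrow> real"
  assumes P: "convex P" and f: "linear f" and le: "\<And>x. x \<in> P \<Longrightarrow> f x \<le> h"
  shows "P \<inter> {x. f x = h} face_of P"
  unfolding face_of_def
proof (intro conjI ballI impI)
  have "convex {x. f x = h}"
    using f by (auto simp: convex_def linear_add linear_scale simp flip: distrib_right)
  then show "convex (P \<inter> {x. f x = h})"
    using P by (rule convex_Int[rotated])
next
  fix a b x assume ab: "a \<in> P" "b \<in> P" and x: "x \<in> P \<inter> {x. f x = h}" "x \<in> open_segment a b"
  then obtain t where t: "0 < t" "t < 1" "x = (1 - t) *\<^sub>R a + t *\<^sub>R b"
    by (auto simp: in_segment)
  have "f x = (1 - t) * f a + t * f b"
    unfolding t(3) by (simp add: linear_add[OF f] linear_scale[OF f])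
  moreover have "f x = h" using x by simp
  ultimately have "(1 - t) * (h - f a) + t * (h - f b) = 0"
    by (simp add: algebra_simps)
  moreover have "0 \<le> (1 - t) * (h - f a)" "0 \<le> t * (h - f b)"
    using t le[OF ab(1)] le[OF ab(2)] by auto
  ultimately have "(1 - t) * (h - f a) = 0" "t * (h - f b) = 0" by linarith+
  then show "a \<in> P \<inter> {x. f x = h}" "b \<in> P \<inter> {x. f x = h}"
    using t ab by auto
qed simp

text \<open>Steinitz exchange after translating a base point to 0. It guarantees that a facet
  contains at least \<open>d\<close> of the given points.\<close>

lemma affine_independent_card_le:
  fixes T :: "'a::real_vector set"
  assumes B: "\<not> affine_dependent B" "card B = Suc m" "B \<subseteq> affine hull T" and T: "finite T"
  shows "Suc m \<le> card T"
proof -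
  have finB: "finite B" using B(2) card.infinite by fastforce
  obtain b where b: "b \<in> B" using B(2) by fastforce
  then have "T \<noteq> {}" using B(3) by auto
  then obtain a where a: "a \<in> T" by auto
  let ?T = "(\<lambda>x. - a + x) ` (T - {a})" and ?B = "(\<lambda>x. - b + x) ` (B - {b})"
  have hull: "affine hull T = (\<lambda>x. a + x) ` span ?T" by (rule affine_hull_span2[OF a])
  have mem: "- a + x \<in> span ?T" if "x \<in> B" for x
    using B(3) that unfolding hull by auto
  have sub: "?B \<subseteq> span ?T"
  proof
    fix z assume "z \<in> ?B"
    then obtain x where x: "x \<in> B" "z = - b + x" by auto
    have "z = (- a + x) - (- a + b)" using x by simp
    then show "z \<in> span ?T" using span_diff[OF mem[OF x(1)] mem[OF b]] by simp
  qed
  have ind: "independent ?B" using B(1) affine_dependent_iff_dependent2[OF b] by simp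
  have "card ?B \<le> card ?T"
    using independent_span_bound[OF _ ind sub] T by simp
  moreover have "card ?B = m"
    using b finB B(2) by (subst card_image) (auto simp: inj_on_def)
  moreover have "card ?T \<le> card (T - {a})" by (rule card_image_le) (use T in simp)
  moreover have "card (T - {a}) = card T - 1" "card T > 0" using T a by (auto simp: card_gt_0_iff)
  ultimately show ?thesis by linarith
qed

section \<open>Nondegenerate tuples and the hyperplanes they span\<close>

lemma gs_res_add: "gs_res d x k (u + v) = gs_res d x k u + gs_res d x k v"
  using gs_res_linear[of d x k u 1 v] by (simp add: plus_fun_def)

lemma gs_res_scale: "gs_res d x k (c *\<^sub>R v) = c *\<^sub>R gs_res d x k v"
proof -
  have zero: "gs_res d x k (\<lambda>_. 0) = (\<lambda>_. 0)" by (induction k) auto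
  show ?thesis
    using gs_res_linear[of d x k "\<lambda>_. 0" c v] by (simp add: scaleR_fun_def zero)
qed

text \<open>The projection vanishes on the span of the earlier points but not on the new
  one.\<close>

lemma gs_nondeg_independent:
  "gs_nondeg d y k \<Longrightarrow> independent (y ` {..<k}) \<and> card (y ` {..<k}) = k"
proof (induction k)
  case (Suc k)
  have nd: "gs_nondeg d y k" "inner_dim d (gs_dir d y k) (gs_dir d y k) \<noteq> 0"
    using Suc.prems by (auto simp: gs_nondeg_Suc)
  have sub: "subspace {v. gs_res d y k v = 0}"
    unfolding subspace_def using gs_res_scale[of d y k 0 0] by (auto simp: gs_res_add gs_res_scale)
  have "span (y ` {..<k}) \<subseteq> {v. gs_res d y k v = 0}"
    by (rule span_minimal[OF _ sub]) (use gs_res_eq_0[OF nd(1)] in \<open>auto simp: zero_fun_def\<close>)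
  moreover have "gs_dir d y k \<noteq> 0" using nd(2) by (auto simp: zero_fun_def)
  ultimately have notin: "y k \<notin> span (y ` {..<k})" by auto
  then have "y k \<notin> y ` {..<k}" using span_superset[of "y ` {..<k}"] by auto
  with notin Suc.IH[OF nd(1)] show ?case
    by (simp add: lessThan_Suc independent_insertI)
qed (simp add: independent_empty)

definition gs_facet :: "nat \<Rightarrow> (nat \<Rightarrow> real) set \<Rightarrow> (nat \<Rightarrow> nat \<Rightarrow> real) \<Rightarrow> (nat \<Rightarrow> real) set"
  where "gs_facet d P y = P \<inter> {v \<in> topspace (Euclidean_space d). inner_dim d v (gs_sol d y d) = 1}"

text \<open>
  The sign \<open>s\<close> selects the unit normal \<open>s w / \<parallel>w\<parallel>\<close> of the hyperplane through \<open>y 0, \<dots>, y (d - 1)\<close>, whose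
  signed height is then \<open>s / \<parallel>w\<parallel>\<close>. With \<open>A = {..s}\<close> and \<open>A = {..<s}\<close> the event bounds the facet count from
  above and from below.
\<close>

definition facet_event :: "real set \<Rightarrow> nat \<Rightarrow> nat \<Rightarrow> real \<Rightarrow> real \<Rightarrow> real \<Rightarrow> (nat \<Rightarrow> nat \<Rightarrow> real) \<Rightarrow> bool"
  where "facet_event A d n h1 h2 s y \<longleftrightarrow> gs_nondeg d y d \<and> s / sqrt (gs_norm d y d) \<in> {h1..h2} \<and>
    (\<forall>j\<in>{d..<n}. s * inner_dim d (y j) (gs_sol d y d) \<in> A)"

lemma gs_norm_pos:
  assumes "gs_nondeg d y d" "0 < d"
  shows "0 < gs_norm d y d"
proof -
  have "gs_norm d y d \<noteq> 0"
  proof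
    assume "gs_norm d y d = 0"
    then have "sqs {..<d} (gs_sol d y d) = 0" by (simp add: gs_norm_def inner_dim_self)
    then have "gs_sol d y d i = 0" if "i < d" for i
      using that by (simp add: sqs_def sum_nonneg_eq_0_iff)
    then have "inner_dim d (y 0) (gs_sol d y d) = 0" by (simp add: inner_dim_def)
    then show False using gs_sol_inner[OF assms] by simp
  qed
  then show ?thesis using gs_norm_nonneg[of d y d] by (simp add: less_le del: gs_norm_nonneg)
qed

text \<open>The permutation \<open>\<pi> I\<close> lists the points of \<open>I\<close> before all
  others, so statements about the first \<open>d\<close> points, such as \<open>facet_event\<close>,
  cover every \<open>d\<close>-subset.\<close>

context
  fixes d n :: nat and x :: "nat \<Rightarrow> nat \<Rightarrow> real" and \<pi> :: "nat set \<Rightarrow> nat \<Rightarrow> nat" and h1 h2 :: real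
  assumes d: "2 \<le> d" "d < n"
    and x: "\<And>i. i < n \<Longrightarrow> x i \<in> topspace (Euclidean_space d)"
    and \<pi>: "\<And>I. I \<subseteq> {..<n} \<Longrightarrow> card I = d \<Longrightarrow> bij_betw (\<pi> I) {..<n} {..<n}"
      "\<And>I. I \<subseteq> {..<n} \<Longrightarrow> card I = d \<Longrightarrow> \<pi> I ` {..<d} = I"
begin

lemma hull_subset_topspace: "convex hull (x ` {..<n}) \<subseteq> topspace (Euclidean_space d)"
proof (rule hull_minimal)
  show "convex (topspace (Euclidean_space d))"
    by (auto simp: convex_def topspace_Euclidean_space plus_fun_def scaleR_fun_def)
qed (use x in auto)

text \<open>At least \<open>d\<close> points lie on the supporting hyperplane, and any
  \<open>d\<close> of them serve as \<open>I\<close>. Nondegeneracy determines the normal as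
  \<open>h\<close> times the Gram-Schmidt solution, whence \<open>h\<close> is nonzero and equals
  plus or minus the reciprocal of the norm. Further points may lie on the hyperplane, so only the
  weak event can be claimed.\<close>

lemma facet_imp_facet_event:
  assumes nd: "\<And>I. I \<subseteq> {..<n} \<Longrightarrow> card I = d \<Longrightarrow> gs_nondeg d (x \<circ> \<pi> I) d"
    and P: "P = convex hull (x ` {..<n})"
    and G: "G \<in> facets d P" "h \<in> {h1..h2}" "has_height d P G h"
  shows "\<exists>I s. I \<subseteq> {..<n} \<and> card I = d \<and> s \<in> {1, -1} \<and> facet_event {..s} d n h1 h2 s (x \<circ> \<pi> I)
    \<and> G = gs_facet d P (x \<circ> \<pi> I)"
proof -
  let ?E = "topspace (Euclidean_space d)"
  obtain u where u: "u \<in> unit_sphere d" and Gu: "G = P \<inter> {v \<in> ?E. inner_dim d v u = h}"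
    and Pu: "P \<subseteq> {v \<in> ?E. inner_dim d v u \<le> h}"
    using G(3) by (auto simp: has_height_def)
  have uu: "inner_dim d u u = 1" using u by (simp add: unit_sphere_def norm_dim_def)
  have PE: "P \<subseteq> ?E" unfolding P by (rule hull_subset_topspace)
  have xP: "x i \<in> P" if "i < n" for i
    unfolding P using that by (intro hull_inc) auto
  let ?Z = "{i\<in>{..<n}. inner_dim d (x i) u = h}"
  have "G = convex hull (x ` {..<n}) \<inter> {v. inner_dim d v u = h}"
    unfolding Gu using PE by (auto simp: P)
  also have "\<dots> = convex hull {v \<in> x ` {..<n}. inner_dim d v u = h}"
    by (rule convex_hull_Int_supporting_hyperplane) (use linear_inner_dim xP Pu in auto)
  also have "{v \<in> x ` {..<n}. inner_dim d v u = h} = x ` ?Z" by auto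
  finally have GZ: "G = convex hull (x ` ?Z)" .
  have "has_aff_dim G (d - 1)" using G(1) by (simp add: facets_def)
  then obtain B where B: "affine hull B = affine hull G" "\<not> affine_dependent B" "card B = Suc (d - 1)"
    by (auto simp: has_aff_dim_def)
  have "B \<subseteq> affine hull (x ` ?Z)"
    using B(1) hull_subset[of B affine] by (simp add: GZ)
  then have "Suc (d - 1) \<le> card (x ` ?Z)"
    by (intro affine_independent_card_le[OF B(2,3)]) auto
  also have "\<dots> \<le> card ?Z" by (rule card_image_le) simp
  finally have Zd: "d \<le> card ?Z" using d by simp
  obtain I where I: "I \<subseteq> ?Z" "card I = d"
    by (rule obtain_subset_with_card_n[OF Zd])
  then have In: "I \<subseteq> {..<n}" by auto
  define y where "y = x \<circ> \<pi> I"
  let ?w = "gs_sol d y d"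
  define N where "N = gs_norm d y d"
  have nd': "gs_nondeg d y d" unfolding y_def by (rule nd[OF In I(2)])
  have N: "N > 0" unfolding N_def by (rule gs_norm_pos[OF nd']) (use d in simp)
  have yu: "inner_dim d (y j) u = h" if "j < d" for j
  proof -
    have "\<pi> I j \<in> I" using \<pi>(2)[OF In I(2)] that by blast
    then show ?thesis using I(1) by (auto simp: y_def)
  qed
  \<comment> \<open>The difference is orthogonal to all \<open>d\<close> points of the tuple, so its
    first \<open>d\<close> entries vanish by completeness.\<close>
  define z where "z = (\<lambda>i. u i + (- h) * ?w i)"
  have "inner_dim d z z = 0"
  proof (rule gs_complete[OF nd'])
    fix j assume "j < d"
    then show "inner_dim d (y j) z = 0"
      unfolding z_def inner_dim_add_right using yu gs_sol_inner[OF nd'] by simp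
  qed
  then have "z i = 0" if "i < d" for i
    using that by (simp add: inner_dim_self sqs_def sum_nonneg_eq_0_iff)
  then have uw: "u i = h * ?w i" if "i < d" for i using that by (simp add: z_def)
  then have vu: "inner_dim d v u = h * inner_dim d v ?w" for v
    by (simp add: inner_dim_def sum_distrib_left mult_ac)
  have "h * (h * N) = 1"
    using uu vu[of u] vu[of ?w] by (simp add: inner_dim_commute[of d u ?w] N_def gs_norm_def)
  then have hN: "h\<^sup>2 * N = 1" by (simp add: power2_eq_square mult_ac)
  then have h0: "h \<noteq> 0" by auto
  define s where "s = sgn h"
  have s: "s \<in> {1, -1}" "h = s * \<bar>h\<bar>" "s * s = 1" using h0 by (auto simp: s_def sgn_if)
  have "sqrt (h\<^sup>2 * N) = 1" using hN by simp
  then have "\<bar>h\<bar> * sqrt N = 1" by (simp add: real_sqrt_mult)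
  then have "\<bar>h\<bar> = 1 / sqrt N" using N by (simp add: field_simps)
  then have hs: "h = s / sqrt N" using s(2) by simp
  have "s * inner_dim d (y j) ?w \<le> s" if "j < n" for j
  proof -
    have "\<pi> I j < n" using \<pi>(1)[OF In I(2)] that by (auto simp: bij_betw_def)
    then have "inner_dim d (y j) u \<le> h" using xP Pu by (auto simp: y_def)
    then have "\<bar>h\<bar> * (s * inner_dim d (y j) ?w) \<le> \<bar>h\<bar> * s"
      using vu[of "y j"] s(2) by (metis mult.assoc mult.commute)
    then show ?thesis using h0 by simp
  qed
  then have "facet_event {..s} d n h1 h2 s y"
    using nd' G(2) hs by (simp add: facet_event_def N_def)
  moreover have "G = gs_facet d P y"
    unfolding Gu gs_facet_def using h0 by (auto simp: vu)
  ultimately show ?thesis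
    using In I(2) s(1) unfolding y_def by blast
qed

text \<open>Strictness puts exactly the points of \<open>I\<close> on the hyperplane. Hence the
  facet is their convex hull, of the right dimension by independence, and \<open>I\<close> can be
  recovered from it.\<close>

lemma facet_event_imp_facet:
  assumes P: "P = convex hull (x ` {..<n})"
    and I: "I \<subseteq> {..<n}" "card I = d" and s: "s \<in> {1, -1}"
    and st: "facet_event {..<s} d n h1 h2 s (x \<circ> \<pi> I)"
  shows "gs_facet d P (x \<circ> \<pi> I) \<in> facets d P"
    and "\<exists>h\<in>{h1..h2}. has_height d P (gs_facet d P (x \<circ> \<pi> I)) h"
    and "I = {i. i < n \<and> x i \<in> gs_facet d P (x \<circ> \<pi> I)}"
proof -
  let ?E = "topspace (Euclidean_space d)"
  define y where "y = x \<circ> \<pi> I"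
  let ?w = "gs_sol d y d" and ?G = "gs_facet d P y"
  define N where "N = gs_norm d y d"
  have nd: "gs_nondeg d y d" using st by (simp add: facet_event_def y_def)
  have N: "N > 0" unfolding N_def by (rule gs_norm_pos[OF nd]) (use d in simp)
  have ss: "s * s = 1" using s by auto
  define h where "h = s / sqrt N"
  have h: "h \<in> {h1..h2}" using st by (simp add: facet_event_def h_def N_def y_def)
  \<comment> \<open>The truncation places \<open>u\<close> in the carrier of
    \<open>Euclidean_space d\<close>; \<open>inner_dim\<close> does not see the entries beyond
    \<open>d\<close>.\<close>
  define u where "u = (\<lambda>i. if i < d then h * ?w i else 0)"
  have vu: "inner_dim d v u = h * inner_dim d v ?w" for v
    by (simp add: inner_dim_def u_def sum_distrib_left mult_ac)
  have "inner_dim d u u = h * (h * N)"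
    using vu[of u] vu[of ?w] by (simp add: inner_dim_commute[of d u ?w] N_def gs_norm_def)
  then have uu: "inner_dim d u u = 1" using ss N by (simp add: h_def field_simps)
  have u: "u \<in> unit_sphere d"
    using uu by (simp add: unit_sphere_def norm_dim_def topspace_Euclidean_space u_def)
  have h0: "h \<noteq> 0" using uu vu[of u] by auto
  have PE: "P \<subseteq> ?E" unfolding P by (rule hull_subset_topspace)
  have bij: "bij_betw (\<pi> I) {..<n} {..<n}" by (rule \<pi>(1)[OF I])
  have onI: "inner_dim d (x i) ?w = 1" if "i \<in> I" for i
  proof -
    have "i \<in> \<pi> I ` {..<d}" using \<pi>(2)[OF I] that by simp
    then obtain j where "j < d" "i = \<pi> I j" by auto
    then show ?thesis using gs_sol_inner[OF nd, of j] by (simp add: y_def)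
  qed
  have offI: "s * inner_dim d (x i) ?w < s" if "i < n" "i \<notin> I" for i
  proof -
    have "i \<in> \<pi> I ` {..<n}" using bij that(1) by (simp add: bij_betw_def)
    then obtain j where j: "j < n" "i = \<pi> I j" by auto
    then have "\<not> j < d" using \<pi>(2)[OF I] that(2) by auto
    then have "j \<in> {d..<n}" using j by simp
    then show ?thesis using st j by (simp add: facet_event_def y_def)
  qed
  have iff: "inner_dim d (x i) u = h \<longleftrightarrow> i \<in> I" if "i < n" for i
  proof (cases "i \<in> I")
    case True
    then show ?thesis using onI by (simp add: vu)
  next
    case False
    then show ?thesis using offI[OF that False] h0 by (auto simp: vu)
  qed
  have le: "inner_dim d (x i) u \<le> h" if "i < n" for i
  proof (cases "i \<in> I")
    case True
    then show ?thesis using iff[OF that] by simp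
  next
    case False
    have "(s * inner_dim d (x i) ?w) / sqrt N \<le> s / sqrt N"
      using offI[OF that False] N by (intro divide_right_mono) auto
    then show ?thesis by (simp add: vu h_def)
  qed
  have "convex {v. inner_dim d v u \<le> h}"
  proof -
    have "{v. inner_dim d v u \<le> h} = (\<lambda>v. inner_dim d v u) -` {..h}" by auto
    then show ?thesis using convex_linear_vimage[OF linear_inner_dim, of "{..h}" d u] by simp
  qed
  then have "P \<subseteq> {v. inner_dim d v u \<le> h}"
    unfolding P using le by (intro hull_minimal) auto
  then have Ple: "\<And>v. v \<in> P \<Longrightarrow> inner_dim d v u \<le> h" by auto
  have Gu: "?G = P \<inter> {v. inner_dim d v u = h}"
    unfolding gs_facet_def using h0 PE by (auto simp: vu)
  have xP: "x i \<in> P" if "i < n" for i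
    unfolding P using that by (intro hull_inc) auto
  have "has_height d P ?G h"
    unfolding has_height_def using u Ple PE by (intro bexI[of _ u]) (auto simp: Gu)
  then show "\<exists>h\<in>{h1..h2}. has_height d P (gs_facet d P (x \<circ> \<pi> I)) h"
    using h unfolding y_def by blast
  have face: "?G face_of P"
    unfolding Gu by (rule face_of_Int_supporting_level_set) (use Ple linear_inner_dim P in auto)
  have "?G = convex hull {v \<in> x ` {..<n}. inner_dim d v u = h}"
    unfolding Gu unfolding P by (rule convex_hull_Int_supporting_hyperplane) (use linear_inner_dim le in auto)
  also have "{v \<in> x ` {..<n}. inner_dim d v u = h} = x ` I"
    using iff I(1) by auto
  also have "x ` I = y ` {..<d}" unfolding y_def using \<pi>(2)[OF I] by (metis image_comp)
  finally have GI: "?G = convex hull (y ` {..<d})" .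
  have "has_aff_dim ?G (d - 1)"
    unfolding has_aff_dim_def
  proof (intro exI[of _ "y ` {..<d}"] conjI)
    show "\<not> affine_dependent (y ` {..<d})"
      using gs_nondeg_independent[OF nd] affine_dependent_imp_dependent by blast
    show "card (y ` {..<d}) = d - 1 + 1" using gs_nondeg_independent[OF nd] d by simp
  qed (simp add: GI)
  then show "gs_facet d P (x \<circ> \<pi> I) \<in> facets d P"
    using face by (simp add: facets_def y_def)
  have "I = {i. i < n \<and> x i \<in> ?G}"
    using iff xP I(1) by (auto simp: Gu)
  then show "I = {i. i < n \<and> x i \<in> gs_facet d P (x \<circ> \<pi> I)}" by (simp add: y_def)
qed

text \<open>Sending a pair of subset and sign to its facet is onto from the weak events and
  injective on the strict ones.\<close>

lemma card_facets_bounds: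
  assumes nd: "\<And>I. I \<subseteq> {..<n} \<Longrightarrow> card I = d \<Longrightarrow> gs_nondeg d (x \<circ> \<pi> I) d"
    and P: "P = convex hull (x ` {..<n})"
  defines "S \<equiv> {G \<in> facets d P. \<exists>h\<in>{h1..h2}. has_height d P G h}"
    and "T \<equiv> {I. I \<subseteq> {..<n} \<and> card I = d} \<times> {1, -1::real}"
  shows "card S \<le> (\<Sum>(I, s)\<in>T. of_bool (facet_event {..s} d n h1 h2 s (x \<circ> \<pi> I)))"
    and "(\<Sum>(I, s)\<in>T. of_bool (facet_event {..<s} d n h1 h2 s (x \<circ> \<pi> I))) \<le> card S"
proof -
  let ?\<phi> = "\<lambda>(I, s::real). gs_facet d P (x \<circ> \<pi> I)"
  let ?W = "{(I, s)\<in>T. facet_event {..s} d n h1 h2 s (x \<circ> \<pi> I)}"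
  let ?V = "{(I, s)\<in>T. facet_event {..<s} d n h1 h2 s (x \<circ> \<pi> I)}"
  have "finite {I. I \<subseteq> {..<n} \<and> card I = d}" by (rule finite_subset[of _ "Pow {..<n}"]) auto
  then have T: "finite T" by (simp add: T_def)
  have finW: "finite ?W" and finV: "finite ?V" by (auto intro: finite_subset[OF _ T])
  have sub: "S \<subseteq> ?\<phi> ` ?W"
  proof
    fix G assume "G \<in> S"
    then obtain h where "G \<in> facets d P" "h \<in> {h1..h2}" "has_height d P G h" by (auto simp: S_def)
    from facet_imp_facet_event[OF nd P this] show "G \<in> ?\<phi> ` ?W"
      unfolding T_def by force
  qed
  have "card S \<le> card (?\<phi> ` ?W)" by (rule card_mono) (use sub finW in auto)
  also have "\<dots> \<le> card ?W" by (rule card_image_le[OF finW])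
  also have "\<dots> = (\<Sum>(I, s)\<in>T. of_bool (facet_event {..s} d n h1 h2 s (x \<circ> \<pi> I)))"
    using T by (simp add: split_def of_bool_def sum.If_cases Int_def)
  finally show "card S \<le> (\<Sum>(I, s)\<in>T. of_bool (facet_event {..s} d n h1 h2 s (x \<circ> \<pi> I)))" .
  have fin: "finite S" using sub finW by (meson finite_imageI finite_subset)
  have inj: "inj_on ?\<phi> ?V"
  proof (rule inj_onI, clarify)
    fix I s J t
    assume T: "(I, s) \<in> T" "(J, t) \<in> T"
      and st: "facet_event {..<s} d n h1 h2 s (x \<circ> \<pi> I)" "facet_event {..<t} d n h1 h2 t (x \<circ> \<pi> J)"
      and eq: "gs_facet d P (x \<circ> \<pi> I) = gs_facet d P (x \<circ> \<pi> J)"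
    have IJ: "I = J"
      using facet_event_imp_facet(3)[OF P _ _ _ st(1)] facet_event_imp_facet(3)[OF P _ _ _ st(2)] eq T
      by (auto simp: T_def)
    \<comment> \<open>Because \<open>d < n\<close> there is a point off the hyperplane, and its side
      determines the sign.\<close>
    have "d \<in> {d..<n}" using d by simp
    then have "s * inner_dim d ((x \<circ> \<pi> I) d) (gs_sol d (x \<circ> \<pi> I) d) < s"
      "t * inner_dim d ((x \<circ> \<pi> I) d) (gs_sol d (x \<circ> \<pi> I) d) < t"
      using st unfolding facet_event_def IJ lessThan_iff by blast+
    then have "s = t" using T by (auto simp: T_def)
    then show "I = J \<and> s = t" using IJ by simp
  qed
  have VS: "?\<phi> ` ?V \<subseteq> S"
  proof
    fix G assume "G \<in> ?\<phi> ` ?V"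
    then obtain I s where I: "I \<subseteq> {..<n}" "card I = d" "s \<in> {1, -1}"
      "facet_event {..<s} d n h1 h2 s (x \<circ> \<pi> I)" "G = gs_facet d P (x \<circ> \<pi> I)"
      by (auto simp: T_def)
    then show "G \<in> S"
      using facet_event_imp_facet(1,2)[OF P I(1-4)] by (simp add: S_def)
  qed
  have "card ?V \<le> card S"
    using card_mono[OF fin VS] by (simp only: card_image[OF inj])
  moreover have "card ?V = (\<Sum>(I, s)\<in>T. of_bool (facet_event {..<s} d n h1 h2 s (x \<circ> \<pi> I)))"
    using T by (simp add: split_def of_bool_def sum.If_cases Int_def)
  ultimately show "(\<Sum>(I, s)\<in>T. of_bool (facet_event {..<s} d n h1 h2 s (x \<circ> \<pi> I))) \<le> card S" by simp
qed

end


subsection \<open>The expected number of facets\<close>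

text \<open>Probability of the facet event for one subset and one sign, after the points outside the
  subset have been integrated out.\<close>

definition facet_integral :: "nat \<Rightarrow> nat \<Rightarrow> real \<Rightarrow> real \<Rightarrow> real \<Rightarrow> ennreal"
  where "facet_integral d n h1 h2 s = (\<integral>\<^sup>+y. indicator {h1..h2} (s / sqrt (gs_norm d y d))
    * ennreal (sphere_cdf d (s / sqrt (gs_norm d y d)) ^ (n - d)) \<partial>sph d {..<d})"

lemma facet_event_cong:
  assumes "d \<le> n" "\<And>j. j < n \<Longrightarrow> y j = z j"
  shows "facet_event A d n h1 h2 s y \<longleftrightarrow> facet_event A d n h1 h2 s z"
proof -
  have "gs_nondeg d y d \<longleftrightarrow> gs_nondeg d z d" "gs_norm d y d = gs_norm d z d" "gs_sol d y d = gs_sol d z d"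
    using assms by (auto intro!: gs_nondeg_cong gs_norm_cong gs_sol_cong)
  then show ?thesis using assms by (auto simp: facet_event_def)
qed

lemma measurable_facet_event:
  assumes "d \<le> n" and [measurable]: "A \<in> sets borel"
  shows "Measurable.pred (sph d {..<n}) (facet_event A d n h1 h2 s)"
proof -
  have comp: "(\<lambda>y. y j) \<in> borel_measurable (sph d {..<n})" if "j < n" for j
    using that by (intro measurable_sph_component) auto
  have [measurable]: "Measurable.pred (sph d {..<n}) (\<lambda>y. gs_nondeg d y d)"
    by (rule measurable_gs_nondeg) (use comp assms in auto)
  have [measurable]: "(\<lambda>y. gs_norm d y d) \<in> borel_measurable (sph d {..<n})"
    by (rule measurable_gs_norm) (use comp assms in auto)
  have [measurable]: "(\<lambda>y. gs_sol d y d) \<in> borel_measurable (sph d {..<n})"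
    by (rule measurable_gs_sol) (use comp assms in auto)
  have [measurable]: "Measurable.pred (sph d {..<n}) (\<lambda>y. \<forall>j\<in>{d..<n}. s * inner_dim d (y j) (gs_sol d y d) \<in> A)"
  proof (intro pred_intros_finite)
    fix j assume "j \<in> {d..<n}"
    then have [measurable]: "(\<lambda>y. y j) \<in> borel_measurable (sph d {..<n})" using comp by simp
    show "Measurable.pred (sph d {..<n}) (\<lambda>y. s * inner_dim d (y j) (gs_sol d y d) \<in> A)"
      by measurable
  qed simp
  show ?thesis unfolding facet_event_def by measurable
qed

text \<open>Given the first \<open>d\<close> points, the remaining ones fall independently into a
  fixed half-space. The hypothesis on \<open>A\<close> lets the open and the closed half-space share
  one proof.\<close>

lemma nn_integral_facet_event:
  assumes d: "2 \<le> d" "d \<le> n" and A[measurable]: "A \<in> sets borel"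
    and half: "\<And>w. inner_dim d w w > 0 \<Longrightarrow>
      emeasure (uniform_sphere d) {x. s * inner_dim d x w \<in> A} = ennreal (sphere_cdf d (s / sqrt (inner_dim d w w)))"
  shows "(\<integral>\<^sup>+y. of_bool (facet_event A d n h1 h2 s y) \<partial>sph d {..<n}) = facet_integral d n h1 h2 s"
proof -
  have d0: "0 < d" using d by simp
  interpret product_sigma_finite "\<lambda>_::nat. uniform_sphere d"
    using d0 by (rule product_sigma_finite_sphere)
  let ?I = "{..<d}" and ?J = "{d..<n}"
  have IJ: "?I \<inter> ?J = {}" "{..<n} = ?I \<union> ?J" using d by auto
  note [measurable] = measurable_facet_event[OF d(2) A]
  have "(\<integral>\<^sup>+y. of_bool (facet_event A d n h1 h2 s y) \<partial>sph d {..<n})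
    = (\<integral>\<^sup>+x. (\<integral>\<^sup>+z. of_bool (facet_event A d n h1 h2 s (merge ?I ?J (x, z))) \<partial>sph d ?J) \<partial>sph d ?I)"
    unfolding IJ(2) by (rule product_nn_integral_fold[OF IJ(1)]) (simp_all flip: IJ(2))
  also have "\<dots> = facet_integral d n h1 h2 s"
    unfolding facet_integral_def
  proof (rule nn_integral_cong_AE)
    show "AE x in sph d ?I. (\<integral>\<^sup>+z. of_bool (facet_event A d n h1 h2 s (merge ?I ?J (x, z))) \<partial>sph d ?J)
      = indicator {h1..h2} (s / sqrt (gs_norm d x d)) * ennreal (sphere_cdf d (s / sqrt (gs_norm d x d)) ^ (n - d))"
      using AE_gs_nondeg[of d d, OF order_refl]
    proof eventually_elim
      case (elim x)
      define w where "w = gs_sol d x d"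
      let ?N = "gs_norm d x d"
      define B where "B = {v. s * inner_dim d v w \<in> A}"
      have B[measurable]: "B \<in> sets borel"
      proof -
        have "(\<lambda>v. s * inner_dim d v w) \<in> borel_measurable borel" by measurable
        from measurable_sets[OF this A] show ?thesis by (simp add: B_def vimage_def)
      qed
      have N: "inner_dim d w w = ?N" "?N > 0"
        using gs_norm_pos[OF elim d0] by (auto simp: w_def gs_norm_def)
      have ev: "facet_event A d n h1 h2 s (merge ?I ?J (x, z)) \<longleftrightarrow>
         s / sqrt ?N \<in> {h1..h2} \<and> (\<forall>j\<in>?J. z j \<in> B)" for z
      proof -
        have "gs_nondeg d (merge ?I ?J (x, z)) d \<longleftrightarrow> gs_nondeg d x d"
          "gs_norm d (merge ?I ?J (x, z)) d = ?N" "gs_sol d (merge ?I ?J (x, z)) d = w"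
          unfolding w_def by (rule gs_nondeg_cong gs_norm_cong gs_sol_cong; simp add: merge_def)+
        moreover have "merge ?I ?J (x, z) j = z j" if "j \<in> ?J" for j
          using that by (simp add: merge_def)
        ultimately show ?thesis using elim by (auto simp: facet_event_def B_def)
      qed
      have "(\<integral>\<^sup>+z. of_bool (facet_event A d n h1 h2 s (merge ?I ?J (x, z))) \<partial>sph d ?J)
        = (\<integral>\<^sup>+z. indicator {h1..h2} (s / sqrt ?N) * indicator (PiE ?J (\<lambda>_. B)) z \<partial>sph d ?J)"
        unfolding ev by (intro nn_integral_cong) (auto simp: space_PiM PiE_def Pi_def indicator_def)
      also have "\<dots> = indicator {h1..h2} (s / sqrt ?N) * emeasure (sph d ?J) (PiE ?J (\<lambda>_. B))"
      proof -
        have "PiE ?J (\<lambda>_. B) \<in> sets (sph d ?J)" by (rule sets_PiM_I_finite) auto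
        then show ?thesis by (simp add: nn_integral_cmult)
      qed
      also have "emeasure (sph d ?J) (PiE ?J (\<lambda>_. B)) = (\<Prod>j\<in>?J. emeasure (uniform_sphere d) B)"
        by (rule emeasure_PiM) auto
      also have "\<dots> = ennreal (sphere_cdf d (s / sqrt ?N) ^ (n - d))"
        using half[of w] N sphere_cdf_bounds[OF d0] by (simp add: B_def ennreal_power)
      finally show ?case .
    qed
  qed
  finally show ?thesis .
qed

lemma nn_integral_facet_weak:
  assumes "2 \<le> d" "d \<le> n" "s \<in> {1, -1}"
  shows "(\<integral>\<^sup>+y. of_bool (facet_event {..s} d n h1 h2 s y) \<partial>sph d {..<n}) = facet_integral d n h1 h2 s"
  by (rule nn_integral_facet_event) (use assms emeasure_halfspace(1)[OF assms(1) refl] in auto)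

lemma nn_integral_facet_strict:
  assumes "2 \<le> d" "d \<le> n" "s \<in> {1, -1}"
  shows "(\<integral>\<^sup>+y. of_bool (facet_event {..<s} d n h1 h2 s y) \<partial>sph d {..<n}) = facet_integral d n h1 h2 s"
  by (rule nn_integral_facet_event) (use assms emeasure_halfspace(2)[OF assms(1) refl] in auto)

section \<open>From one subset to the full facet count\<close>

lemma AE_uniform_sphere_topspace: "AE x in uniform_sphere d. x \<in> topspace (Euclidean_space d)"
proof -
  have [measurable]: "{x :: nat \<Rightarrow> real. \<forall>i\<ge>d. x i = 0} \<in> sets borel"
    by measurable
  show ?thesis
    unfolding uniform_sphere_alt topspace_Euclidean_space
    by (subst AE_distr_iff) (auto simp: sphere_proj_def)
qed

lemma exists_bij_extending:
  assumes "I \<subseteq> {..<n}" "card I = d"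
  shows "\<exists>p. bij_betw p {..<n} {..<n} \<and> p ` {..<d} = I"
proof -
  have fin: "finite I" using assms by (auto intro: finite_subset)
  have dn: "d \<le> n" using card_mono[OF _ assms(1)] assms(2) by simp
  obtain f where f: "bij_betw f {..<d} I"
    using finite_same_card_bij[of "{..<d}" I] fin assms by auto
  have "card {d..<n} = card ({..<n} - I)"
    using assms fin by (simp add: card_Diff_subset)
  then obtain g where g: "bij_betw g {d..<n} ({..<n} - I)"
    using finite_same_card_bij[of "{d..<n}" "{..<n} - I"] by auto
  define p where "p = (\<lambda>j. if j < d then f j else g j)"
  have p1: "bij_betw p {..<d} I"
    using f by (subst bij_betw_cong[of _ p f]) (auto simp: p_def)
  have p2: "bij_betw p {d..<n} ({..<n} - I)"
    using g by (subst bij_betw_cong[of _ p g]) (auto simp: p_def)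
  have "bij_betw p ({..<d} \<union> {d..<n}) (I \<union> ({..<n} - I))"
    by (rule bij_betw_combine[OF p1 p2]) auto
  moreover have "{..<d} \<union> {d..<n} = {..<n}" "I \<union> ({..<n} - I) = {..<n}" using dn assms by auto
  ultimately show ?thesis using p1 by (auto simp: bij_betw_def)
qed

text \<open>By exchangeability all subsets contribute equally, and the sums over weak and over
  strict events have the same integral. The facet count lies between them almost surely, so it is
  touched only by monotonicity of the integral; its measurability is never discussed.\<close>

lemma expected_facets_eq:
  assumes d: "2 \<le> d" "d < n" and iid: "iid_uniform_sphere M n d X"
  shows "expected_facets M n d X h1 h2
    = of_nat (n choose d) * (facet_integral d n h1 h2 1 + facet_integral d n h1 h2 (-1))"
proof -
  interpret M: prob_space M using iid by (simp add: iid_uniform_sphere_def)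
  have d0: "0 < d" and dn: "d \<le> n" using d by auto
  let ?n = "{..<n}"
  have ind: "M.indep_vars (\<lambda>_. borel) X ?n" and law: "\<And>i. i < n \<Longrightarrow> distr M borel (X i) = uniform_sphere d"
    using iid by (auto simp: iid_uniform_sphere_def)
  have X: "X i \<in> borel_measurable M" if "i < n" for i
    using ind that by (auto simp: M.indep_vars_def)
  have sets_eq: "sets (sph d ?n) = sets (PiM ?n (\<lambda>_. borel))"
    by (rule sets_PiM_cong) auto
  define Y where "Y = (\<lambda>\<omega>. \<lambda>i\<in>?n. X i \<omega>)"
  have Y[measurable]: "Y \<in> measurable M (sph d ?n)"
    unfolding Y_def by (rule measurable_restrict) (use X in \<open>auto simp: measurable_cong_sets[OF refl sets_uniform_sphere]\<close>)
  have "?n \<noteq> {}" using d by auto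
  have distrY: "distr M (sph d ?n) Y = sph d ?n"
  proof -
    have "distr M (sph d ?n) Y = distr M (PiM ?n (\<lambda>_. borel)) Y"
      by (rule distr_cong[OF refl sets_eq refl])
    also have "\<dots> = PiM ?n (\<lambda>i. distr M borel (X i))"
      unfolding Y_def using M.indep_vars_iff_distr_eq_PiM'[OF \<open>?n \<noteq> {}\<close>, of X "\<lambda>_. borel"] X ind by simp
    also have "\<dots> = sph d ?n"
      by (rule PiM_cong) (use law in auto)
    finally show ?thesis .
  qed
  \<comment> \<open>Permuting the indices preserves the product law, so any \<open>I\<close> can be
    moved to the front.\<close>
  define R where "R = (\<lambda>p :: nat \<Rightarrow> nat. \<lambda>y :: nat \<Rightarrow> nat \<Rightarrow> real. \<lambda>j\<in>?n. y (p j))"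
  have R: "R p \<in> measurable (sph d ?n) (sph d ?n)" "distr (sph d ?n) (sph d ?n) (R p) = sph d ?n"
    if p: "bij_betw p ?n ?n" for p
  proof -
    have pin: "p j \<in> ?n" if "j \<in> ?n" for j using p that by (auto simp: bij_betw_def)
    show "R p \<in> measurable (sph d ?n) (sph d ?n)"
      unfolding R_def by (rule measurable_restrict) (use pin in \<open>auto intro: measurable_component_singleton\<close>)
    show "distr (sph d ?n) (sph d ?n) (R p) = sph d ?n"
      unfolding R_def using p pin
      by (intro distr_PiM_reindex[of ?n "\<lambda>_. uniform_sphere d" p ?n] prob_space_uniform_sphere d0)
         (auto simp: bij_betw_def)
  qed
  have "\<forall>I\<in>{I. I \<subseteq> ?n \<and> card I = d}. \<exists>p. bij_betw p ?n ?n \<and> p ` {..<d} = I"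
    using exists_bij_extending by blast
  then obtain \<pi> where \<pi>': "\<forall>I\<in>{I. I \<subseteq> ?n \<and> card I = d}. bij_betw (\<pi> I) ?n ?n \<and> \<pi> I ` {..<d} = I"
    by (rule bchoice[THEN exE])
  then have \<pi>: "\<And>I. I \<subseteq> ?n \<Longrightarrow> card I = d \<Longrightarrow> bij_betw (\<pi> I) ?n ?n"
    "\<And>I. I \<subseteq> ?n \<Longrightarrow> card I = d \<Longrightarrow> \<pi> I ` {..<d} = I" by auto
  define Z where "Z = (\<lambda>I \<omega>. R (\<pi> I) (Y \<omega>))"
  have Zm: "Z I \<in> measurable M (sph d ?n)" and distrZ: "distr M (sph d ?n) (Z I) = sph d ?n"
    if "I \<subseteq> ?n" "card I = d" for I
  proof -
    note RI = R[OF \<pi>(1)[OF that]]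
    show "Z I \<in> measurable M (sph d ?n)"
      unfolding Z_def by (rule measurable_compose[OF Y RI(1)])
    have "distr M (sph d ?n) (Z I) = distr (distr M (sph d ?n) Y) (sph d ?n) (R (\<pi> I))"
      unfolding Z_def using distr_distr[OF RI(1) Y] by (simp add: comp_def)
    then show "distr M (sph d ?n) (Z I) = sph d ?n" by (simp add: distrY RI)
  qed
  have Z_eq: "Z I \<omega> j = ((\<lambda>i. X i \<omega>) \<circ> \<pi> I) j" if "I \<subseteq> ?n" "card I = d" "j < n" for I \<omega> j
  proof -
    have "\<pi> I j < n" using \<pi>(1)[OF that(1,2)] that(3) by (auto simp: bij_betw_def)
    then show ?thesis using that(3) by (simp add: Z_def R_def Y_def)
  qed
  let ?U = "{I. I \<subseteq> ?n \<and> card I = d}"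
  let ?T = "?U \<times> {1, -1::real}"
  have fin0: "finite ?U" by (rule finite_subset[of _ "Pow ?n"]) auto
  have card0: "card ?U = n choose d" using n_subsets[of ?n d] by simp
  have int: "(\<integral>\<^sup>+\<omega>. (\<Sum>(I, s)\<in>?T. of_bool (facet_event (A s) d n h1 h2 s ((\<lambda>i. X i \<omega>) \<circ> \<pi> I))) \<partial>M)
      = of_nat (n choose d) * (facet_integral d n h1 h2 1 + facet_integral d n h1 h2 (-1))"
    if A: "\<And>s. A s \<in> sets borel" and F: "\<And>s. s \<in> {1, -1} \<Longrightarrow>
        (\<integral>\<^sup>+y. of_bool (facet_event (A s) d n h1 h2 s y) \<partial>sph d ?n) = facet_integral d n h1 h2 s"
    for A :: "real \<Rightarrow> real set"
  proof -
    have ev: "facet_event (A s) d n h1 h2 s ((\<lambda>i. X i \<omega>) \<circ> \<pi> I) \<longleftrightarrow> facet_event (A s) d n h1 h2 s (Z I \<omega>)"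
      if "I \<in> ?U" for I s \<omega>
      using Z_eq[of I _ \<omega>] that by (intro facet_event_cong[OF dn]) auto
    have "(\<integral>\<^sup>+\<omega>. (\<Sum>(I, s)\<in>?T. of_bool (facet_event (A s) d n h1 h2 s ((\<lambda>i. X i \<omega>) \<circ> \<pi> I))) \<partial>M)
      = (\<integral>\<^sup>+\<omega>. (\<Sum>p\<in>?T. of_bool (facet_event (A (snd p)) d n h1 h2 (snd p) (Z (fst p) \<omega>))) \<partial>M)"
      using ev by (intro nn_integral_cong sum.cong) auto
    also have "\<dots> = (\<Sum>p\<in>?T. \<integral>\<^sup>+\<omega>. of_bool (facet_event (A (snd p)) d n h1 h2 (snd p) (Z (fst p) \<omega>)) \<partial>M)"
    proof (rule nn_integral_sum)
      fix p assume "p \<in> ?T"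
      then have "Z (fst p) \<in> measurable M (sph d ?n)" by (intro Zm) auto
      from measurable_compose[OF this measurable_facet_event[OF dn A]]
      have [measurable]: "Measurable.pred M (\<lambda>\<omega>. facet_event (A (snd p)) d n h1 h2 (snd p) (Z (fst p) \<omega>))" .
      show "(\<lambda>\<omega>. of_bool (facet_event (A (snd p)) d n h1 h2 (snd p) (Z (fst p) \<omega>)) :: ennreal) \<in> borel_measurable M"
        by measurable
    qed
    also have "\<dots> = (\<Sum>p\<in>?T. facet_integral d n h1 h2 (snd p))"
    proof (rule sum.cong[OF refl])
      fix p assume p: "p \<in> ?T"
      then have I: "fst p \<subseteq> ?n" "card (fst p) = d" and s: "snd p \<in> {1, -1}" by auto
      note [measurable] = measurable_facet_event[OF dn A]
      have "(\<integral>\<^sup>+\<omega>. of_bool (facet_event (A (snd p)) d n h1 h2 (snd p) (Z (fst p) \<omega>)) \<partial>M)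
        = (\<integral>\<^sup>+y. of_bool (facet_event (A (snd p)) d n h1 h2 (snd p) y) \<partial>distr M (sph d ?n) (Z (fst p)))"
        by (subst nn_integral_distr) (use Zm[OF I] in auto)
      then show "(\<integral>\<^sup>+\<omega>. of_bool (facet_event (A (snd p)) d n h1 h2 (snd p) (Z (fst p) \<omega>)) \<partial>M) = facet_integral d n h1 h2 (snd p)"
        using F[OF s] by (simp add: distrZ[OF I])
    qed
    also have "\<dots> = (\<Sum>I\<in>?U. \<Sum>s\<in>{1, -1}. facet_integral d n h1 h2 s)"
      by (subst sum.cartesian_product) (simp add: split_def)
    also have "\<dots> = of_nat (n choose d) * (facet_integral d n h1 h2 1 + facet_integral d n h1 h2 (-1))"
      by (simp add: card0)
    finally show ?thesis .
  qed
  have AE_nd: "AE \<omega> in M. gs_nondeg d ((\<lambda>i. X i \<omega>) \<circ> \<pi> I) d" if I: "I \<in> ?U" for I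
  proof -
    have I': "I \<subseteq> ?n" "card I = d" using I by auto
    interpret P: product_prob_space "\<lambda>_::nat. uniform_sphere d"
      by (rule product_prob_spaceI) (rule prob_space_uniform_sphere[OF d0])
    have "distr (sph d ?n) (sph d {..<d}) (\<lambda>f. restrict f {..<d}) = sph d {..<d}"
      by (rule P.distr_restrict[symmetric]) (use dn in auto)
    then have "AE y in distr (sph d ?n) (sph d {..<d}) (\<lambda>f. restrict f {..<d}). gs_nondeg d y d"
      using AE_gs_nondeg[of d d] by (simp only: order_refl simp_thms)
    then have "AE y in sph d ?n. gs_nondeg d (restrict y {..<d}) d"
      by (rule AE_distrD[rotated]) (use dn in \<open>auto intro: measurable_restrict_subset\<close>)
    then have "AE y in distr M (sph d ?n) (Z I). gs_nondeg d (restrict y {..<d}) d"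
      by (subst distrZ[OF I'])
    then have "AE \<omega> in M. gs_nondeg d (restrict (Z I \<omega>) {..<d}) d"
      by (rule AE_distrD[OF Zm[OF I']])
    then show ?thesis
    proof eventually_elim
      case (elim \<omega>)
      have "gs_nondeg d (restrict (Z I \<omega>) {..<d}) d \<longleftrightarrow> gs_nondeg d ((\<lambda>i. X i \<omega>) \<circ> \<pi> I) d"
        using Z_eq[OF I', of _ \<omega>] dn by (intro gs_nondeg_cong) auto
      then show ?case using elim by simp
    qed
  qed
  have "AE \<omega> in M. \<forall>I\<in>?U. gs_nondeg d ((\<lambda>i. X i \<omega>) \<circ> \<pi> I) d"
    using AE_nd by (intro AE_finite_allI[OF fin0])
  moreover have "AE \<omega> in M. \<forall>i\<in>?n. X i \<omega> \<in> topspace (Euclidean_space d)"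
  proof (intro AE_finite_allI)
    fix i assume i: "i \<in> ?n"
    have "AE x in distr M borel (X i). x \<in> topspace (Euclidean_space d)"
      by (subst law) (use i AE_uniform_sphere_topspace[of d] in auto)
    then show "AE \<omega> in M. X i \<omega> \<in> topspace (Euclidean_space d)"
      by (rule AE_distrD[rotated]) (use X i in auto)
  qed simp
  ultimately have AE: "AE \<omega> in M.
     card {G \<in> facets d (random_polytope n X \<omega>). \<exists>h\<in>{h1..h2}. has_height d (random_polytope n X \<omega>) G h}
       \<le> (\<Sum>(I, s)\<in>?T. of_bool (facet_event {..s} d n h1 h2 s ((\<lambda>i. X i \<omega>) \<circ> \<pi> I))) \<and>
     (\<Sum>(I, s)\<in>?T. of_bool (facet_event {..<s} d n h1 h2 s ((\<lambda>i. X i \<omega>) \<circ> \<pi> I)))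
       \<le> card {G \<in> facets d (random_polytope n X \<omega>). \<exists>h\<in>{h1..h2}. has_height d (random_polytope n X \<omega>) G h}"
  proof eventually_elim
    case (elim \<omega>)
    define x where "x = (\<lambda>i. X i \<omega>)"
    have x: "\<And>i. i < n \<Longrightarrow> x i \<in> topspace (Euclidean_space d)"
      using elim(2) by (simp add: x_def)
    have nd: "\<And>I. I \<subseteq> ?n \<Longrightarrow> card I = d \<Longrightarrow> gs_nondeg d (x \<circ> \<pi> I) d"
      using elim(1) by (simp add: x_def)
    have P: "random_polytope n X \<omega> = convex hull (x ` ?n)"
      by (simp add: random_polytope_def x_def)
    show ?case
      using card_facets_bounds[OF d x \<pi> nd P, of h1 h2]
      unfolding x_def by (rule conjI)
  qed
  have cast: "of_nat (\<Sum>(I, s)\<in>?T. of_bool (Q I s)) = (\<Sum>(I, s)\<in>?T. of_bool (Q I s) :: ennreal)" for Q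
    by (simp add: split_def)
  show ?thesis
  proof (rule antisym)
    have "expected_facets M n d X h1 h2 \<le>
      (\<integral>\<^sup>+\<omega>. (\<Sum>(I, s)\<in>?T. of_bool (facet_event {..s} d n h1 h2 s ((\<lambda>i. X i \<omega>) \<circ> \<pi> I))) \<partial>M)"
      unfolding expected_facets_def
    proof (rule nn_integral_mono_AE, use AE in eventually_elim)
      case (elim \<omega>)
      then show ?case by (subst cast[symmetric]) (simp only: of_nat_le_iff)
    qed
    also have "\<dots> = of_nat (n choose d) * (facet_integral d n h1 h2 1 + facet_integral d n h1 h2 (-1))"
      by (rule int) (use nn_integral_facet_weak d in auto)
    finally show "expected_facets M n d X h1 h2
      \<le> of_nat (n choose d) * (facet_integral d n h1 h2 1 + facet_integral d n h1 h2 (-1))" .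
    have "of_nat (n choose d) * (facet_integral d n h1 h2 1 + facet_integral d n h1 h2 (-1))
      = (\<integral>\<^sup>+\<omega>. (\<Sum>(I, s)\<in>?T. of_bool (facet_event {..<s} d n h1 h2 s ((\<lambda>i. X i \<omega>) \<circ> \<pi> I))) \<partial>M)"
      by (rule int[symmetric]) (use nn_integral_facet_strict d in auto)
    also have "\<dots> \<le> expected_facets M n d X h1 h2"
      unfolding expected_facets_def
    proof (rule nn_integral_mono_AE, use AE in eventually_elim)
      case (elim \<omega>)
      then show ?case by (subst cast[symmetric]) (simp only: of_nat_le_iff)
    qed
    finally show "of_nat (n choose d) * (facet_integral d n h1 h2 1 + facet_integral d n h1 h2 (-1))
      \<le> expected_facets M n d X h1 h2" .
  qed
qed


subsection \<open>Bounds on the expected number of facets\<close>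

lemma measurable_sphere_cdf: "0 < d \<Longrightarrow> sphere_cdf d \<in> borel_measurable borel"
  by (intro borel_measurable_mono monoI sphere_cdf_mono)

lemma measurable_gs_height: "(\<lambda>y. s / sqrt (gs_norm d y d)) \<in> borel_measurable (sph d {..<d})"
proof -
  have [measurable]: "(\<lambda>y. gs_norm d y d) \<in> borel_measurable (sph d {..<d})"
    by (rule measurable_gs_norm_sph) simp
  show ?thesis by measurable
qed

lemma facet_integral_subadd:
  assumes d: "0 < d" and C: "finite C" "{h1..h2} \<subseteq> (\<Union>(a, b)\<in>C. {a..b})"
  shows "facet_integral d n h1 h2 s \<le> (\<Sum>(a, b)\<in>C. facet_integral d n a b s)"
proof -
  note [measurable] = measurable_gs_height measurable_sphere_cdf[OF d]
  let ?F = "\<lambda>y. ennreal (sphere_cdf d (s / sqrt (gs_norm d y d)) ^ (n - d))"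
  have "facet_integral d n h1 h2 s \<le> (\<integral>\<^sup>+y. (\<Sum>c\<in>C. indicator {fst c..snd c} (s / sqrt (gs_norm d y d)) * ?F y) \<partial>sph d {..<d})"
    unfolding facet_integral_def
  proof (rule nn_integral_mono)
    fix y
    let ?h = "s / sqrt (gs_norm d y d)"
    show "indicator {h1..h2} ?h * ?F y \<le> (\<Sum>c\<in>C. indicator {fst c..snd c} ?h * ?F y)"
    proof (cases "?h \<in> {h1..h2}")
      case True
      then obtain c where c: "c \<in> C" "?h \<in> {fst c..snd c}" using C(2) by fastforce
      have "indicator {h1..h2} ?h * ?F y = indicator {fst c..snd c} ?h * ?F y"
        using True c by (simp add: indicator_def)
      also have "\<dots> \<le> (\<Sum>c\<in>C. indicator {fst c..snd c} ?h * ?F y)"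
        by (rule member_le_sum) (use c C in auto)
      finally show ?thesis .
    next
      case False
      then have "indicator {h1..h2} ?h = (0 :: ennreal)" by (rule indicator_simps)
      then show ?thesis by simp
    qed
  qed
  also have "\<dots> = (\<Sum>c\<in>C. \<integral>\<^sup>+y. indicator {fst c..snd c} (s / sqrt (gs_norm d y d)) * ?F y \<partial>sph d {..<d})"
    by (rule nn_integral_sum) measurable
  finally show ?thesis
    by (simp add: facet_integral_def split_def)
qed

text \<open>The value of \<open>expected_facets\<close> just found. It does not mention the
  probability spaces, so the asymptotic analysis is carried out on it.\<close>

definition facet_expectation :: "nat \<Rightarrow> nat \<Rightarrow> real \<Rightarrow> real \<Rightarrow> ennreal"
  where "facet_expectation d n h1 h2
    = of_nat (n choose d) * (facet_integral d n h1 h2 1 + facet_integral d n h1 h2 (-1))"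

lemma facet_expectation_subadd:
  assumes d: "0 < d" and C: "finite C" "{h1..h2} \<subseteq> (\<Union>(a, b)\<in>C. {a..b})"
  shows "facet_expectation d n h1 h2 \<le> (\<Sum>(a, b)\<in>C. facet_expectation d n a b)"
proof -
  have "facet_expectation d n h1 h2 \<le> of_nat (n choose d) *
     ((\<Sum>(a, b)\<in>C. facet_integral d n a b 1) + (\<Sum>(a, b)\<in>C. facet_integral d n a b (-1)))"
    unfolding facet_expectation_def
    by (intro mult_left_mono add_mono facet_integral_subadd[OF d C]) auto
  also have "\<dots> = (\<Sum>(a, b)\<in>C. facet_expectation d n a b)"
    by (simp add: facet_expectation_def split_def sum.distrib[symmetric] sum_distrib_left)
  finally show ?thesis .
qed

lemma facet_expectation_mono:
  assumes "0 < d" "h1' \<le> h1" "h2 \<le> h2'"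
  shows "facet_expectation d n h1 h2 \<le> facet_expectation d n h1' h2'"
  using facet_expectation_subadd[OF assms(1), of "{(h1', h2')}" h1 h2 n] assms by auto

lemma facet_expectation_split:
  assumes "0 < d"
  shows "facet_expectation d n a c \<le> facet_expectation d n a b + facet_expectation d n b c"
proof (cases "(a, b) = (b, c)")
  case True
  then show ?thesis by simp
next
  case False
  have "{a..c} \<subseteq> (\<Union>(a, b)\<in>{(a, b), (b, c)}. {a..b})" by auto
  then show ?thesis
    using facet_expectation_subadd[OF assms, of "{(a, b), (b, c)}" a c n] False by simp
qed

text \<open>Exponent of \<open>1 - h\<^sup>2\<close> in the exact tail for \<open>d - 1\<close>
  points; it grows like half the square of \<open>d\<close>.\<close>

definition tail_exp :: "nat \<Rightarrow> real"
  where "tail_exp d = real (d - 1) * (d / 2 - 1)"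

text \<open>The cap probability is largest at the right end of the window, and the heights force the
  squared distance above \<open>H\<close>, so the two factors are bounded separately. For
  \<open>H = 0\<close> the tail bound is trivial, which serves windows that contain height
  0.\<close>

lemma facet_integral_upper:
  assumes d: "2 \<le> d" and H: "0 \<le> H" "H < 1" and s: "s \<in> {1, -1}"
    and heights: "H = 0 \<or> (\<forall>h\<in>{h1..h2}. H < h\<^sup>2)"
  shows "facet_integral d n h1 h2 s \<le> ennreal ((1 - H) powr tail_exp d * sphere_cdf d h2 ^ (n - d))"
proof -
  have d0: "0 < d" using d by simp
  interpret prob_space "sph d {..<d}" using d0 by (rule prob_space_sph)
  have [measurable]: "(\<lambda>y. gs_norm d y d) \<in> borel_measurable (sph d {..<d})"
    by (rule measurable_gs_norm_sph) simp
  have tail: "(\<integral>\<^sup>+y. indicator {0<..} (1 - H * gs_norm d y d) \<partial>sph d {..<d}) \<le> ennreal ((1 - H) powr tail_exp d)"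
  proof (cases "H = 0")
    case True
    then show ?thesis using emeasure_space_1 by simp
  next
    case False
    then show ?thesis
      using emeasure_gs_norm_upper[OF _ H(2) d] H unfolding tail_exp_def by simp
  qed
  have "facet_integral d n h1 h2 s \<le> (\<integral>\<^sup>+y. indicator {0<..} (1 - H * gs_norm d y d) * ennreal (sphere_cdf d h2 ^ (n - d)) \<partial>sph d {..<d})"
    unfolding facet_integral_def
  proof (rule nn_integral_mono)
    fix y
    let ?N = "gs_norm d y d"
    let ?h = "s / sqrt ?N"
    show "indicator {h1..h2} ?h * ennreal (sphere_cdf d ?h ^ (n - d))
      \<le> indicator {0<..} (1 - H * ?N) * ennreal (sphere_cdf d h2 ^ (n - d))"
    proof (cases "?h \<in> {h1..h2}")
      case True
      have "H * ?N < 1"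
      proof (cases "H = 0")
        case False
        then have lt: "H < ?h\<^sup>2" using heights True by auto
        have "?h\<^sup>2 = 1 / ?N" using s by (auto simp: power_divide)
        moreover have "?N \<noteq> 0" using lt H by auto
        then have "?N > 0" using gs_norm_nonneg[of d y d] by (simp add: less_le del: gs_norm_nonneg)
        ultimately show ?thesis using lt by (simp add: field_simps)
      qed simp
      moreover have "sphere_cdf d ?h ^ (n - d) \<le> sphere_cdf d h2 ^ (n - d)"
        using True sphere_cdf_bounds[OF d0] by (intro power_mono sphere_cdf_mono d0) auto
      ultimately show ?thesis using True by (simp add: indicator_def ennreal_leI)
    next
      case False
      then have "indicator {h1..h2} ?h = (0 :: ennreal)" by (rule indicator_simps)
      then show ?thesis by simp
    qed
  qed
  also have "\<dots> = (\<integral>\<^sup>+y. indicator {0<..} (1 - H * gs_norm d y d) \<partial>sph d {..<d}) * ennreal (sphere_cdf d h2 ^ (n - d))"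
    by (rule nn_integral_multc) measurable
  also have "\<dots> \<le> ennreal ((1 - H) powr tail_exp d) * ennreal (sphere_cdf d h2 ^ (n - d))"
    by (rule mult_right_mono[OF tail]) simp
  finally show ?thesis
    using sphere_cdf_bounds[OF d0] by (simp add: ennreal_mult)
qed

lemma facet_expectation_upper:
  assumes "2 \<le> d" "0 \<le> H" "H < 1" "H = 0 \<or> (\<forall>h\<in>{h1..h2}. H < h\<^sup>2)"
  shows "facet_expectation d n h1 h2
    \<le> ennreal (2 * (real (n choose d) * (1 - H) powr tail_exp d * sphere_cdf d h2 ^ (n - d)))"
proof -
  have d0: "0 < d" using assms by simp
  let ?a = "(1 - H) powr tail_exp d * sphere_cdf d h2 ^ (n - d)"
  have "facet_expectation d n h1 h2 \<le> of_nat (n choose d) * (ennreal ?a + ennreal ?a)"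
    unfolding facet_expectation_def
    using assms by (intro mult_left_mono add_mono facet_integral_upper) auto
  also have "\<dots> = ennreal (real (n choose d) * (?a + ?a))"
  proof -
    have "0 \<le> ?a" using sphere_cdf_bounds[OF d0] by simp
    then show ?thesis
      by (simp only: ennreal_plus[symmetric] ennreal_of_nat_eq_real_of_nat ennreal_mult'[symmetric] add_nonneg_nonneg of_nat_0_le_iff)
  qed
  finally show ?thesis by (simp add: algebra_simps)
qed

text \<open>The distance is confined to a window by subtracting the tail at \<open>b\<close> from
  that at \<open>a\<close>. The intermediate \<open>g\<close> is the level required of the first
  \<open>d - 1\<close> points. The cap probability is smallest at the left end of the signed window,
  which is \<open>- b\<close> for negative heights.\<close>

lemma facet_integral_lower:
  assumes d: "3 \<le> d" and ab: "0 < a" "a < g" "g < b" "b < 1" and s: "s \<in> {1, -1}"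
    and h: "h1 \<le> (if s = 1 then a else - b)" "(if s = 1 then b else - a) \<le> h2"
  shows "ennreal (sphere_cdf d (if s = 1 then a else - b) ^ (n - d) *
      ((1 - a\<^sup>2 / g\<^sup>2) powr (1 / 2) * (1 - a\<^sup>2) powr (real (d - 1) / 2) / real (d - 1) * (1 - g\<^sup>2) powr tail_exp d
        - (1 - b\<^sup>2) powr tail_exp d)) \<le> facet_integral d n h1 h2 s"
proof -
  have d0: "0 < d" and d2: "2 \<le> d" using d by auto
  have [measurable]: "(\<lambda>y. gs_norm d y d) \<in> borel_measurable (sph d {..<d})"
    by (rule measurable_gs_norm_sph) simp
  let ?lo = "if s = 1 then a else - b"
  let ?F = "ennreal (sphere_cdf d ?lo ^ (n - d))"
  let ?A = "(1 - a\<^sup>2 / g\<^sup>2) powr (1 / 2) * (1 - a\<^sup>2) powr (real (d - 1) / 2) / real (d - 1) * (1 - g\<^sup>2) powr tail_exp d"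
  let ?B = "(1 - b\<^sup>2) powr tail_exp d"
  let ?p = "\<lambda>H. \<integral>\<^sup>+y. indicator {0<..} (1 - H * gs_norm d y d) \<partial>sph d {..<d}"
  \<comment> \<open>Indicator that the distance \<open>1 / sqrt (gs_norm d y d)\<close> lies above
    \<open>a\<close> and not above \<open>b\<close>.\<close>
  let ?E = "\<lambda>y. indicator {0<..} (1 - a\<^sup>2 * gs_norm d y d) * indicator {..0} (1 - b\<^sup>2 * gs_norm d y d) :: ennreal"
  have sq: "0 < a\<^sup>2" "a\<^sup>2 < g\<^sup>2" "g\<^sup>2 < 1" "0 < b\<^sup>2" "b\<^sup>2 < 1"
    using ab by (auto intro: power_strict_mono simp: power_less_one_iff abs_square_less_1)
  have "?p (a\<^sup>2) \<le> (\<integral>\<^sup>+y. ?E y + indicator {0<..} (1 - b\<^sup>2 * gs_norm d y d) \<partial>sph d {..<d})"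
    by (rule nn_integral_mono) (auto simp: indicator_def)
  also have "\<dots> = (\<integral>\<^sup>+y. ?E y \<partial>sph d {..<d}) + ?p (b\<^sup>2)"
    by (rule nn_integral_add) measurable
  also have "\<dots> \<le> (\<integral>\<^sup>+y. ?E y \<partial>sph d {..<d}) + ennreal ?B"
    using emeasure_gs_norm_upper[OF sq(4,5) d2] by (intro add_left_mono) (simp add: tail_exp_def)
  finally have "ennreal ?A \<le> (\<integral>\<^sup>+y. ?E y \<partial>sph d {..<d}) + ennreal ?B"
    using emeasure_gs_norm_lower[OF sq(1,2,3) d] unfolding tail_exp_def by (rule order_trans[rotated])
  then have diff: "ennreal (?A - ?B) \<le> (\<integral>\<^sup>+y. ?E y \<partial>sph d {..<d})"
    by (simp add: ennreal_minus_le_iff flip: ennreal_minus) (simp add: add.commute)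
  have "ennreal (sphere_cdf d ?lo ^ (n - d) * (?A - ?B)) = ?F * ennreal (?A - ?B)"
    using sphere_cdf_bounds[OF d0] by (intro ennreal_mult') auto
  also have "\<dots> \<le> ?F * (\<integral>\<^sup>+y. ?E y \<partial>sph d {..<d})"
    by (rule mult_left_mono[OF diff]) simp
  also have "\<dots> = (\<integral>\<^sup>+y. ?F * ?E y \<partial>sph d {..<d})"
    by (rule nn_integral_cmult[symmetric]) measurable
  also have "\<dots> \<le> facet_integral d n h1 h2 s"
    unfolding facet_integral_def
  proof (rule nn_integral_mono)
    fix y
    let ?N = "gs_norm d y d"
    let ?h = "s / sqrt ?N"
    show "?F * ?E y \<le> indicator {h1..h2} ?h * ennreal (sphere_cdf d ?h ^ (n - d))"
    proof (cases "a\<^sup>2 * ?N < 1 \<and> 1 \<le> b\<^sup>2 * ?N")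
      case True
      then have N: "?N > 0" using sq by (metis less_le_trans zero_less_one zero_less_mult_pos)
      have "a * sqrt ?N < 1"
        using True ab N real_sqrt_less_mono[of "a\<^sup>2 * ?N" 1] by (simp add: real_sqrt_mult)
      moreover have "1 \<le> b * sqrt ?N"
        using True ab N real_sqrt_le_mono[of 1 "b\<^sup>2 * ?N"] by (simp add: real_sqrt_mult)
      ultimately have hh: "a \<le> 1 / sqrt ?N" "1 / sqrt ?N \<le> b" using N by (auto simp: field_simps)
      have lo: "?lo \<le> ?h" using s hh by auto
      have "?h \<in> {h1..h2}" using s hh h by auto
      moreover have "sphere_cdf d ?lo ^ (n - d) \<le> sphere_cdf d ?h ^ (n - d)"
        using sphere_cdf_bounds[OF d0] lo by (intro power_mono sphere_cdf_mono d0) auto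
      ultimately show ?thesis using True by (simp add: indicator_def ennreal_leI)
    qed (auto simp: indicator_def)
  qed
  finally show ?thesis .
qed

subsection \<open>Exponential rates\<close>

text \<open>Crude Stirling bounds by induction from
  \<open>1 / (n + 1) \<le> ln (1 + 1 / n) \<le> 1 / n\<close>; an error of order \<open>ln n\<close>
  disappears after division by \<open>d\<close>.\<close>

lemma ln_fact_bounds:
  assumes "1 \<le> n"
  shows "real n * ln n - n \<le> ln (fact n)" "ln (fact n) \<le> real n * ln n - n + ln n + 1"
proof -
  have "real n * ln n - n \<le> ln (fact n) \<and> ln (fact n) \<le> real n * ln n - n + ln n + 1"
    using assms
  proof (induction n rule: nat_induct_at_least)
    case base
    then show ?case by simp
  next
    case (Suc n)
    have n: "real n > 0" using Suc.hyps by simp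
    have fact: "ln (fact (Suc n) :: real) = ln (real n + 1) + ln (fact n)"
      by (simp add: ln_mult add.commute)
    have step: "ln (real n + 1) - ln n = ln (1 + 1 / n)"
      using n ln_div[of "real n + 1" "real n"] by (simp add: add_divide_distrib)
    have "n * (ln (real n + 1) - ln n) \<le> n * (1 / n)"
      unfolding step using n by (intro mult_left_mono ln_add_one_self_le_self) auto
    then have up: "n * (ln (real n + 1) - ln n) \<le> 1" using n by simp
    have quot: "real n / (real n + 1) = 1 + (- (1 / (real n + 1)))"
      using n by (simp add: field_simps)
    have "ln n - ln (real n + 1) = ln (real n / (real n + 1))"
      using n by (subst ln_div) auto
    also have "\<dots> = ln (1 + (- (1 / (real n + 1))))"
      by (simp only: quot)
    also have "\<dots> \<le> - (1 / (real n + 1))"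
      using n by (intro ln_add_one_self_le_self2) simp
    finally have "(real n + 1) * (1 / (real n + 1)) \<le> (real n + 1) * (ln (real n + 1) - ln n)"
      using n by (intro mult_left_mono) auto
    then have low: "1 \<le> (real n + 1) * (ln (real n + 1) - ln n)" using n by simp
    show ?case
      using Suc.IH up low unfolding fact by (simp add: algebra_simps)
  qed
  then show "real n * ln n - n \<le> ln (fact n)" "ln (fact n) \<le> real n * ln n - n + ln n + 1" by auto
qed

text \<open>The linear terms of the three factorials cancel because \<open>n = d + m\<close>, and
  dividing \<open>n ln n - d ln d - m ln m\<close> by \<open>d\<close> gives a function of the ratio
  \<open>r = m / d\<close> alone.\<close>

lemma ln_binomial_bounds:
  assumes d: "1 \<le> d" "d < n"
  defines "r \<equiv> (real n - real d) / real d"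
  shows "\<bar>ln (real (n choose d)) / d - ((1 + r) * ln (1 + r) - r * ln r)\<bar> \<le> (2 * ln n + 2) / d"
proof -
  define m where "m = n - d"
  have m: "1 \<le> m" "n = d + m" using d by (auto simp: m_def)
  have n1: "1 \<le> n" using d by simp
  have r: "r = real m / real d" "1 + r = real n / real d" using m d by (auto simp: r_def field_simps)
  have "real (n choose d) = fact n / (fact d * fact m)"
    using binomial_fact[of d n, where 'a=real] d by (simp add: m_def)
  then have lnC: "ln (real (n choose d)) = ln (fact n) - ln (fact d) - ln (fact m)"
    by (simp add: ln_div ln_mult)
  let ?S = "real n * ln n - d * ln d - m * ln m"
  have lnle: "ln (real d) \<le> ln n" "ln (real m) \<le> ln n" "0 \<le> ln (real d)" "0 \<le> ln (real m)" "0 \<le> ln (real n)"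
    using d m by auto
  have "\<bar>ln (real (n choose d)) - ?S\<bar> \<le> 2 * ln n + 2"
    using ln_fact_bounds[OF n1] ln_fact_bounds[OF d(1)] ln_fact_bounds[OF m(1)] lnle m(2)
    unfolding lnC by (simp add: abs_le_iff)
  then have "\<bar>ln (real (n choose d)) - ?S\<bar> / d \<le> (2 * ln n + 2) / d"
    by (rule divide_right_mono) simp
  moreover have "\<bar>ln (real (n choose d)) - ?S\<bar> / d = \<bar>ln (real (n choose d)) / d - ?S / d\<bar>"
    by (simp add: diff_divide_distrib[symmetric])
  moreover have "?S / d = (1 + r) * ln (1 + r) - r * ln r"
  proof -
    have "real n = real d + real m" using m by simp
    then have "?S = real n * (ln n - ln d) - m * (ln m - ln d)" by (simp add: algebra_simps)
    then have "?S / d = n / d * (ln n - ln d) - m / d * (ln m - ln d)"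
      by (simp only: diff_divide_distrib times_divide_eq_left)
    moreover have "ln (1 + r) = ln n - ln d"
      unfolding r(2) using d by (subst ln_div) auto
    moreover have "ln r = ln m - ln d"
      unfolding r(1) using d m by (subst ln_div) auto
    ultimately show ?thesis
      unfolding r(2)[symmetric] r(1)[symmetric] by simp
  qed
  ultimately show ?thesis by simp
qed

lemma exp_rate_tendsto_0:
  assumes d: "filterlim d at_top sequentially" and pos: "\<forall>\<^sub>F n in sequentially. 0 < f n"
    and rate: "(\<lambda>n. ln (f n) / real (d n)) \<longlonglongrightarrow> G" and G: "G < 0"
  shows "f \<longlonglongrightarrow> 0"
proof -
  have "filterlim (\<lambda>n. real (d n)) at_top sequentially"
    by (rule filterlim_compose[OF filterlim_real_sequentially d])
  then have "filterlim (\<lambda>n. (ln (f n) / real (d n)) * real (d n)) at_bot sequentially"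
    by (rule filterlim_tendsto_neg_mult_at_bot[OF rate G])
  then have "(\<lambda>n. exp ((ln (f n) / real (d n)) * real (d n))) \<longlonglongrightarrow> 0"
    by (rule filterlim_compose[OF exp_at_bot])
  moreover have "\<forall>\<^sub>F n in sequentially. exp ((ln (f n) / real (d n)) * real (d n)) = f n"
    using pos filterlim_at_top[THEN iffD1, OF d, rule_format, of 1]
    by eventually_elim simp
  ultimately show ?thesis by (rule Lim_transform_eventually)
qed

lemma exp_rate_at_top:
  assumes d: "filterlim d at_top sequentially" and pos: "\<forall>\<^sub>F n in sequentially. 0 < f n"
    and rate: "(\<lambda>n. ln (f n) / real (d n)) \<longlonglongrightarrow> G" and G: "G > 0"
  shows "filterlim f at_top sequentially"
proof -
  have "filterlim (\<lambda>n. real (d n)) at_top sequentially"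
    by (rule filterlim_compose[OF filterlim_real_sequentially d])
  then have "filterlim (\<lambda>n. (ln (f n) / real (d n)) * real (d n)) at_top sequentially"
    by (rule filterlim_tendsto_pos_mult_at_top[OF rate G])
  then have "filterlim (\<lambda>n. exp ((ln (f n) / real (d n)) * real (d n))) at_top sequentially"
    by (rule filterlim_compose[OF exp_at_top])
  moreover have "\<forall>\<^sub>F n in sequentially. exp ((ln (f n) / real (d n)) * real (d n)) = f n"
    using pos filterlim_at_top[THEN iffD1, OF d, rule_format, of 1]
    by eventually_elim simp
  ultimately show ?thesis
    by (subst filterlim_cong[OF refl refl]) (auto elim: eventually_mono)
qed

text \<open>An exponent of order half the square of \<open>x\<close> meets a logarithm of order
  \<open>- K / x\<close>; with \<open>K\<close> the square of the rescaled height this is the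
  quadratic term of the rate.\<close>

lemma tail_rate: "((\<lambda>x::real. ((x - 1) * (x / 2 - 1)) * ln (1 - K / x) / x) \<longlongrightarrow> - K / 2) at_top"
  by real_asymp

text \<open>The losses at the last point, a constant, a power of order \<open>x / 2\<close> and a
  divisor \<open>x - 1\<close>, do not affect the exponential rate.\<close>

lemma tail_rate': "((\<lambda>x::real. (c + (x - 1) / 2 * ln (1 - a / x) - ln (x - 1)) / x) \<longlongrightarrow> 0) at_top"
  by real_asymp


subsection \<open>The rate function\<close>

text \<open>Exponential growth rate of the binomial coefficient per dimension.\<close>

definition rate_const :: "real \<Rightarrow> real"
  where "rate_const \<rho> = (\<rho> + 1) * ln (\<rho> + 1) - \<rho> * ln \<rho>"

lemma g_rate_eq: "g_rate \<rho> r = rate_const \<rho> - r\<^sup>2 / 2 + \<rho> * ln (std_normal_cdf r)"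
  by (simp add: g_rate_def rate_const_def)

lemma isCont_ln_std_normal_cdf: "isCont (\<lambda>x. ln (std_normal_cdf x)) r"
  using isCont_ln'[OF isCont_std_normal_cdf] std_normal_cdf_pos[of r] by (metis less_irrefl)

lemma isCont_g_rate: "isCont (g_rate \<rho>) r"
  unfolding g_rate_eq[abs_def]
  by (intro continuous_intros isCont_ln_std_normal_cdf) auto

lemma ln_std_normal_cdf_neg: "ln (std_normal_cdf r) < 0"
  using std_normal_cdf_pos std_normal_cdf_less_1 by simp

text \<open>The difference \<open>u\<close> of the two sides has derivative
  \<open>exp (- (x\<^sup>2 / 2)) * (c - x)\<close>. It is positive at 0, increases up to
  \<open>c\<close> and then decreases strictly to its limit 0, so it stays positive.\<close>

lemma std_normal_tail_bound:
  assumes r: "0 \<le> r"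
  shows "1 - std_normal_cdf r < exp (- (r\<^sup>2 / 2))"
proof (rule ccontr)
  define u where "u = (\<lambda>x. exp (- (x\<^sup>2 / 2)) - (1 - std_normal_cdf x))"
  define c where "c = 1 / sqrt (2 * pi)"
  assume "\<not> ?thesis"
  then have ur: "u r \<le> 0" by (simp add: u_def)
  have du: "(u has_real_derivative exp (- (x\<^sup>2 / 2)) * (c - x)) (at x)" for x
    unfolding u_def
    by (auto intro!: derivative_eq_intros std_normal_cdf_deriv simp: std_normal_density_def c_def algebra_simps)
  show False
  proof (cases "r \<le> c")
    case True
    have "u 0 \<le> u r"
      by (rule DERIV_nonneg_imp_nondecreasing[OF r])
         (use du True in \<open>auto intro!: exI mult_nonneg_nonneg\<close>)
    moreover have "u 0 > 0" using std_normal_cdf_pos[of 0] by (simp add: u_def)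
    ultimately show False using ur by simp
  next
    case False
    have dec: "u y < u x" if "r \<le> x" "x < y" for x y
      by (rule DERIV_neg_imp_decreasing[OF that(2)])
         (use du False that in \<open>force intro!: mult_pos_neg\<close>)
    have "((\<lambda>x. exp (- (x\<^sup>2 / 2)) - (1 - std_normal_cdf x)) \<longlongrightarrow> 0 - (1 - 1)) at_top"
    proof (intro tendsto_diff tendsto_const std_normal_cdf_at_top)
      show "((\<lambda>x::real. exp (- (x\<^sup>2 / 2))) \<longlongrightarrow> 0) at_top" by real_asymp
    qed
    then have "(u \<longlongrightarrow> 0) at_top" by (simp add: u_def)
    moreover have "\<forall>\<^sub>F x in at_top. u x \<le> u (r + 1)"
      using eventually_gt_at_top[of "r + 1"] by eventually_elim (use dec[of "r + 1"] in \<open>auto intro: less_imp_le\<close>)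
    ultimately have "0 \<le> u (r + 1)" by (rule tendsto_upperbound) simp
    then show False using dec[of r "r + 1"] ur by simp
  qed
qed

text \<open>
  For \<open>r \<ge> 0\<close> and \<open>p = std_normal_cdf r\<close> the tail bound makes the rate larger than
  \<open>rate_const \<rho> + \<rho> ln p + ln (1 - p)\<close>, which vanishes at its maximum \<open>p = \<rho> / (1 + \<rho>)\<close>.
\<close>

lemma g_rate_pos_exists:
  assumes \<rho>: "\<rho> > 0"
  shows "\<exists>r\<ge>0. g_rate \<rho> r > 0"
proof (cases "std_normal_cdf 0 \<ge> \<rho> / (1 + \<rho>)")
  case True
  have "ln (\<rho> / (1 + \<rho>)) \<le> ln (std_normal_cdf 0)"
    using True \<rho> std_normal_cdf_pos[of 0] by (subst ln_le_cancel_iff) auto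
  then have "\<rho> * (ln \<rho> - ln (1 + \<rho>)) \<le> \<rho> * ln (std_normal_cdf 0)"
    using \<rho> by (intro mult_left_mono) (auto simp: ln_div)
  moreover have "ln (1 + \<rho>) > 0" using \<rho> by simp
  ultimately have "g_rate \<rho> 0 > 0"
    by (simp add: g_rate_def algebra_simps)
  then show ?thesis by (intro exI[of _ 0]) simp
next
  case False
  let ?p = "\<rho> / (1 + \<rho>)"
  have p: "?p < 1" using \<rho> by simp
  have "\<forall>\<^sub>F x in at_top. ?p < std_normal_cdf x"
    using order_tendstoD(1)[OF std_normal_cdf_at_top p] .
  moreover have "\<forall>\<^sub>F x::real in at_top. 0 \<le> x" by (rule eventually_ge_at_top)
  ultimately have "\<forall>\<^sub>F x in at_top. ?p < std_normal_cdf x \<and> 0 \<le> x" by eventually_elim simp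
  then have "\<exists>x. ?p < std_normal_cdf x \<and> 0 \<le> x"
    by (rule eventually_happens'[OF trivial_limit_at_top_linorder])
  then obtain x where x: "?p < std_normal_cdf x" "0 \<le> x" by (elim exE conjE)
  obtain r where r: "0 \<le> r" "std_normal_cdf r = ?p"
    using IVT[of std_normal_cdf 0 ?p x] False x isCont_std_normal_cdf by auto
  have "1 / (1 + \<rho>) = 1 - std_normal_cdf r" using r \<rho> by (simp add: field_simps)
  also have "\<dots> < exp (- (r\<^sup>2 / 2))" by (rule std_normal_tail_bound[OF r(1)])
  finally have "ln (1 / (1 + \<rho>)) < - (r\<^sup>2 / 2)"
    using \<rho> by (subst ln_exp[symmetric], subst ln_less_cancel_iff) auto
  then have "- ln (1 + \<rho>) < - (r\<^sup>2 / 2)" using \<rho> by (simp add: ln_div)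
  moreover have "\<rho> * ln (std_normal_cdf r) = \<rho> * (ln \<rho> - ln (1 + \<rho>))" using r \<rho> by (simp add: ln_div)
  ultimately have "g_rate \<rho> r > 0" by (simp add: g_rate_def algebra_simps)
  then show ?thesis using r(1) by blast
qed

section \<open>Shape of the set where the rate is positive\<close>

lemma g_rate_pos_bound:
  assumes \<rho>: "\<rho> > 0" and g: "g_rate \<rho> r > 0"
  shows "\<bar>r\<bar> \<le> sqrt (2 * rate_const \<rho>)"
proof -
  have "\<rho> * ln (std_normal_cdf r) < 0" using \<rho> ln_std_normal_cdf_neg by (simp add: mult_pos_neg)
  then have "r\<^sup>2 \<le> 2 * rate_const \<rho>" using g by (simp add: g_rate_eq)
  then show ?thesis using real_sqrt_le_mono by fastforce
qed

lemma g_rate_bdd: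
  assumes \<rho>: "\<rho> > 0"
  shows "bdd_below {r. g_rate \<rho> r > 0}" "bdd_above {r. g_rate \<rho> r > 0}"
  using g_rate_pos_bound[OF \<rho>]
  by (auto intro!: bdd_belowI[of _ "- sqrt (2 * rate_const \<rho>)"] bdd_aboveI[of _ "sqrt (2 * rate_const \<rho>)"]
      simp: abs_le_iff minus_le_iff)

lemma g_rate_less_nonpos:
  assumes \<rho>: "\<rho> > 0" and "r < s" "s \<le> 0"
  shows "g_rate \<rho> r < g_rate \<rho> s"
proof -
  have "s\<^sup>2 < r\<^sup>2" using power_strict_mono[of "- s" "- r" 2] assms by simp
  moreover have "ln (std_normal_cdf r) \<le> ln (std_normal_cdf s)"
    using std_normal_cdf_mono[of r s] std_normal_cdf_pos assms by simp
  then have "\<rho> * ln (std_normal_cdf r) \<le> \<rho> * ln (std_normal_cdf s)" using \<rho> by simp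
  ultimately show ?thesis by (simp add: g_rate_eq)
qed

text \<open>On the nonnegative axis the normal density decreases while its distribution function
  increases, so their quotient decreases and the derivative of the negated rate increases.\<close>

lemma g_rate_convex:
  assumes \<rho>: "\<rho> > 0"
  shows "convex_on {0..} (\<lambda>r. - g_rate \<rho> r)"
proof (rule convex_on_realI[where f'="\<lambda>r. r - \<rho> * (std_normal_density r / std_normal_cdf r)"])
  fix r :: real
  have "((\<lambda>r. - g_rate \<rho> r) has_real_derivative r - \<rho> * (std_normal_density r / std_normal_cdf r)) (at r)"
    unfolding g_rate_eq[abs_def] using std_normal_cdf_pos[of r]
    by (auto intro!: derivative_eq_intros std_normal_cdf_deriv)
  then show "((\<lambda>r. - g_rate \<rho> r) has_real_derivative r - \<rho> * (std_normal_density r / std_normal_cdf r)) (at r)" .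
next
  fix r s :: real assume rs: "r \<in> {0..}" "s \<in> {0..}" "r \<le> s"
  have "std_normal_density s \<le> std_normal_density r"
    using rs by (simp add: std_normal_density_def divide_right_mono power_mono)
  then have "std_normal_density s / std_normal_cdf s \<le> std_normal_density r / std_normal_cdf r"
    using rs std_normal_cdf_mono[of r s] std_normal_cdf_pos normal_density_nonneg
    by (intro frac_le) auto
  then have "\<rho> * (std_normal_density s / std_normal_cdf s) \<le> \<rho> * (std_normal_density r / std_normal_cdf r)"
    using \<rho> by (intro mult_left_mono) auto
  then show "r - \<rho> * (std_normal_density r / std_normal_cdf r) \<le> s - \<rho> * (std_normal_density s / std_normal_cdf s)"
    using rs by linarith
qed (auto simp: connected_Ici)

text \<open>Concavity with a positive weight at \<open>b\<close> yields strict positivity away from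
  \<open>a\<close>. This excludes zeros of the rate outside the closure of the set where it is
  positive.\<close>

lemma g_rate_between:
  assumes \<rho>: "\<rho> > 0" and a: "0 \<le> a" "0 \<le> b" and g: "g_rate \<rho> a \<ge> 0" "g_rate \<rho> b > 0"
    and c: "a < c \<and> c \<le> b \<or> b \<le> c \<and> c < a"
  shows "g_rate \<rho> c > 0"
proof -
  define t where "t = (c - a) / (b - a)"
  have t: "0 < t" "t \<le> 1" and tc: "t * (b - a) = c - a"
    using c by (auto simp: t_def zero_less_divide_iff divide_le_eq)
  have mid: "(1 - t) *\<^sub>R a + t *\<^sub>R b = c" using tc by (simp add: algebra_simps)
  have "- g_rate \<rho> c \<le> (1 - t) * - g_rate \<rho> a + t * - g_rate \<rho> b"
    using convex_onD[OF g_rate_convex[OF \<rho>], of t a b, unfolded mid] a t by simp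
  moreover have "0 < t * g_rate \<rho> b" "0 \<le> (1 - t) * g_rate \<rho> a" using t g by auto
  ultimately show ?thesis by simp
qed

text \<open>By definition of the infimum the rate is at most 0 below it. For negative
  \<open>r\<close> strictness comes from strict growth towards a point still below the infimum; for
  \<open>r \<ge> 0\<close> a zero at \<open>r\<close> would force a positive value at the midpoint
  \<open>c\<close>.\<close>

lemma g_rate_neg_below:
  assumes \<rho>: "\<rho> > 0" and r: "r < r_lower \<rho>"
  shows "g_rate \<rho> r < 0"
proof -
  have le: "g_rate \<rho> s \<le> 0" if "s < r_lower \<rho>" for s
    using that cInf_lower[OF _ g_rate_bdd(1)[OF \<rho>], of s] unfolding r_lower_def by force
  obtain s where s: "s \<ge> 0" "g_rate \<rho> s > 0" using g_rate_pos_exists[OF \<rho>] by blast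
  have sr: "r_lower \<rho> \<le> s" using le[of s] s by (cases "s < r_lower \<rho>") auto
  define c where "c = (r + r_lower \<rho>) / 2"
  have c: "r < c" "c < r_lower \<rho>" using r by (auto simp: c_def)
  show ?thesis
  proof (cases "r < 0")
    case True
    then have "r < min 0 c" "min 0 c < r_lower \<rho>" using c by (auto simp: min_def)
    then show ?thesis
      using g_rate_less_nonpos[OF \<rho>, of r "min 0 c"] le[of "min 0 c"] by simp
  next
    case False
    then show ?thesis
      using g_rate_between[OF \<rho>, of r s c] le[of c] c s sr by force
  qed
qed

text \<open>Only the concave side matters, because the supremum is at least the nonnegative point
  \<open>s\<close> where the rate is positive.\<close>

lemma g_rate_neg_above:
  assumes \<rho>: "\<rho> > 0" and r: "r > r_upper \<rho>"
  shows "g_rate \<rho> r < 0"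
proof -
  have le: "g_rate \<rho> s \<le> 0" if "s > r_upper \<rho>" for s
    using that cSup_upper[OF _ g_rate_bdd(2)[OF \<rho>], of s] unfolding r_upper_def by force
  obtain s where s: "s \<ge> 0" "g_rate \<rho> s > 0" using g_rate_pos_exists[OF \<rho>] by blast
  have sr: "s \<le> r_upper \<rho>" using le[of s] s by (cases "s > r_upper \<rho>") auto
  define c where "c = (r + r_upper \<rho>) / 2"
  have c: "c < r" "r_upper \<rho> < c" using r by (auto simp: c_def)
  show ?thesis
    using g_rate_between[OF \<rho>, of r s c] le[of c] c s sr by force
qed

text \<open>The lower bound for a window needs distances bounded away from 0 and heights of one
  sign, so a point of positive rate at 0 is shifted slightly.\<close>

lemma g_rate_pos_nonzero:
  assumes "g_rate \<rho> s > 0" "0 < \<delta>"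
  shows "\<exists>t. t \<noteq> 0 \<and> \<bar>t - s\<bar> < \<delta> \<and> g_rate \<rho> t > 0"
proof (cases "s = 0")
  case True
  have "(g_rate \<rho> \<longlongrightarrow> g_rate \<rho> 0) (at 0)" using isCont_g_rate by (simp add: isCont_def)
  then have "\<forall>\<^sub>F t in at 0. 0 < g_rate \<rho> t" using assms True by (auto intro: order_tendstoD(1))
  moreover have "\<forall>\<^sub>F t in at (0::real). dist t 0 < \<delta> \<and> t \<noteq> 0"
    using assms(2) by (auto simp: eventually_at intro!: exI[of _ \<delta>])
  ultimately have "\<forall>\<^sub>F t in at 0. 0 < g_rate \<rho> t \<and> dist t 0 < \<delta> \<and> t \<noteq> 0" by eventually_elim simp
  then show ?thesis using True eventually_happens'[OF trivial_limit_at] by (fastforce simp: dist_real_def)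
qed (use assms in auto)

subsection \<open>Asymptotics of the expected number of facets\<close>

lemma ennreal_null_comparison:
  assumes "\<forall>\<^sub>F n in sequentially. f n \<le> ennreal (2 * a n)" and "a \<longlonglongrightarrow> 0"
  shows "f \<longlonglongrightarrow> (0 :: ennreal)"
proof (rule tendsto_sandwich[OF _ assms(1) tendsto_const])
  have "(\<lambda>n. ennreal (2 * a n)) \<longlonglongrightarrow> ennreal (2 * 0)"
    by (intro tendsto_ennrealI tendsto_mult tendsto_const assms)
  then show "(\<lambda>n. ennreal (2 * a n)) \<longlonglongrightarrow> 0" by simp
qed simp

context
  fixes \<rho> :: real and d :: "nat \<Rightarrow> nat"
  assumes \<rho>: "\<rho> > 0"
    and d_top: "filterlim d at_top sequentially"
    and d_ev: "\<forall>\<^sub>F n in sequentially. 2 \<le> d n \<and> d n < n"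
    and ratio: "(\<lambda>n. (real n - real (d n)) / real (d n)) \<longlonglongrightarrow> \<rho>"
begin

abbreviation (input) scale :: "nat \<Rightarrow> real"
  where "scale n \<equiv> sqrt (real (d n))"

abbreviation (input) window :: "nat \<Rightarrow> real \<Rightarrow> real \<Rightarrow> ennreal"
  where "window n a b \<equiv> facet_expectation (d n) n (a / scale n) (b / scale n)"

section \<open>Exponential rates of the binomial coefficient, the tail and the cap
  probability\<close>

lemma real_d_top: "filterlim (\<lambda>n. real (d n)) at_top sequentially"
  by (rule filterlim_compose[OF filterlim_real_sequentially d_top])

lemma eventually_d_ge: "\<forall>\<^sub>F n in sequentially. x \<le> real (d n)"
  using filterlim_at_top[THEN iffD1, OF real_d_top] by blast

text \<open>Writing \<open>ln n\<close> as \<open>ln d + ln (n / d)\<close> shows that the error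
  vanishes after division by \<open>d\<close>, since \<open>n / d\<close> converges.\<close>

lemma binomial_rate: "(\<lambda>n. ln (real (n choose d n)) / real (d n)) \<longlonglongrightarrow> rate_const \<rho>"
proof -
  let ?r = "\<lambda>n. (real n - real (d n)) / real (d n)"
  let ?f = "\<lambda>n. (1 + ?r n) * ln (1 + ?r n) - ?r n * ln (?r n)"
  have f: "?f \<longlonglongrightarrow> (1 + \<rho>) * ln (1 + \<rho>) - \<rho> * ln \<rho>"
    using \<rho> by (intro tendsto_intros ratio) auto
  have "((\<lambda>x::real. ln x / x) \<longlongrightarrow> 0) at_top" by real_asymp
  then have 1: "(\<lambda>n. ln (real (d n)) / real (d n)) \<longlonglongrightarrow> 0"
    using real_d_top by (rule filterlim_compose)
  have "(\<lambda>n. 2 * ln (1 + ?r n) + 2) \<longlonglongrightarrow> 2 * ln (1 + \<rho>) + 2"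
    using \<rho> by (intro tendsto_intros ratio) auto
  then have 2: "(\<lambda>n. (2 * ln (1 + ?r n) + 2) / real (d n)) \<longlonglongrightarrow> 0"
    by (rule tendsto_divide_0[OF _ filterlim_at_top_imp_at_infinity[OF real_d_top]])
  have "(\<lambda>n. 2 * (ln (real (d n)) / real (d n)) + (2 * ln (1 + ?r n) + 2) / real (d n)) \<longlonglongrightarrow> 2 * 0 + 0"
    by (intro tendsto_intros 1 2)
  moreover have "\<forall>\<^sub>F n in sequentially. 2 * (ln (real (d n)) / real (d n)) + (2 * ln (1 + ?r n) + 2) / real (d n)
      = (2 * ln (real n) + 2) / real (d n)"
    using d_ev
  proof eventually_elim
    case (elim n)
    have "1 + ?r n = real n / real (d n)" using elim by (simp add: field_simps)
    then have "ln (1 + ?r n) = ln (real n) - ln (real (d n))"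
      using elim by (simp add: ln_div)
    then have "ln (real n) = ln (real (d n)) + ln (1 + ?r n)" by simp
    then show ?case by (simp only: add_divide_distrib distrib_left times_divide_eq_right ac_simps)
  qed
  ultimately have err: "(\<lambda>n. (2 * ln (real n) + 2) / real (d n)) \<longlonglongrightarrow> 0"
    by (simp add: Lim_transform_eventually)
  have "(\<lambda>n. ln (real (n choose d n)) / real (d n) - ?f n) \<longlonglongrightarrow> 0"
  proof (rule Lim_null_comparison[OF _ err])
    show "\<forall>\<^sub>F n in sequentially. norm (ln (real (n choose d n)) / real (d n) - ?f n) \<le> (2 * ln (real n) + 2) / real (d n)"
      using d_ev by eventually_elim (use ln_binomial_bounds in simp)
  qed
  from tendsto_add[OF this f] show ?thesis
    by (simp add: rate_const_def add.commute)
qed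

lemma tail_exp_rate: "(\<lambda>n. tail_exp (d n) * ln (1 - K / real (d n)) / real (d n)) \<longlonglongrightarrow> - K / 2"
proof -
  have "(\<lambda>n. ((real (d n) - 1) * (real (d n) / 2 - 1)) * ln (1 - K / real (d n)) / real (d n)) \<longlonglongrightarrow> - K / 2"
    by (rule filterlim_compose[OF tail_rate real_d_top])
  moreover have "\<forall>\<^sub>F n in sequentially. ((real (d n) - 1) * (real (d n) / 2 - 1)) * ln (1 - K / real (d n)) / real (d n)
      = tail_exp (d n) * ln (1 - K / real (d n)) / real (d n)"
    using d_ev by eventually_elim (simp add: tail_exp_def of_nat_diff)
  ultimately show ?thesis by (rule Lim_transform_eventually)
qed

lemma eventually_one_minus_pos: "\<forall>\<^sub>F n in sequentially. 0 < 1 - K / real (d n)"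
proof -
  have "(\<lambda>n. 1 - K / real (d n)) \<longlonglongrightarrow> 1 - 0"
    by (intro tendsto_diff tendsto_const tendsto_divide_0[OF tendsto_const] filterlim_at_top_imp_at_infinity real_d_top)
  then show ?thesis by (rule order_tendstoD(1)) simp
qed

lemma sphere_cdf_rate: "(\<lambda>n. sphere_cdf (d n) (b / scale n)) \<longlonglongrightarrow> std_normal_cdf b"
  by (rule filterlim_compose[OF sphere_cdf_tendsto d_top])

lemma eventually_sphere_cdf_pos: "\<forall>\<^sub>F n in sequentially. 0 < sphere_cdf (d n) (b / scale n)"
  using order_tendstoD(1)[OF sphere_cdf_rate std_normal_cdf_pos] .

lemma sphere_cdf_power_rate:
  "(\<lambda>n. ln (sphere_cdf (d n) (b / scale n) ^ (n - d n)) / real (d n)) \<longlonglongrightarrow> \<rho> * ln (std_normal_cdf b)"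
proof -
  have "(\<lambda>n. (real n - real (d n)) / real (d n) * ln (sphere_cdf (d n) (b / scale n)))
     \<longlonglongrightarrow> \<rho> * ln (std_normal_cdf b)"
    using std_normal_cdf_pos[of b] by (intro tendsto_mult ratio tendsto_ln sphere_cdf_rate) auto
  moreover have "\<forall>\<^sub>F n in sequentially. (real n - real (d n)) / real (d n) * ln (sphere_cdf (d n) (b / scale n))
     = ln (sphere_cdf (d n) (b / scale n) ^ (n - d n)) / real (d n)"
    using d_ev eventually_sphere_cdf_pos[of b] by eventually_elim (simp add: ln_realpow of_nat_diff)
  ultimately show ?thesis by (rule Lim_transform_eventually)
qed

lemma upper_tendsto_0:
  assumes f: "\<forall>\<^sub>F n in sequentially. 0 < f n" "(\<lambda>n. ln (f n) / real (d n)) \<longlonglongrightarrow> G"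
    and neg: "rate_const \<rho> + - K / 2 + G < 0"
  shows "(\<lambda>n. real (n choose d n) * (1 - K / real (d n)) powr tail_exp (d n) * f n) \<longlonglongrightarrow> 0"
proof (rule exp_rate_tendsto_0[OF d_top _ _ neg])
  show "\<forall>\<^sub>F n in sequentially. 0 < real (n choose d n) * (1 - K / real (d n)) powr tail_exp (d n) * f n"
    using d_ev eventually_one_minus_pos[of K] f(1) by eventually_elim simp
  have "(\<lambda>n. ln (real (n choose d n)) / real (d n) + tail_exp (d n) * ln (1 - K / real (d n)) / real (d n)
      + ln (f n) / real (d n)) \<longlonglongrightarrow> rate_const \<rho> + - K / 2 + G"
    by (intro tendsto_add binomial_rate tail_exp_rate f)
  moreover have "\<forall>\<^sub>F n in sequentially. ln (real (n choose d n)) / real (d n) + tail_exp (d n) * ln (1 - K / real (d n)) / real (d n)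
      + ln (f n) / real (d n) = ln (real (n choose d n) * (1 - K / real (d n)) powr tail_exp (d n) * f n) / real (d n)"
    using d_ev eventually_one_minus_pos[of K] f(1)
    by eventually_elim (simp add: ln_mult ln_powr add_divide_distrib)
  ultimately show "(\<lambda>n. ln (real (n choose d n) * (1 - K / real (d n)) powr tail_exp (d n) * f n) / real (d n))
    \<longlonglongrightarrow> rate_const \<rho> + - K / 2 + G"
    by (rule Lim_transform_eventually)
qed

lemma tail_upper_tendsto_0:
  assumes "rate_const \<rho> - K / 2 < 0"
  shows "(\<lambda>n. real (n choose d n) * (1 - K / real (d n)) powr tail_exp (d n)) \<longlonglongrightarrow> 0"
  using upper_tendsto_0[of "\<lambda>_. 1" 0 K] assms by simp

lemma local_upper_tendsto_0:
  assumes "rate_const \<rho> - K / 2 + \<rho> * ln (std_normal_cdf b) < 0"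
  shows "(\<lambda>n. real (n choose d n) * (1 - K / real (d n)) powr tail_exp (d n)
    * sphere_cdf (d n) (b / scale n) ^ (n - d n)) \<longlonglongrightarrow> 0"
proof (rule upper_tendsto_0[OF _ sphere_cdf_power_rate])
  show "\<forall>\<^sub>F n in sequentially. 0 < sphere_cdf (d n) (b / scale n) ^ (n - d n)"
    using eventually_sphere_cdf_pos[of b] by eventually_elim simp
qed (use assms in simp)

text \<open>As \<open>e\<close> tends to 0, the exponent of the upper bound for the window around
  \<open>s\<close> tends to \<open>g_rate \<rho> s\<close>, so it is still negative for some
  positive \<open>e\<close>.\<close>

lemma facet_expectation_local_0:
  assumes g: "g_rate \<rho> s < 0"
  shows "\<exists>e>0. (\<lambda>n. window n (s - e) (s + e)) \<longlonglongrightarrow> 0"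
proof -
  \<comment> \<open>Heights of the window have rescaled modulus at least
    \<open>\<bar>s\<bar> - e\<close>; subtracting \<open>2 * e\<close> gives the strict inequality
    demanded by the tail bound. Near 0 the maximum makes \<open>K\<close> vanish and the trivial
    bound applies.\<close>
  let ?K = "\<lambda>e. (max 0 (\<bar>s\<bar> - 2 * e))\<^sup>2"
  let ?\<phi> = "\<lambda>e. rate_const \<rho> - ?K e / 2 + \<rho> * ln (std_normal_cdf (s + e))"
  have "isCont ?\<phi> 0"
    by (intro continuous_intros isCont_o2[OF _ isCont_ln_std_normal_cdf]) auto
  then have "(?\<phi> \<longlongrightarrow> ?\<phi> 0) (at_right 0)"
    unfolding isCont_def by (rule tendsto_within_subset) auto
  moreover have "?\<phi> 0 = g_rate \<rho> s"
    by (simp add: g_rate_eq)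
  ultimately have "\<forall>\<^sub>F e in at_right 0. ?\<phi> e < 0"
    using g by (auto intro: order_tendstoD(2))
  moreover have "\<forall>\<^sub>F e in at_right (0::real). 0 < e" by (simp add: eventually_at_right_less)
  ultimately have "\<forall>\<^sub>F e in at_right 0. ?\<phi> e < 0 \<and> 0 < e" by eventually_elim simp
  then have "\<exists>e. ?\<phi> e < 0 \<and> 0 < e"
    by (rule eventually_happens'[OF trivial_limit_at_right_real])
  then obtain e where e: "0 < e" "?\<phi> e < 0" by (elim exE conjE)
  define K where "K = ?K e"
  have "(\<lambda>n. window n (s - e) (s + e)) \<longlonglongrightarrow> 0"
  proof (rule ennreal_null_comparison)
    show "(\<lambda>n. real (n choose d n) * (1 - K / real (d n)) powr tail_exp (d n)
      * sphere_cdf (d n) ((s + e) / scale n) ^ (n - d n)) \<longlonglongrightarrow> 0"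
      using e(2) unfolding K_def by (rule local_upper_tendsto_0)
    show "\<forall>\<^sub>F n in sequentially. window n (s - e) (s + e)
      \<le> ennreal (2 * (real (n choose d n) * (1 - K / real (d n)) powr tail_exp (d n)
        * sphere_cdf (d n) ((s + e) / scale n) ^ (n - d n)))"
      using d_ev eventually_one_minus_pos[of K]
    proof eventually_elim
      case (elim n)
      have q: "scale n > 0" "(scale n)\<^sup>2 = real (d n)" using elim by auto
      show ?case
      proof (rule facet_expectation_upper)
        show "K / real (d n) = 0 \<or> (\<forall>h\<in>{(s - e) / scale n..(s + e) / scale n}. K / real (d n) < h\<^sup>2)"
        proof (cases "\<bar>s\<bar> - 2 * e > 0")
          case True
          have "K / real (d n) < h\<^sup>2" if h: "h \<in> {(s - e) / scale n..(s + e) / scale n}" for h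
          proof -
            have "s - e \<le> h * scale n" "h * scale n \<le> s + e" using h q by (auto simp: field_simps)
            then have "\<bar>s\<bar> - 2 * e < \<bar>h * scale n\<bar>" using e(1) by linarith
            then have "K < \<bar>h * scale n\<bar>\<^sup>2"
              unfolding K_def using True by (intro power_strict_mono) auto
            then have "K < h\<^sup>2 * real (d n)" using q by (simp add: power_mult_distrib)
            then show ?thesis using elim by (simp add: field_simps)
          qed
          then show ?thesis by blast
        next
          case False
          then show ?thesis by (simp add: K_def max_def)
        qed
      qed (use elim in \<open>auto simp: K_def\<close>)
    qed
  qed
  then show ?thesis using e(1) by blast
qed

lemma facet_expectation_compact_0:
  assumes g: "\<And>s. s \<in> {lo..hi} \<Longrightarrow> g_rate \<rho> s < 0"
  shows "(\<lambda>n. window n lo hi) \<longlonglongrightarrow> 0"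
proof -
  have "\<forall>s\<in>{lo..hi}. \<exists>e>0. (\<lambda>n. window n (s - e) (s + e)) \<longlonglongrightarrow> 0"
    using facet_expectation_local_0 g by blast
  from bchoice[OF this] obtain e where e': "\<forall>s\<in>{lo..hi}. 0 < e s \<and>
      (\<lambda>n. window n (s - e s) (s + e s)) \<longlonglongrightarrow> 0" ..
  have e: "\<And>s. s \<in> {lo..hi} \<Longrightarrow> 0 < e s"
    "\<And>s. s \<in> {lo..hi} \<Longrightarrow> (\<lambda>n. window n (s - e s) (s + e s)) \<longlonglongrightarrow> 0"
    using e' by simp_all
  obtain D where D: "D \<subseteq> {lo..hi}" "finite D" "{lo..hi} \<subseteq> (\<Union>s\<in>D. {s - e s<..<s + e s})"
  proof (rule compactE_image[of "{lo..hi}" "{lo..hi}" "\<lambda>s. {s - e s<..<s + e s}"])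
    show "{lo..hi} \<subseteq> (\<Union>s\<in>{lo..hi}. {s - e s<..<s + e s})" using e(1) by force
  qed auto
  show ?thesis
  proof (rule tendsto_sandwich[OF _ _ tendsto_const])
    have "(\<lambda>n. \<Sum>s\<in>D. window n (s - e s) (s + e s))
      \<longlonglongrightarrow> (\<Sum>s\<in>D. 0)"
      by (rule tendsto_sum) (use e(2) D(1) in blast)
    then show "(\<lambda>n. \<Sum>s\<in>D. window n (s - e s) (s + e s)) \<longlonglongrightarrow> 0"
      by simp
    show "\<forall>\<^sub>F n in sequentially. window n lo hi
      \<le> (\<Sum>s\<in>D. window n (s - e s) (s + e s))"
      using d_ev
    proof eventually_elim
      case (elim n)
      let ?c = "\<lambda>s. ((s - e s) / scale n, (s + e s) / scale n)"
      have q: "scale n > 0" using elim by auto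
      have "window n lo hi \<le> (\<Sum>(a, b)\<in>?c ` D. facet_expectation (d n) n a b)"
      proof (rule facet_expectation_subadd)
        show "{lo / scale n..hi / scale n} \<subseteq> (\<Union>(a, b)\<in>?c ` D. {a..b})"
        proof
          fix h assume "h \<in> {lo / scale n..hi / scale n}"
          then have "h * scale n \<in> {lo..hi}" using q by (auto simp: field_simps)
          then obtain s where s: "s \<in> D" "h * scale n \<in> {s - e s<..<s + e s}" using D(3) by blast
          then have "h \<in> {(s - e s) / scale n..(s + e s) / scale n}" using q by (auto simp: field_simps)
          then show "h \<in> (\<Union>(a, b)\<in>?c ` D. {a..b})" using s(1) by auto
        qed
      qed (use elim D in auto)
      also have "\<dots> \<le> (\<Sum>s\<in>D. window n (s - e s) (s + e s))"
        using sum_image_le[OF D(2), of "\<lambda>(a, b). facet_expectation (d n) n a b" ?c] by simp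
      finally show ?case .
    qed
  qed simp
qed

text \<open>Heights up to 1 correspond to rescaled heights up to \<open>sqrt d\<close>, beyond the
  reach of a compactness argument. There the tail of the distance alone beats the binomial
  coefficient and the cap probability is bounded by 1. The gap between \<open>K\<close> and
  \<open>2 * K\<close> supplies strictness.\<close>

lemma facet_expectation_tail_0:
  assumes K: "0 < K" "rate_const \<rho> - K\<^sup>2 / 2 < 0"
  shows "(\<lambda>n. facet_expectation (d n) n (- 1) (- (2 * K) / scale n)) \<longlonglongrightarrow> 0"
    and "(\<lambda>n. facet_expectation (d n) n (2 * K / scale n) 1) \<longlonglongrightarrow> 0"
proof -
  have bound: "(\<lambda>n. facet_expectation (d n) n (h1 n) (h2 n)) \<longlonglongrightarrow> 0"
    if h: "\<And>n h. h \<in> {h1 n..h2 n} \<Longrightarrow> 2 * K / scale n \<le> \<bar>h\<bar>" for h1 h2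
  proof (rule ennreal_null_comparison[OF _ tail_upper_tendsto_0[OF K(2)]])
    show "\<forall>\<^sub>F n in sequentially. facet_expectation (d n) n (h1 n) (h2 n)
      \<le> ennreal (2 * (real (n choose d n) * (1 - K\<^sup>2 / real (d n)) powr tail_exp (d n)))"
      using d_ev eventually_one_minus_pos[of "K\<^sup>2"]
    proof eventually_elim
      case (elim n)
      have q: "scale n > 0" "(scale n)\<^sup>2 = real (d n)" and d0: "0 < d n" using elim by auto
      have "facet_expectation (d n) n (h1 n) (h2 n)
        \<le> ennreal (2 * (real (n choose d n) * (1 - K\<^sup>2 / real (d n)) powr tail_exp (d n) * sphere_cdf (d n) (h2 n) ^ (n - d n)))"
      proof (rule facet_expectation_upper)
        have "K\<^sup>2 / real (d n) < x\<^sup>2" if "x \<in> {h1 n..h2 n}" for x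
        proof -
          have "(K / scale n)\<^sup>2 < (2 * K / scale n)\<^sup>2" using K q by (intro power_strict_mono) (auto simp: divide_strict_right_mono)
          also have "\<dots> \<le> \<bar>x\<bar>\<^sup>2" using h[OF that] K q by (intro power_mono) auto
          finally show ?thesis using q by (simp add: power_divide)
        qed
        then show "K\<^sup>2 / real (d n) = 0 \<or> (\<forall>h\<in>{h1 n..h2 n}. K\<^sup>2 / real (d n) < h\<^sup>2)" by blast
      qed (use elim in auto)
      also have "\<dots> \<le> ennreal (2 * (real (n choose d n) * (1 - K\<^sup>2 / real (d n)) powr tail_exp (d n)))"
        using sphere_cdf_bounds[OF d0, of "h2 n"]
        by (intro ennreal_leI mult_left_mono mult_left_le) (auto intro: power_le_one)
      finally show ?case .
    qed
  qed
  have "2 * K / scale n \<le> \<bar>h\<bar>" if "h \<in> {- 1..- (2 * K) / scale n}" for n h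
    using that by auto
  then show "(\<lambda>n. facet_expectation (d n) n (- 1) (- (2 * K) / scale n)) \<longlonglongrightarrow> 0"
    by (rule bound)
  have "2 * K / scale n \<le> \<bar>h\<bar>" if "h \<in> {2 * K / scale n..1}" for n h
    using that by auto
  then show "(\<lambda>n. facet_expectation (d n) n (2 * K / scale n) 1) \<longlonglongrightarrow> 0"
    by (rule bound)
qed

lemma exists_tail: "\<exists>K>0. \<bar>r\<bar> < 2 * K \<and> rate_const \<rho> - K\<^sup>2 / 2 < 0"
proof -
  define K where "K = max (\<bar>r\<bar> + 1) (sqrt (2 * \<bar>rate_const \<rho>\<bar>) + 1)"
  have "(sqrt (2 * \<bar>rate_const \<rho>\<bar>))\<^sup>2 < K\<^sup>2"
    by (rule power_strict_mono) (auto simp: K_def max_def)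
  then have "rate_const \<rho> - K\<^sup>2 / 2 < 0" by auto
  moreover have "0 < K" "\<bar>r\<bar> < 2 * K" by (auto simp: K_def max_def)
  ultimately show ?thesis by blast
qed

lemma facet_expectation_lower_0:
  assumes r: "r < r_lower \<rho>"
  shows "(\<lambda>n. facet_expectation (d n) n (- 1) (r / scale n)) \<longlonglongrightarrow> 0"
proof -
  obtain K where K: "0 < K" "\<bar>r\<bar> < 2 * K" "rate_const \<rho> - K\<^sup>2 / 2 < 0" using exists_tail by blast
  have "(\<lambda>n. facet_expectation (d n) n (- 1) (- (2 * K) / scale n) + window n (- (2 * K)) r) \<longlonglongrightarrow> 0 + 0"
    using r by (intro tendsto_add facet_expectation_tail_0 K facet_expectation_compact_0 g_rate_neg_below \<rho>) auto
  then have lim: "(\<lambda>n. facet_expectation (d n) n (- 1) (- (2 * K) / scale n) + window n (- (2 * K)) r) \<longlonglongrightarrow> 0"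
    by simp
  show ?thesis
    by (rule tendsto_sandwich[OF _ _ tendsto_const lim])
       (use d_ev in \<open>simp, eventually_elim, auto intro: facet_expectation_split\<close>)
qed

lemma facet_expectation_upper_0:
  assumes r: "r > r_upper \<rho>"
  shows "(\<lambda>n. facet_expectation (d n) n (r / scale n) 1) \<longlonglongrightarrow> 0"
proof -
  obtain K where K: "0 < K" "\<bar>r\<bar> < 2 * K" "rate_const \<rho> - K\<^sup>2 / 2 < 0" using exists_tail by blast
  have "(\<lambda>n. window n r (2 * K) + facet_expectation (d n) n (2 * K / scale n) 1) \<longlonglongrightarrow> 0 + 0"
    using r by (intro tendsto_add facet_expectation_tail_0 K facet_expectation_compact_0 g_rate_neg_above \<rho>) auto
  then have lim: "(\<lambda>n. window n r (2 * K) + facet_expectation (d n) n (2 * K / scale n) 1) \<longlonglongrightarrow> 0"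
    by simp
  show ?thesis
    by (rule tendsto_sandwich[OF _ _ tendsto_const lim])
       (use d_ev in \<open>simp, eventually_elim, auto intro: facet_expectation_split\<close>)
qed

text \<open>The tail \<open>B\<close> beyond the outer end has a smaller exponential rate than the
  main term \<open>A\<close>, whose first \<open>d - 1\<close> points are kept at level
  \<open>t\<close>; so \<open>A - B\<close> is eventually at least half of \<open>A\<close>. The
  remaining exponent tends to \<open>g_rate \<rho> s\<close> as \<open>e\<close> tends to 0.\<close>

lemma facet_expectation_local_top:
  assumes g: "g_rate \<rho> s > 0" and s: "s \<noteq> 0" and \<delta>: "0 < \<delta>"
  shows "\<exists>e. 0 < e \<and> e < \<delta> \<and>
    (\<lambda>n. window n (s - e) (s + e)) \<longlonglongrightarrow> \<infinity>"
proof -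
  let ?\<phi> = "\<lambda>e. rate_const \<rho> - s\<^sup>2 / 2 + \<rho> * ln (std_normal_cdf (s - e))"
  have "isCont ?\<phi> 0"
    by (intro continuous_intros isCont_o2[OF _ isCont_ln_std_normal_cdf]) auto
  then have "(?\<phi> \<longlongrightarrow> ?\<phi> 0) (at_right 0)"
    unfolding isCont_def by (rule tendsto_within_subset) auto
  moreover have "?\<phi> 0 = g_rate \<rho> s"
    by (simp add: g_rate_eq)
  ultimately have "\<forall>\<^sub>F e in at_right 0. 0 < ?\<phi> e"
    using g by (auto intro: order_tendstoD(1))
  moreover have "\<forall>\<^sub>F e in at_right (0::real). e \<in> {0<..<min \<delta> \<bar>s\<bar>}"
    using \<delta> s by (intro eventually_at_right_real) auto
  ultimately have "\<forall>\<^sub>F e in at_right 0. 0 < ?\<phi> e \<and> e \<in> {0<..<min \<delta> \<bar>s\<bar>}" by eventually_elim simp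
  then have "\<exists>e. 0 < ?\<phi> e \<and> e \<in> {0<..<min \<delta> \<bar>s\<bar>}"
    by (rule eventually_happens'[OF trivial_limit_at_right_real])
  then obtain e where "0 < ?\<phi> e" "e \<in> {0<..<min \<delta> \<bar>s\<bar>}" by (elim exE conjE)
  then have e: "0 < e" "e < \<delta>" "e < \<bar>s\<bar>" "0 < ?\<phi> e" by auto
  \<comment> \<open>Modulus and sign of \<open>s\<close>: as \<open>e < t\<close>, all heights of
    the window have the sign of \<open>s\<close>, and only the summand with that sign is
    used.\<close>
  define t where "t = \<bar>s\<bar>"
  define \<sigma> where "\<sigma> = sgn s"
  have \<sigma>: "\<sigma> \<in> {1, -1}" using s by (auto simp: \<sigma>_def sgn_if)
  let ?F = "\<lambda>n. sphere_cdf (d n) ((s - e) / scale n) ^ (n - d n)"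
  \<comment> \<open>The scale \<open>sqrt d\<close> cancels in the ratio of the two levels, so this
    factor does not depend on \<open>n\<close>.\<close>
  define c where "c = (1 - (t - e)\<^sup>2 / t\<^sup>2) powr (1 / 2)"
  have te: "0 < t - e" "t - e < t" "t < t + e" using e by (auto simp: t_def)
  have "(t - e)\<^sup>2 < t\<^sup>2" using te by (intro power_strict_mono) auto
  then have c: "c > 0" using te by (simp add: c_def)
  define A where "A = (\<lambda>n. c * (1 - (t - e)\<^sup>2 / real (d n)) powr (real (d n - 1) / 2) / real (d n - 1)
      * (1 - t\<^sup>2 / real (d n)) powr tail_exp (d n))"
  define B where "B = (\<lambda>n. (1 - (t + e)\<^sup>2 / real (d n)) powr tail_exp (d n))"
  have pos: "\<forall>\<^sub>F n in sequentially. 0 < A n \<and> 0 < B n"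
    using d_ev eventually_one_minus_pos[of "(t - e)\<^sup>2"] eventually_one_minus_pos[of "t\<^sup>2"] eventually_one_minus_pos[of "(t + e)\<^sup>2"]
    by eventually_elim (use c in \<open>simp add: A_def B_def\<close>)
  have Arate: "(\<lambda>n. ln (A n) / real (d n)) \<longlonglongrightarrow> - t\<^sup>2 / 2"
  proof -
    have "(\<lambda>n. (ln c + (real (d n) - 1) / 2 * ln (1 - (t - e)\<^sup>2 / real (d n)) - ln (real (d n) - 1)) / real (d n)
      + tail_exp (d n) * ln (1 - t\<^sup>2 / real (d n)) / real (d n)) \<longlonglongrightarrow> 0 + - t\<^sup>2 / 2"
      by (intro tendsto_add tail_exp_rate filterlim_compose[OF tail_rate' real_d_top])
    moreover have "\<forall>\<^sub>F n in sequentially. (ln c + (real (d n) - 1) / 2 * ln (1 - (t - e)\<^sup>2 / real (d n)) - ln (real (d n) - 1)) / real (d n)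
      + tail_exp (d n) * ln (1 - t\<^sup>2 / real (d n)) / real (d n) = ln (A n) / real (d n)"
      using d_ev eventually_one_minus_pos[of "(t - e)\<^sup>2"] eventually_one_minus_pos[of "t\<^sup>2"]
    proof eventually_elim
      case (elim n)
      then show ?case
        using c by (simp add: A_def ln_mult ln_div ln_powr of_nat_diff add_divide_distrib[symmetric])
    qed
    ultimately show ?thesis by (simp add: Lim_transform_eventually)
  qed
  have Brate: "(\<lambda>n. ln (B n) / real (d n)) \<longlonglongrightarrow> - (t + e)\<^sup>2 / 2"
  proof -
    have "\<forall>\<^sub>F n in sequentially. tail_exp (d n) * ln (1 - (t + e)\<^sup>2 / real (d n)) / real (d n) = ln (B n) / real (d n)"
      using eventually_one_minus_pos[of "(t + e)\<^sup>2"] by eventually_elim (simp add: B_def ln_powr)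
    with tail_exp_rate[of "(t + e)\<^sup>2"] show ?thesis by (rule Lim_transform_eventually)
  qed
  have "(\<lambda>n. B n / A n) \<longlonglongrightarrow> 0"
  proof (rule exp_rate_tendsto_0[OF d_top])
    show "\<forall>\<^sub>F n in sequentially. 0 < B n / A n" using pos by eventually_elim simp
    have "(\<lambda>n. ln (B n) / real (d n) - ln (A n) / real (d n)) \<longlonglongrightarrow> - (t + e)\<^sup>2 / 2 - - t\<^sup>2 / 2"
      by (intro tendsto_diff Arate Brate)
    moreover have "\<forall>\<^sub>F n in sequentially. ln (B n) / real (d n) - ln (A n) / real (d n) = ln (B n / A n) / real (d n)"
      using pos by eventually_elim (simp add: ln_div diff_divide_distrib)
    ultimately show "(\<lambda>n. ln (B n / A n) / real (d n)) \<longlonglongrightarrow> - (t + e)\<^sup>2 / 2 - - t\<^sup>2 / 2"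
      by (rule Lim_transform_eventually)
    have "t\<^sup>2 < (t + e)\<^sup>2" using te by (intro power_strict_mono) auto
    then show "- (t + e)\<^sup>2 / 2 - - t\<^sup>2 / 2 < 0" by simp
  qed
  then have "\<forall>\<^sub>F n in sequentially. B n / A n < 1 / 2" by (rule order_tendstoD(2)) simp
  with pos have AB: "\<forall>\<^sub>F n in sequentially. A n / 2 \<le> A n - B n"
    by eventually_elim (simp add: field_simps)
  define f where "f = (\<lambda>n. real (n choose d n) * (?F n * (A n / 2)))"
  have f_top: "filterlim f at_top sequentially"
  proof (rule exp_rate_at_top[OF d_top])
    show "\<forall>\<^sub>F n in sequentially. 0 < f n"
      using pos d_ev eventually_sphere_cdf_pos[of "s - e"] by eventually_elim (simp add: f_def)
    have "(\<lambda>n. ln 2 / real (d n)) \<longlonglongrightarrow> 0"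
      by (intro tendsto_divide_0[OF tendsto_const] filterlim_at_top_imp_at_infinity real_d_top)
    then have "(\<lambda>n. ln (real (n choose d n)) / real (d n) + ln (?F n) / real (d n) + ln (A n) / real (d n) - ln 2 / real (d n))
      \<longlonglongrightarrow> rate_const \<rho> + \<rho> * ln (std_normal_cdf (s - e)) + - t\<^sup>2 / 2 - 0"
      by (intro tendsto_diff tendsto_add binomial_rate sphere_cdf_power_rate Arate)
    moreover have "\<forall>\<^sub>F n in sequentially. ln (real (n choose d n)) / real (d n) + ln (?F n) / real (d n) + ln (A n) / real (d n) - ln 2 / real (d n)
       = ln (f n) / real (d n)"
      using pos d_ev eventually_sphere_cdf_pos[of "s - e"]
    proof eventually_elim
      case (elim n)
      have "ln (f n) = ln (real (n choose d n)) + (ln (?F n) + (ln (A n) - ln 2))"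
        using elim by (simp add: f_def ln_mult ln_div)
      then show ?case by (simp add: add_divide_distrib diff_divide_distrib)
    qed
    ultimately show "(\<lambda>n. ln (f n) / real (d n)) \<longlonglongrightarrow> rate_const \<rho> + \<rho> * ln (std_normal_cdf (s - e)) + - t\<^sup>2 / 2 - 0"
      by (rule Lim_transform_eventually)
    show "0 < rate_const \<rho> + \<rho> * ln (std_normal_cdf (s - e)) + - t\<^sup>2 / 2 - 0"
      using e(4) by (simp add: t_def)
  qed
  have lower: "\<forall>\<^sub>F n in sequentially. ennreal (f n) \<le> window n (s - e) (s + e)"
    using d_ev AB eventually_d_ge[of 3] eventually_one_minus_pos[of "(t + e)\<^sup>2"]
  proof eventually_elim
    case (elim n)
    have q: "scale n > 0" "(scale n)\<^sup>2 = real (d n)" and d3: "3 \<le> d n" and d0: "0 < d n" using elim by auto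
    have lo: "(if \<sigma> = 1 then (t - e) / scale n else - ((t + e) / scale n)) = (s - e) / scale n"
      and hi: "(if \<sigma> = 1 then (t + e) / scale n else - ((t - e) / scale n)) = (s + e) / scale n"
      using s by (auto simp: \<sigma>_def t_def sgn_if abs_if minus_divide_left simp del: divide_minus_left)
    have sq: "(x / scale n)\<^sup>2 = x\<^sup>2 / real (d n)" for x using q by (simp add: power_divide)
    have lt1: "(t + e) / scale n < 1"
    proof -
      have "((t + e) / scale n)\<^sup>2 < 1" using elim by (simp add: sq)
      then show ?thesis using power2_less_imp_less[of "(t + e) / scale n" 1] by simp
    qed
    have "ennreal (sphere_cdf (d n) (if \<sigma> = 1 then (t - e) / scale n else - ((t + e) / scale n)) ^ (n - d n) *
      ((1 - ((t - e) / scale n)\<^sup>2 / (t / scale n)\<^sup>2) powr (1 / 2) * (1 - ((t - e) / scale n)\<^sup>2) powr (real (d n - 1) / 2) / real (d n - 1)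
          * (1 - (t / scale n)\<^sup>2) powr tail_exp (d n)
        - (1 - ((t + e) / scale n)\<^sup>2) powr tail_exp (d n)))
      \<le> facet_integral (d n) n ((s - e) / scale n) ((s + e) / scale n) \<sigma>"
      by (rule facet_integral_lower[OF d3 _ _ _ lt1 \<sigma>])
         (use te q lo hi in \<open>auto simp: divide_strict_right_mono\<close>)
    moreover have "((t - e) / scale n)\<^sup>2 / (t / scale n)\<^sup>2 = (t - e)\<^sup>2 / t\<^sup>2"
      using q te by (simp add: power_divide)
    ultimately have low: "ennreal (?F n * (A n - B n)) \<le> facet_integral (d n) n ((s - e) / scale n) ((s + e) / scale n) \<sigma>"
      by (simp only: lo sq A_def B_def c_def)
    have F0: "0 \<le> ?F n" using sphere_cdf_bounds[OF d0] by simp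
    have "ennreal (f n) = of_nat (n choose d n) * ennreal (?F n * (A n / 2))"
      unfolding f_def by (simp only: ennreal_mult'[OF of_nat_0_le_iff] ennreal_of_nat_eq_real_of_nat)
    also have "\<dots> \<le> of_nat (n choose d n) * ennreal (?F n * (A n - B n))"
      using elim F0 by (intro mult_left_mono ennreal_leI) auto
    also have "\<dots> \<le> of_nat (n choose d n) * facet_integral (d n) n ((s - e) / scale n) ((s + e) / scale n) \<sigma>"
      using low by (rule mult_left_mono) simp
    also have "\<dots> \<le> window n (s - e) (s + e)"
      unfolding facet_expectation_def using \<sigma> by (intro mult_left_mono) (auto simp: add_increasing add_increasing2)
    finally show ?case .
  qed
  have f_lim: "(\<lambda>n. ennreal (f n)) \<longlonglongrightarrow> \<infinity>"
    using f_top by (simp add: ennreal_tendsto_top_eq_at_top)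
  have "(\<lambda>n. window n (s - e) (s + e)) \<longlonglongrightarrow> \<infinity>"
    by (rule tendsto_sandwich[OF lower _ f_lim tendsto_const]) simp
  then show ?thesis using e by blast
qed

section \<open>Divergence of the expected number of facets\<close>

lemma eventually_abs_le_1: "\<forall>\<^sub>F n in sequentially. - 1 \<le> x / scale n \<and> x / scale n \<le> 1"
  using eventually_d_ge[of "max 1 (x\<^sup>2)"]
proof eventually_elim
  case (elim n)
  have "\<bar>x\<bar> \<le> scale n" using elim by (intro real_le_rsqrt) auto
  moreover have "scale n > 0" using elim by simp
  ultimately have "\<bar>x / scale n\<bar> \<le> 1" by (simp add: field_simps abs_divide)
  then show ?case by linarith
qed

lemma facet_expectation_top:
  assumes g: "g_rate \<rho> s > 0" and \<delta>: "0 < \<delta>"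
    and win: "\<And>t. \<bar>t - s\<bar> < \<delta> \<Longrightarrow> \<forall>\<^sub>F n in sequentially. h1 n \<le> t / scale n \<and> t / scale n \<le> h2 n"
  shows "(\<lambda>n. facet_expectation (d n) n (h1 n) (h2 n)) \<longlonglongrightarrow> \<infinity>"
proof -
  \<comment> \<open>Half of \<open>\<delta>\<close> is spent on moving away from 0, the other half
    on the width of the window.\<close>
  obtain t where t: "t \<noteq> 0" "\<bar>t - s\<bar> < \<delta> / 2" "g_rate \<rho> t > 0"
    using g_rate_pos_nonzero[OF g, of "\<delta> / 2"] \<delta> by auto
  obtain e where e: "0 < e" "e < \<delta> / 2" and lim: "(\<lambda>n. window n (t - e) (t + e)) \<longlonglongrightarrow> \<infinity>"
    using facet_expectation_local_top[OF t(3,1), of "\<delta> / 2"] \<delta> by auto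
  have "\<forall>\<^sub>F n in sequentially. window n (t - e) (t + e) \<le> facet_expectation (d n) n (h1 n) (h2 n)"
  proof -
    have "\<bar>t - e - s\<bar> < \<delta>" "\<bar>t + e - s\<bar> < \<delta>" using t(2) e by linarith+
    from d_ev win[OF this(1)] win[OF this(2)] show ?thesis
      by eventually_elim (auto intro: facet_expectation_mono)
  qed
  then show ?thesis
    by (rule tendsto_sandwich[OF _ _ lim tendsto_const]) simp
qed

lemma facet_expectation_lower_top:
  assumes r: "r > r_lower \<rho>"
  shows "(\<lambda>n. facet_expectation (d n) n (- 1) (r / scale n)) \<longlonglongrightarrow> \<infinity>"
proof -
  have "{r. g_rate \<rho> r > 0} \<noteq> {}" using g_rate_pos_exists[OF \<rho>] by auto
  from cInf_lessD[OF this r[unfolded r_lower_def]] obtain s where s: "g_rate \<rho> s > 0" "s < r" by auto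
  show ?thesis
  proof (rule facet_expectation_top[OF s(1), of "r - s"])
    fix t assume "\<bar>t - s\<bar> < r - s"
    then have "t \<le> r" by auto
    then show "\<forall>\<^sub>F n in sequentially. - 1 \<le> t / scale n \<and> t / scale n \<le> r / scale n"
      using eventually_abs_le_1[of t] by (auto elim!: eventually_mono intro: divide_right_mono)
  qed (use s in simp)
qed

lemma facet_expectation_upper_top:
  assumes r: "r < r_upper \<rho>"
  shows "(\<lambda>n. facet_expectation (d n) n (r / scale n) 1) \<longlonglongrightarrow> \<infinity>"
proof -
  have "{r. g_rate \<rho> r > 0} \<noteq> {}" using g_rate_pos_exists[OF \<rho>] by auto
  from less_cSupD[OF this r[unfolded r_upper_def]] obtain s where s: "g_rate \<rho> s > 0" "r < s" by auto
  show ?thesis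
  proof (rule facet_expectation_top[OF s(1), of "s - r"])
    fix t assume "\<bar>t - s\<bar> < s - r"
    then have "r \<le> t" by auto
    then show "\<forall>\<^sub>F n in sequentially. r / scale n \<le> t / scale n \<and> t / scale n \<le> 1"
      using eventually_abs_le_1[of t] by (auto elim!: eventually_mono intro: divide_right_mono)
  qed (use s in simp)
qed

end

text \<open>A constant dimension would make the ratio diverge.\<close>

lemma dimension_unbounded:
  fixes d :: "nat \<Rightarrow> nat"
  assumes "\<forall>\<^sub>F n in sequentially. 2 \<le> d n"
    and "(\<exists>c. \<forall>\<^sub>F n in sequentially. d n = c) \<or> filterlim d at_top sequentially"
    and ratio: "(\<lambda>n. (real n - real (d n)) / real (d n)) \<longlonglongrightarrow> \<rho>"
  shows "filterlim d at_top sequentially"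
proof (rule ccontr)
  assume "\<not> ?thesis"
  then obtain c where c: "\<forall>\<^sub>F n in sequentially. d n = c" using assms(2) by blast
  have "\<forall>\<^sub>F n in sequentially. 2 \<le> c" using assms(1) c by eventually_elim simp
  then have c2: "2 \<le> c" using eventually_happens'[OF sequentially_bot] by blast
  have "\<forall>\<^sub>F n in sequentially. (real n - real (d n)) / real (d n) = (real n - real c) / real c"
    using c by eventually_elim simp
  with ratio have "(\<lambda>n. (real n - real c) / real c) \<longlonglongrightarrow> \<rho>" by (rule Lim_transform_eventually)
  moreover have "filterlim (\<lambda>n. (real n - real c) / real c) at_top sequentially"
    using c2 by real_asymp
  ultimately show False
    using not_tendsto_and_filterlim_at_infinity[OF sequentially_bot] filterlim_at_top_imp_at_infinity by blast
qed

text \<open>That the set of positive rate is nonempty and bounded is the existence of the two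
  thresholds: only then are \<open>Inf\<close> and \<open>Sup\<close> its actual real infimum and
  supremum. Each \<open>n\<close> may use its own probability space.\<close>

theorem theorem7:
  fixes \<rho> :: real
    and d :: "nat \<Rightarrow> nat"
    and M :: "nat \<Rightarrow> 'a measure"
    and X :: "nat \<Rightarrow> nat \<Rightarrow> 'a \<Rightarrow> nat \<Rightarrow> real"
  assumes "\<rho> > 0"
    and "\<forall>\<^sub>F n in sequentially. 2 \<le> d n \<and> d n \<le> n - 1"
    and "(\<exists>c. \<forall>\<^sub>F n in sequentially. d n = c) \<or> filterlim d at_top sequentially"
    and "(\<lambda>n. (real n - real (d n)) / real (d n)) \<longlonglongrightarrow> \<rho>"
    and "\<forall>\<^sub>F n in sequentially. iid_uniform_sphere (M n) n (d n) (X n)"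
  shows "{r. g_rate \<rho> r > 0} \<noteq> {} \<and>
    bdd_below {r. g_rate \<rho> r > 0} \<and> bdd_above {r. g_rate \<rho> r > 0} \<and>
    (\<forall>r::real.
      (r > r_lower \<rho> \<longrightarrow>
        (\<lambda>n. expected_facets (M n) n (d n) (X n) (- 1) (r / sqrt (real (d n)))) \<longlonglongrightarrow> \<infinity>) \<and>
      (r < r_lower \<rho> \<longrightarrow>
        (\<lambda>n. expected_facets (M n) n (d n) (X n) (- 1) (r / sqrt (real (d n)))) \<longlonglongrightarrow> 0) \<and>
      (r < r_upper \<rho> \<longrightarrow>
        (\<lambda>n. expected_facets (M n) n (d n) (X n) (r / sqrt (real (d n))) 1) \<longlonglongrightarrow> \<infinity>) \<and>
      (r > r_upper \<rho> \<longrightarrow>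
        (\<lambda>n. expected_facets (M n) n (d n) (X n) (r / sqrt (real (d n))) 1) \<longlonglongrightarrow> 0))"
proof -
  have d_ev: "\<forall>\<^sub>F n in sequentially. 2 \<le> d n \<and> d n < n"
    using assms(2) by eventually_elim auto
  then have "\<forall>\<^sub>F n in sequentially. 2 \<le> d n" by eventually_elim simp
  then have d_top: "filterlim d at_top sequentially"
    by (rule dimension_unbounded[OF _ assms(3,4)])
  note asym = assms(1) d_top d_ev assms(4)
  have eq: "\<forall>\<^sub>F n in sequentially. facet_expectation (d n) n (h1 n) (h2 n)
    = expected_facets (M n) n (d n) (X n) (h1 n) (h2 n)" for h1 h2
    using d_ev assms(5) by eventually_elim (simp add: expected_facets_eq facet_expectation_def)
  show ?thesis
  proof (intro conjI allI impI)
    show "{r. g_rate \<rho> r > 0} \<noteq> {}" using g_rate_pos_exists[OF assms(1)] by auto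
    show "bdd_below {r. g_rate \<rho> r > 0}" "bdd_above {r. g_rate \<rho> r > 0}"
      using g_rate_bdd[OF assms(1)] by auto
  next
    fix r assume "r > r_lower \<rho>"
    from facet_expectation_lower_top[OF asym this]
    show "(\<lambda>n. expected_facets (M n) n (d n) (X n) (- 1) (r / sqrt (real (d n)))) \<longlonglongrightarrow> \<infinity>"
      by (rule Lim_transform_eventually) (rule eq)
  next
    fix r assume "r < r_lower \<rho>"
    from facet_expectation_lower_0[OF asym this]
    show "(\<lambda>n. expected_facets (M n) n (d n) (X n) (- 1) (r / sqrt (real (d n)))) \<longlonglongrightarrow> 0"
      by (rule Lim_transform_eventually) (rule eq)
  next
    fix r assume "r < r_upper \<rho>"
    from facet_expectation_upper_top[OF asym this]
    show "(\<lambda>n. expected_facets (M n) n (d n) (X n) (r / sqrt (real (d n))) 1) \<longlonglongrightarrow> \<infinity>"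
      by (rule Lim_transform_eventually) (rule eq)
  next
    fix r assume "r > r_upper \<rho>"
    from facet_expectation_upper_0[OF asym this]
    show "(\<lambda>n. expected_facets (M n) n (d n) (X n) (r / sqrt (real (d n))) 1) \<longlonglongrightarrow> 0"
      by (rule Lim_transform_eventually) (rule eq)
  qed
qed

end
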